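(* For any non-negative integer $s$, $(QP_5)_{15\cdot 2^s-5}^{GL_5}=0$; that is, the only $GL_5$-invariant element of $(QP_5)_{15\cdot 2^s-5}$ is $0$.
   Context: $P_n=\mathbb F_2[x_1,\ldots,x_n]$ is the graded polynomial algebra over the field $\mathbb F_2$ of two elements with $\deg x_i=1$. It is a module over the mod-2 Steenrod algebra $\mathcal A$: the Steenrod squares satisfy $Sq^0=\mathrm{id}$, $Sq^1(x_i)=x_i^2$, $Sq^k(x_i)=0$ for $k>1$, and the Cartan formula $Sq^k(fg)=\sum_{i=0}^k Sq^i(f)Sq^{k-i}(g)$. $\mathcal A^+$ is the augmentation ideal of $\mathcal A$, so $\mathcal A^+P_n$ is the span of all $Sq^j(g)$ with $j>0$, $g\in P_n$. $QP_n:=P_n/\mathcal A^+P_n$, and $(QP_n)_d$ is its degree $d$ part, consisting of classes of homogeneous polynomials of degree $d$. The general linear group $GL_n=GL_n(\mathbb F_2)$ acts on $P_n$ by algebra automorphisms given by linear substitution of the variables; this action commutes with that of $\mathcal A$ and hence induces an action on each $(QP_n)_d$. $(QP_n)_d^{GL_n}$ is the subspace of invariants. *)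

theory Defs
  imports
    "HOL-Analysis.Analysis"
    "HOL-Library.Poly_Mapping"
    "HOL-Library.Z2"
    "HOL-Computational_Algebra.Polynomial"
begin

text \<open>
  The variables are indexed by a finite type; a monomial is its exponent function, and \<^typ>\<open>bit\<close>
  is the field with two elements.
\<close>

type_synonym 'n P = "('n \<Rightarrow>\<^sub>0 nat) \<Rightarrow>\<^sub>0 bit"

definition X :: "'n \<Rightarrow> 'n P" where
  "X i = Poly_Mapping.single (Poly_Mapping.single i 1) 1"

definition const :: "bit \<Rightarrow> 'n P" where
  "const c = Poly_Mapping.single 0 c"

definition homogeneous :: "nat \<Rightarrow> 'n::finite P \<Rightarrow> bool" where
  "homogeneous d f \<longleftrightarrow> (\<forall>m\<in>Poly_Mapping.keys f. (\<Sum>i\<in>UNIV. Poly_Mapping.lookup m i) = d)"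

definition evalP :: "(bit \<Rightarrow> 'r::comm_ring_1) \<Rightarrow> ('n::finite \<Rightarrow> 'r) \<Rightarrow> 'n P \<Rightarrow> 'r" where
  "evalP h \<sigma> f = (\<Sum>m\<in>Poly_Mapping.keys f.
     h (Poly_Mapping.lookup f m) * (\<Prod>i\<in>UNIV. \<sigma> i ^ Poly_Mapping.lookup m i))"

lemma P_add_self [simp]: "(f::'n P) + f = 0"
proof (rule poly_mapping_eqI)
  fix m
  have "b + b = 0" for b :: bit by (cases b) simp_all
  then show "Poly_Mapping.lookup (f + f) m = Poly_Mapping.lookup 0 m"
    by (simp only: lookup_add lookup_zero)
qed

lemma P_two_mult [simp]: "2 * (f::'n P) = 0"
  using P_add_self[of f] by (simp only: mult_2)

lemma const_simps [simp]: "const 0 = 0" "const 1 = 1" "const (c + d) = const c + const d"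
    "const (c * d) = const c * const d"
  unfolding const_def by (simp_all only: single_zero single_one single_add mult_single add_0_left)

locale bit_hom =
  fixes h :: "bit \<Rightarrow> 'r::comm_ring_1"
  assumes h0 [simp]: "h 0 = 0" and h1 [simp]: "h 1 = 1"
    and hadd: "h (c + d) = h c + h d"
begin

lemma hmult: "h (c * d) = h c * h d"
  by (cases c; cases d) simp_all

lemma evalP_superset:
  assumes "finite K" "Poly_Mapping.keys f \<subseteq> K"
  shows "evalP h \<sigma> f =
    (\<Sum>m\<in>K. h (Poly_Mapping.lookup f m) * (\<Prod>i\<in>UNIV. \<sigma> i ^ Poly_Mapping.lookup m i))"
  unfolding evalP_def using assms
  by (intro sum.mono_neutral_left) (auto simp: in_keys_iff)

lemma evalP_0 [simp]: "evalP h \<sigma> 0 = 0"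
  by (simp add: evalP_def)

lemma evalP_add: "evalP h \<sigma> (f + g) = evalP h \<sigma> f + evalP h \<sigma> g"
proof -
  let ?K = "Poly_Mapping.keys f \<union> Poly_Mapping.keys g"
  have "Poly_Mapping.keys (f + g) \<subseteq> ?K" by (rule Poly_Mapping.keys_add)
  then show ?thesis
    by (simp only: evalP_superset[where K = ?K] finite_Un finite_keys Un_upper1 Un_upper2
        lookup_add hadd distrib_right sum.distrib)
qed

lemma evalP_single:
  "evalP h \<sigma> (Poly_Mapping.single m c) = h c * (\<Prod>i\<in>UNIV. \<sigma> i ^ Poly_Mapping.lookup m i)"
  by (subst evalP_superset[where K = "{m}"]) auto

end

lemma P_induct [case_names zero add]:
  fixes f :: "'n P"
  assumes "Q 0" and "\<And>m c f. Q f \<Longrightarrow> Q (Poly_Mapping.single m c + f)"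
  shows "Q f"
proof (induction f rule: update_induct)
  case const
  then show ?case using assms(1) by simp
next
  case (update f a b)
  have "Poly_Mapping.update a b f = Poly_Mapping.single a b + f"
    using update by (intro poly_mapping_eqI)
      (auto simp: lookup_update lookup_add lookup_single when_def in_keys_iff)
  then show ?case using assms(2)[OF update(3)] by simp
qed

context bit_hom
begin

lemma evalP_mult_single: "evalP h \<sigma> (Poly_Mapping.single m c * g) =
    evalP h \<sigma> (Poly_Mapping.single m c) * evalP h \<sigma> g"
  by (induction g rule: P_induct)
    (simp_all add: distrib_left evalP_add mult_single evalP_single lookup_add power_add
      prod.distrib hmult algebra_simps)

lemma evalP_mult: "evalP h \<sigma> (f * g) = evalP h \<sigma> f * evalP h \<sigma> g"
  by (induction f rule: P_induct) (simp_all add: distrib_right evalP_add evalP_mult_single)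

lemma evalP_X [simp]: "evalP h \<sigma> (X i) = \<sigma> i"
proof -
  have "(\<Prod>j\<in>UNIV. \<sigma> j ^ Poly_Mapping.lookup (Poly_Mapping.single i (1::nat)) j) =
      (\<Prod>j\<in>UNIV. if j = i then \<sigma> j else 1)"
    by (rule prod.cong) (auto simp: lookup_single when_def)
  then show ?thesis by (simp add: X_def evalP_single)
qed

lemma evalP_1 [simp]: "evalP h \<sigma> 1 = 1"
  using evalP_single[of \<sigma> 0 1] by simp

end

lemma P_mult_induct [case_names one X mult add]:
  fixes f :: "'n::finite P"
  assumes "Q 1" and "\<And>i. Q (X i)" and "\<And>f g. Q f \<Longrightarrow> Q g \<Longrightarrow> Q (f * g)"
    and "\<And>f g. Q f \<Longrightarrow> Q g \<Longrightarrow> Q (f + g)"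
  shows "Q f"
proof -
  have Q0: "Q 0" using assms(4)[OF assms(1) assms(1)] by simp
  have mono: "Q (Poly_Mapping.single m 1)" for m :: "'n \<Rightarrow>\<^sub>0 nat"
  proof (induction "\<Sum>i\<in>UNIV. Poly_Mapping.lookup m i" arbitrary: m)
    case 0
    then have "m = 0" by (intro poly_mapping_eqI) simp
    then show ?case using assms(1) by simp
  next
    case (Suc d)
    then have "\<exists>i. Poly_Mapping.lookup m i \<noteq> 0"
      by (metis nat.distinct(1) sum.neutral)
    then obtain i where i: "Poly_Mapping.lookup m i > 0" by auto
    define m' where "m' = m - Poly_Mapping.single i 1"
    have m: "m = Poly_Mapping.single i 1 + m'"
      using i by (intro poly_mapping_eqI) (auto simp: m'_def lookup_add lookup_minus lookup_single when_def)
    have "(\<Sum>j\<in>UNIV. Poly_Mapping.lookup m j) =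
        (\<Sum>j\<in>UNIV. if j = i then 1 else 0) + (\<Sum>j\<in>UNIV. Poly_Mapping.lookup m' j)"
      unfolding sum.distrib[symmetric]
      by (rule sum.cong) (auto simp: m lookup_add lookup_single when_def)
    then have "d = (\<Sum>j\<in>UNIV. Poly_Mapping.lookup m' j)" using Suc(2) by simp
    then have "Q (Poly_Mapping.single m' 1)" by (rule Suc(1))
    moreover have "Poly_Mapping.single m 1 = X i * Poly_Mapping.single m' 1"
      by (simp add: X_def mult_single m)
    ultimately show ?case using assms(2,3) by simp
  qed
  show ?thesis
  proof (induction f rule: P_induct)
    case zero show ?case by (rule Q0)
  next
    case (add m c f)
    then show ?case using assms(4) mono by (cases c) auto
  qed
qed


text \<open>
  Additivity is linearity over the field with two elements. The conditions determine the squares;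
  see \<open>ex1_steenrod_action\<close> below.
\<close>

definition steenrod_action :: "(nat \<Rightarrow> 'n P \<Rightarrow> 'n P) \<Rightarrow> bool" where
  "steenrod_action S \<longleftrightarrow>
     (\<forall>k f g. S k (f + g) = S k f + S k g) \<and>
     (\<forall>f. S 0 f = f) \<and>
     (\<forall>i. S 1 (X i) = X i ^ 2) \<and>
     (\<forall>k i. k > 1 \<longrightarrow> S k (X i) = 0) \<and>
     (\<forall>k f g. S k (f * g) = (\<Sum>i\<le>k. S i f * S (k - i) g))"

definition Sq :: "nat \<Rightarrow> 'n::finite P \<Rightarrow> 'n P" where
  "Sq = (THE S. steenrod_action S)"

text \<open>
  For existence: the coefficients of the total square, the ring homomorphism into the polynomials
  in one further variable \<open>t\<close> which sends \<open>x\<^sub>i\<close> to \<open>x\<^sub>i + x\<^sub>i\<^sup>2 t\<close>.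
\<close>

definition total_square :: "'n::finite P \<Rightarrow> 'n P poly" where
  "total_square = evalP (\<lambda>c. [:const c:]) (\<lambda>i. [:X i, X i ^ 2:])"

interpretation bit_hom_const_poly: bit_hom "\<lambda>c. [:const c :: 'n P:]"
  by standard (simp_all only: const_simps one_pCons pCons_0_0 add_pCons add_0_left)

interpretation bit_hom_const: bit_hom "const :: bit \<Rightarrow> 'n P"
  by standard (simp_all only: const_simps)

lemma total_square_simps:
  "total_square (f + g) = total_square f + total_square g"
  "total_square (f * g) = total_square f * total_square g"
  "total_square (X i) = [:X i, X i ^ 2:]"
  "total_square 1 = 1"
  unfolding total_square_def
  by (rule bit_hom_const_poly.evalP_add bit_hom_const_poly.evalP_mult
      bit_hom_const_poly.evalP_X bit_hom_const_poly.evalP_1)+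

lemma steenrod_action_total_square:
  "steenrod_action (\<lambda>k f :: 'n::finite P. coeff (total_square f) k)"
proof -
  have "coeff (total_square f) 0 = f" for f :: "'n P"
    by (induction f rule: P_mult_induct) (simp_all add: total_square_simps coeff_mult)
  then show ?thesis
    by (auto simp: steenrod_action_def total_square_simps coeff_mult coeff_pCons split: nat.split)
qed

lemma steenrod_action_one:
  assumes "steenrod_action S" "k > 0"
  shows "S k (1 :: 'n::finite P) = 0"
  using assms(2)
proof (induction k rule: less_induct)
  case (less k)
  have S0: "S 0 f = f" for f using assms(1) by (simp add: steenrod_action_def)
  have "S k (1 * 1) = (\<Sum>i\<le>k. S i 1 * S (k - i) 1)"
    using assms(1) unfolding steenrod_action_def by blast
  also have "\<dots> = (\<Sum>i\<in>{0,k}. S i 1 * S (k - i) 1)"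
    using less by (intro sum.mono_neutral_right) auto
  also have "\<dots> = S k 1 + S k 1" using less(2) by (simp add: S0)
  finally show ?case by simp
qed

lemma steenrod_action_unique:
  assumes S: "steenrod_action S" and S': "steenrod_action S'"
  shows "S = (S' :: nat \<Rightarrow> 'n::finite P \<Rightarrow> 'n P)"
proof -
  have "\<forall>k. S k f = S' k f" for f
  proof (induction f rule: P_mult_induct)
    case one
    show ?case
    proof
      fix k show "S k 1 = S' k 1"
        using S S' by (cases "k = 0") (simp_all add: steenrod_action_one, simp add: steenrod_action_def)
    qed
  next
    case (X i)
    show ?case
    proof
      fix k :: nat
      consider "k = 0" | "k = 1" | "k > 1" by linarith
      then show "S k (X i) = S' k (X i)"
        using S S' by cases (simp_all add: steenrod_action_def)
    qed
  qed (use S S' in \<open>simp_all add: steenrod_action_def\<close>)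
  then show ?thesis by (intro ext) simp
qed

lemma ex1_steenrod_action: "\<exists>!S :: nat \<Rightarrow> 'n::finite P \<Rightarrow> 'n P. steenrod_action S"
  using steenrod_action_total_square steenrod_action_unique by blast

lemma steenrod_action_Sq: "steenrod_action Sq"
  unfolding Sq_def by (rule theI'[OF ex1_steenrod_action])

lemma Sq_eq_coeff: "Sq k f = coeff (total_square f) k"
  using fun_cong[OF fun_cong[OF steenrod_action_unique[OF steenrod_action_Sq
        steenrod_action_total_square]]] .


definition scaleP :: "bit \<Rightarrow> 'n P \<Rightarrow> 'n P" where
  "scaleP c f = const c * f"

global_interpretation P: vector_space "scaleP :: bit \<Rightarrow> 'n P \<Rightarrow> 'n P"
  by standard (simp_all only: scaleP_def const_simps distrib_left distrib_right mult.assoc mult_1_left)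

text \<open>The subspace \<open>A\<^sup>+ P\<^sub>n\<close>: positive degree elements of the Steenrod algebra act through the squares.\<close>

definition hit :: "'n::finite P set" where
  "hit = P.span {Sq j g | j g. j > 0}"

quotient_type (overloaded) 'n QP = "'n::finite P" / "\<lambda>f g. f - g \<in> hit"
proof (rule equivpI)
  show "reflp (\<lambda>f g :: 'n P. f - g \<in> hit)"
    by (simp add: reflp_def hit_def P.span_zero)
  show "symp (\<lambda>f g :: 'n P. f - g \<in> hit)"
    unfolding symp_def hit_def using P.span_neg by fastforce
  show "transp (\<lambda>f g :: 'n P. f - g \<in> hit)"
    unfolding transp_def hit_def using P.span_add by fastforce
qed

text \<open>Otherwise lifting would also descend into the representation of \<open>'n P\<close> itself.\<close>

lifting_forget poly_mapping.lifting

lift_definition QP_class :: "'n::finite P \<Rightarrow> 'n QP" is "\<lambda>f. f" .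

instantiation QP :: (finite) ab_group_add
begin

lift_definition zero_QP :: "'a QP" is 0 .

lift_definition plus_QP :: "'a QP \<Rightarrow> 'a QP \<Rightarrow> 'a QP" is "(+)"
  unfolding hit_def by (simp only: add_diff_add P.span_add)

lift_definition uminus_QP :: "'a QP \<Rightarrow> 'a QP" is uminus
  unfolding hit_def by (simp only: minus_diff_minus P.span_neg)

lift_definition minus_QP :: "'a QP \<Rightarrow> 'a QP \<Rightarrow> 'a QP" is minus
proof -
  fix f f' g g' :: "'a P"
  assume "f - f' \<in> hit" "g - g' \<in> hit"
  then have "(f - f') - (g - g') \<in> hit"
    unfolding hit_def by (rule P.span_diff)
  then show "f - g - (f' - g') \<in> hit"
    by (simp add: algebra_simps del: P_add_self)
qed

instance
  by standard (transfer; simp add: hit_def P.span_zero algebra_simps)+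

end

definition QP_deg :: "nat \<Rightarrow> 'n::finite QP set" where
  "QP_deg d = QP_class ` {f. homogeneous d f}"


text \<open>
  \<open>A\<close> acts by \<open>x\<^sub>j \<mapsto> \<Sum>\<^sub>i A\<^sub>i\<^sub>j x\<^sub>i\<close>, which gives a left action. It is defined for every square matrix
  and restricted to invertible ones below.
\<close>

definition linform :: "bit ^ 'n ^ 'n \<Rightarrow> 'n \<Rightarrow> 'n::finite P" where
  "linform A j = (\<Sum>i\<in>UNIV. scaleP (A $ i $ j) (X i))"

definition linear_subst :: "bit ^ 'n ^ 'n \<Rightarrow> 'n::finite P \<Rightarrow> 'n P" where
  "linear_subst A = evalP const (linform A)"

lemma linear_subst_simps:
  "linear_subst A (f + g) = linear_subst A f + linear_subst A g"
  "linear_subst A (f * g) = linear_subst A f * linear_subst A g"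
  "linear_subst A (X j) = linform A j"
  "linear_subst A 1 = 1"
  "linear_subst A 0 = 0"
  unfolding linear_subst_def
  by (rule bit_hom_const.evalP_add bit_hom_const.evalP_mult
      bit_hom_const.evalP_X bit_hom_const.evalP_1 bit_hom_const.evalP_0)+

lemma linear_subst_const: "linear_subst A (const c) = const c"
  by (cases c) (simp_all add: linear_subst_simps)

lemma linear_subst_uminus: "linear_subst A (- f) = - linear_subst A f"
proof -
  have "linear_subst A f + linear_subst A (- f) = linear_subst A (f + - f)"
    by (simp only: linear_subst_simps)
  also have "\<dots> = 0" by (simp only: add.right_inverse linear_subst_simps)
  finally show ?thesis by (rule minus_unique[symmetric])
qed

lemma linear_subst_diff: "linear_subst A (f - g) = linear_subst A f - linear_subst A g"
  by (simp only: diff_conv_add_uminus linear_subst_simps linear_subst_uminus)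

lemma linear_subst_sum: "linear_subst A (sum f K) = (\<Sum>i\<in>K. linear_subst A (f i))"
  by (induction K rule: infinite_finite_induct) (simp_all add: linear_subst_simps)

lemma linear_subst_mult:
  "linear_subst (A ** B) f = linear_subst A (linear_subst B f)"
proof (induction f rule: P_mult_induct)
  case (X j)
  have const_sum: "const (sum c K) = (\<Sum>i\<in>K. const (c i))" for c and K :: "'a set"
  proof (induction K rule: infinite_finite_induct)
    case (insert x F)
    then show ?case by (simp only: sum.insert const_simps not_False_eq_True)
  qed simp_all
  have "linform (A ** B) j = (\<Sum>i\<in>UNIV. \<Sum>k\<in>UNIV. const (A $ i $ k) * const (B $ k $ j) * X i)"
    by (simp only: linform_def scaleP_def matrix_matrix_mult_def vec_lambda_beta const_sum
        const_simps sum_distrib_right)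
  also have "\<dots> = (\<Sum>k\<in>UNIV. \<Sum>i\<in>UNIV. const (A $ i $ k) * const (B $ k $ j) * X i)"
    by (rule sum.swap)
  also have "\<dots> = linear_subst A (linform B j)"
    by (simp add: linform_def scaleP_def linear_subst_sum linear_subst_simps linear_subst_const
        sum_distrib_left mult_ac)
  finally show ?case by (simp add: linear_subst_simps)
qed (simp_all add: linear_subst_simps)

lemma linear_subst_one: "linear_subst (mat 1) f = f"
proof (induction f rule: P_mult_induct)
  case (X j)
  have "linform (mat 1) j = (\<Sum>i\<in>UNIV. if i = j then X i else 0)"
    unfolding linform_def by (rule sum.cong) (auto simp: mat_def scaleP_def)
  then show ?case by (simp add: linear_subst_simps)
qed (simp_all add: linear_subst_simps)

lemma square_sum_P: "(sum f K :: 'n::finite P) ^ 2 = (\<Sum>i\<in>K. f i ^ 2)"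
proof (induction K rule: infinite_finite_induct)
  case (insert x F)
  have "(a + b)\<^sup>2 = a\<^sup>2 + b\<^sup>2 + (a * b + a * b)" for a b :: "'n P"
    by (simp add: power2_eq_square algebra_simps del: P_add_self)
  then show ?case using insert by simp
qed simp_all

lemma total_square_linform: "total_square (linform A j) = [:linform A j, linform A j ^ 2:]"
proof -
  have ts_sum: "total_square (sum f K) = (\<Sum>i\<in>K. total_square (f i))" for f :: "'n \<Rightarrow> 'n::finite P" and K
    by (induction K rule: infinite_finite_induct)
      (simp_all add: total_square_simps, simp_all add: total_square_def)
  have ts_const: "total_square (const c) = [:const c :: 'n::finite P:]" for c
    by (cases c) (simp_all add: total_square_simps one_pCons, simp_all add: total_square_def)
  have sq: "const c ^ 2 = (const c :: 'n P)" for c by (cases c) simp_all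
  have pC: "(\<Sum>i\<in>K. [:a i, b i:]) = [:sum a K, sum b K:]" for a b :: "'n \<Rightarrow> 'n P" and K
    by (induction K rule: infinite_finite_induct) simp_all
  have "total_square (linform A j) =
      (\<Sum>i\<in>UNIV. [:const (A $ i $ j) * X i, const (A $ i $ j) * X i ^ 2:])"
    by (simp add: linform_def scaleP_def ts_sum total_square_simps ts_const mult.commute)
  also have "\<dots> = [:linform A j, linform A j ^ 2:]"
    by (simp add: pC linform_def scaleP_def square_sum_P power_mult_distrib sq)
  finally show ?thesis .
qed

lemma linear_subst_Sq: "linear_subst A (Sq k f) = Sq k (linear_subst A f)"
proof -
  have "\<forall>k. linear_subst A (coeff (total_square f) k) = coeff (total_square (linear_subst A f)) k"
  proof (induction f rule: P_mult_induct)
    case one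
    show ?case by (simp add: linear_subst_simps total_square_simps one_pCons coeff_pCons split: nat.split)
  next
    case (X i)
    show ?case
      by (auto simp: linear_subst_simps total_square_simps total_square_linform coeff_pCons
          power2_eq_square split: nat.split)
  qed (simp_all add: linear_subst_simps total_square_simps coeff_mult linear_subst_sum)
  then show ?thesis by (simp add: Sq_eq_coeff)
qed

lemma linear_subst_hit:
  assumes "f \<in> hit"
  shows "linear_subst A f \<in> hit"
  using assms unfolding hit_def
proof (induction rule: P.span_induct_alt)
  case base
  show ?case by (simp add: linear_subst_simps P.span_zero)
next
  case (step c x y)
  then obtain j g where "j > 0" "x = Sq j g" by auto
  then have "linear_subst A x \<in> {Sq j g | j g. j > 0}"
    by (auto simp: linear_subst_Sq)
  then have "linear_subst A x \<in> {Sq j g | j g. j > 0}"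
    by (auto simp: linear_subst_Sq)
  then have "scaleP c (linear_subst A x) \<in> P.span {Sq j g | j g. j > 0}"
    by (intro P.span_scale P.span_base)
  moreover have "linear_subst A (scaleP c x + y) = scaleP c (linear_subst A x) + linear_subst A y"
    by (simp only: scaleP_def linear_subst_simps linear_subst_const)
  ultimately show ?case using step by (simp only: P.span_add)
qed

lift_definition QP_act :: "bit ^ 'n ^ 'n \<Rightarrow> 'n::finite QP \<Rightarrow> 'n QP" is linear_subst
  by (simp only: linear_subst_diff[symmetric] linear_subst_hit)

definition QP_invariants :: "nat \<Rightarrow> 'n::finite QP set" where
  "QP_invariants d = {q \<in> QP_deg d. \<forall>A :: bit ^ 'n ^ 'n. invertible A \<longrightarrow> QP_act A q = q}"

end

theory Submission
  imports "HOL-Algebra.Algebraic_Closure_Type" Defs "HOL-Library.Code_Binary_Nat"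
begin

text \<open>
  Call a class of degree \<open>d\<^sub>s = 15 2\<^sup>s - 5\<close> invariant if it is fixed by \<open>GL\<^sub>5\<close>. Halving odd exponents,
  Kameko's map sends degree \<open>d\<^sub>s\<^sub>+\<^sub>1\<close> to \<open>d\<^sub>s\<close>, equivariantly and compatibly with the squares. For
  \<open>s + 1 \<ge> 2\<close> it is injective modulo hit elements: a monomial with an even exponent has the form
  \<open>u v\<^sup>2\<close>, \<open>u\<close> a product of one or three variables, and \<open>u v\<^sup>2 = u Sq\<^sup>e v\<close> with \<open>e = deg v\<close> is congruent to
  \<open>\<chi>(Sq\<^sup>e)(u) v\<close>, which vanishes because \<open>e + deg u\<close> is not a sum of \<open>deg u\<close> powers of two. This
  leaves the degrees 10 and 25.

  There, an invariant class equals its average over the normaliser of order \<open>31 \<cdot> 5\<close> of a Singer cycle.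
  Over the field with 32 elements the Singer cycle is diagonal in variables \<open>Y\<^sub>0, \<dots>, Y\<^sub>4\<close> with
  \<open>Sq\<^sup>1 Y\<^sub>i = Y\<^sub>i\<^sub>-\<^sub>1\<^sup>2\<close>, the averages are combinations of the orbits of the monomials of weight
  \<open>0\<close> modulo \<open>31\<close> under \<open>Y\<^sub>i \<mapsto> Y\<^sub>i\<^sub>+\<^sub>1\<close>, and modulo hit elements only 2 (degree 10) and 8 (degree 25)
  orbits remain. Their combinations are detected by the coefficients of the monomials
  \<open>x\<^sub>i\<^sup>7 x\<^sub>j\<^sup>3\<close> and \<open>x\<^sub>i\<^sup>1\<^sup>5 x\<^sub>j\<^sup>7 x\<^sub>k\<^sup>3\<close>. Such spikes do not occur in hit polynomials, and a transvection
  shows that they do not occur in polynomials with invariant class.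
\<close>

no_notation Polynomials.var (\<open>X\<index>\<close>)
hide_const (open) UnivPoly.monom UnivPoly.coeff UnivPoly.up_ring.monom UnivPoly.up_ring.coeff

subsection \<open>Squares of monomials and spikes\<close>

text \<open>Size is the obstacle: degree 25 in five variables has 23751 monomials. Averaging cuts
  this to some 150 orbits. It is legitimate modulo 2 because the group order 155 is odd; its price
  is an extension of scalars, since the Singer cycle has no eigenvector over the field with two
  elements. The way back uses an additive functional \<open>lam\<close> with
  \<open>lam 1 = 1\<close>: applied coefficientwise it commutes with the squares, so being hit over
  the large field can be tested after scaling by every constant and applying \<open>lam\<close>.
  Degree 25 needs its own certificate because Kameko's map loses information there: with three odd
  exponents, e + deg u = 14 = 8 + 4 + 2 is a sum of three powers of two, as the exponents 15, 7, 3
  show. In the next degree, 55, the numbers to be represented are 28 by one power and 29 by three,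
  and neither is possible. Each certificate joins an upper bound, relations that express every orbit
  by a few, to a lower bound, a matrix of spike coefficients with independent columns.\<close>

abbreviation mon :: "('n \<Rightarrow>\<^sub>0 nat) \<Rightarrow> 'n P" where
  "mon m \<equiv> Poly_Mapping.single m 1"

definition expo :: "('n::finite \<Rightarrow> nat) \<Rightarrow> 'n \<Rightarrow>\<^sub>0 nat" where
  "expo b = Poly_Mapping.Abs_poly_mapping b"

lemma lookup_expo [simp]: "Poly_Mapping.lookup (expo b) = b"
  unfolding expo_def by (rule lookup_Abs_poly_mapping) simp

lemma expo_eqI: "(\<And>i. Poly_Mapping.lookup m i = b i) \<Longrightarrow> m = expo b"
  by (intro poly_mapping_eqI) simp

lemma P_mon_induct [case_names zero add]:
  assumes "Q 0" "\<And>m f. Q f \<Longrightarrow> Q (mon m + f)"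
  shows "Q (f :: 'n P)"
proof (induction f rule: P_induct)
  case (add m c f)
  then show ?case using assms(2) by (cases c) auto
qed (rule assms(1))

lemma X_power: "X i ^ k = mon (Poly_Mapping.single i k)"
  by (induction k) (simp_all add: X_def mult_single flip: single_one single_add)

lemma sum_single_self: "(\<Sum>i\<in>UNIV. Poly_Mapping.single i (Poly_Mapping.lookup m i)) = (m :: 'n::finite \<Rightarrow>\<^sub>0 nat)"
  by (intro poly_mapping_eqI) (simp add: lookup_sum lookup_single when_def)

lemma mon_sum: "finite K \<Longrightarrow> mon (sum g K) = (\<Prod>i\<in>K. mon (g i))"
proof (induction K rule: finite_induct)
  case (insert x F)
  have "mon (g x + sum g F) = mon (g x) * mon (sum g F)" by (simp add: mult_single)
  then show ?case using insert by simp
qed simp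

lemma mon_eq_prod: "mon m = (\<Prod>i\<in>UNIV. X i ^ Poly_Mapping.lookup m (i :: 'n::finite))"
  by (subst sum_single_self[of m, symmetric]) (simp only: mon_sum finite X_power)

lemma prod_X_expo: "(\<Prod>i\<in>UNIV. X i ^ b i) = mon (expo b)"
  by (simp add: mon_eq_prod)

lemma P_eq_sum_mon: "(f :: 'n P) = (\<Sum>m\<in>Poly_Mapping.keys f. mon m)"
proof (rule poly_mapping_eqI)
  fix m
  have "Poly_Mapping.lookup f m = of_bool (m \<in> Poly_Mapping.keys f)"
    by (cases "Poly_Mapping.lookup f m") (simp_all add: in_keys_iff)
  also have "\<dots> = Poly_Mapping.lookup (\<Sum>m\<in>Poly_Mapping.keys f. mon m) m"
    by (simp add: lookup_sum lookup_single when_def)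
  finally show "Poly_Mapping.lookup f m = Poly_Mapping.lookup (\<Sum>m\<in>Poly_Mapping.keys f. mon m) m" .
qed

lemma Sq_simps:
  "Sq k (f + g) = Sq k f + Sq k g"
  "Sq 0 f = f"
  "Sq k (f * g) = (\<Sum>i\<le>k. Sq i f * Sq (k - i) g)"
  using steenrod_action_Sq unfolding steenrod_action_def by blast+

lemma Sq_zero [simp]: "Sq k 0 = 0"
  using Sq_simps(1)[of k 0 0] by simp

lemma Sq_sum: "Sq k (sum f K) = (\<Sum>i\<in>K. Sq k (f i))"
  by (induction K rule: infinite_finite_induct) (simp_all add: Sq_simps)

lemma hit_0 [simp]: "0 \<in> hit" and hit_add: "f \<in> hit \<Longrightarrow> g \<in> hit \<Longrightarrow> f + g \<in> hit"
  and hit_Sq: "k > 0 \<Longrightarrow> Sq k f \<in> hit"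
  by (auto simp: hit_def intro: P.span_zero P.span_add P.span_base)

lemma hit_sum: "(\<And>i. i \<in> K \<Longrightarrow> f i \<in> hit) \<Longrightarrow> sum f K \<in> hit"
  by (induction K rule: infinite_finite_induct) (auto intro: hit_add)

text \<open>Additivity of the squares reduces the generators \<open>Sq k g\<close> to monomials
  \<open>g\<close>, which are homogeneous and to which \<open>Sq_mon\<close> applies.\<close>

lemma hit_induct [consumes 1, case_names zero add]:
  assumes "f \<in> hit" "Q 0" "\<And>k m f. k > 0 \<Longrightarrow> Q f \<Longrightarrow> Q (Sq k (mon m) + f)"
  shows "Q f"
  using assms(1) unfolding hit_def
proof (induction rule: P.span_induct_alt)
  case (step c x y)
  then obtain k g where k: "k > 0" "x = Sq k g" by auto
  have "Q (Sq k g + y)"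
    by (induction g rule: P_mon_induct) (use assms(3) k step in \<open>simp_all add: Sq_simps add.assoc\<close>)
  then show ?case using k step by (cases c) (simp_all add: scaleP_def)
qed (rule assms(2))

lemma minus_P [simp]: "- (f :: 'n P) = f"
  using P_add_self[of f] by (simp only: neg_eq_iff_add_eq_0)

lemma diff_P: "(f :: 'n P) - g = f + g"
  by (simp only: diff_conv_add_uminus minus_P)

lemma hit_add_cancel: "f + g \<in> hit \<Longrightarrow> g \<in> hit \<Longrightarrow> f \<in> hit"
  using hit_add[of "f + g" g] by (simp add: add.assoc)

definition total_degree :: "('n::finite \<Rightarrow>\<^sub>0 nat) \<Rightarrow> nat" where
  "total_degree m = (\<Sum>i\<in>UNIV. Poly_Mapping.lookup m i)"

lemma homogeneous_iff: "homogeneous d f \<longleftrightarrow> (\<forall>m. Poly_Mapping.lookup f m \<noteq> 0 \<longrightarrow> total_degree m = d)"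
  by (auto simp: homogeneous_def total_degree_def in_keys_iff)

lemma pCons_power: "[:a :: 'a::comm_ring_1, a ^ 2:] ^ n = (\<Sum>b\<le>n. monom (of_nat (n choose b) * a ^ (n + b)) b)"
proof -
  have "[:a, a ^ 2:] = monom (a ^ 2) 1 + monom a 0" by (simp add: monom_altdef)
  then have "[:a, a ^ 2:] ^ n = (\<Sum>b\<le>n. of_nat (n choose b) * monom (a ^ 2) 1 ^ b * monom a 0 ^ (n - b))"
    by (simp only: binomial_ring)
  also have "\<dots> = (\<Sum>b\<le>n. monom (of_nat (n choose b) * a ^ (n + b)) b)"
  proof (rule sum.cong)
    fix b assume "b \<in> {..n}"
    then have "2 * b + (n - b) = n + b" by simp
    then have "a ^ (n + b) = (a ^ 2) ^ b * a ^ (n - b)" by (metis power_add power_mult)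
    then show "of_nat (n choose b) * monom (a ^ 2) 1 ^ b * monom a 0 ^ (n - b) =
        monom (of_nat (n choose b) * a ^ (n + b)) b"
      by (simp add: monom_power mult_monom of_nat_monom mult.assoc)
  qed simp
  finally show ?thesis .
qed

lemma total_square_power: "total_square (f ^ n) = total_square f ^ n"
  by (induction n) (simp_all add: total_square_simps)

lemma total_square_prod: "total_square (\<Prod>i\<in>K. f i) = (\<Prod>i\<in>K. total_square (f i))"
  by (induction K rule: infinite_finite_induct) (simp_all add: total_square_simps)

lemma prod_monom: "finite K \<Longrightarrow> (\<Prod>i\<in>K. monom (c i) (b i)) = monom (\<Prod>i\<in>K. c i) (\<Sum>i\<in>K. b i)"
  by (induction K rule: finite_induct) (simp_all add: mult_monom)

lemma Sq_mon:
  "Sq k (mon m) = (\<Sum>b\<in>{b. (\<forall>i. b i \<le> Poly_Mapping.lookup m i) \<and> sum b UNIV = k}.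
      of_nat (\<Prod>i\<in>UNIV. Poly_Mapping.lookup m i choose b i) * mon (m + expo b))"
    (is "_ = sum ?t _")
proof -
  let ?m = "Poly_Mapping.lookup m"
  let ?B = "{b. \<forall>i. b i \<le> ?m i}"
  have B: "PiE UNIV (\<lambda>i. {..?m i}) = ?B" by auto
  have fin: "finite ?B" unfolding B[symmetric] by (intro finite_PiE) auto
  have "total_square (mon m) = (\<Prod>i\<in>UNIV. \<Sum>b\<le>?m i. monom (of_nat (?m i choose b) * X i ^ (?m i + b)) b)"
    by (simp only: mon_eq_prod total_square_prod total_square_power total_square_simps pCons_power)
  also have "\<dots> = (\<Sum>b\<in>?B. \<Prod>i\<in>UNIV. monom (of_nat (?m i choose b i) * X i ^ (?m i + b i)) (b i))"
    by (subst prod_sum_PiE) (simp_all add: B)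
  also have "\<dots> = (\<Sum>b\<in>?B. monom (?t b) (sum b UNIV))"
  proof (rule sum.cong)
    fix b
    have "(\<Prod>i\<in>UNIV. X i ^ (?m i + b i)) = mon (m + expo b)"
      unfolding prod_X_expo by (rule arg_cong[where f = mon], rule expo_eqI[symmetric]) (simp add: lookup_add)
    then show "(\<Prod>i\<in>UNIV. monom (of_nat (?m i choose b i) * X i ^ (?m i + b i)) (b i)) = monom (?t b) (sum b UNIV)"
      by (simp add: prod_monom prod.distrib)
  qed simp
  finally have "Sq k (mon m) = (\<Sum>b\<in>?B. if sum b UNIV = k then ?t b else 0)"
    by (simp add: Sq_eq_coeff coeff_sum del: of_nat_prod)
  also have "\<dots> = sum ?t {b\<in>?B. sum b UNIV = k}"
    by (rule sum.inter_filter[OF fin, symmetric])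
  finally show ?thesis by (simp only: mem_Collect_eq)
qed

lemma lookup_of_nat_mult_mon:
  "Poly_Mapping.lookup (of_nat c * mon m) m' = (if m = m' then of_nat c else 0)"
  by (simp add: mult_single flip: single_of_nat)
    (simp add: lookup_single when_def)

lemma even_choose_double_odd: "even ((2 * n) choose Suc (2 * b))"
proof (induction n arbitrary: b)
  case (Suc n)
  show ?case
  proof (cases b)
    case (Suc b')
    then show ?thesis using Suc.IH[of b'] Suc.IH[of b] by simp
  qed simp
qed simp

lemma odd_choose_double: "odd ((2 * n) choose (2 * b)) \<longleftrightarrow> odd (n choose b)"
proof (induction n arbitrary: b)
  case (Suc n)
  show ?case
  proof (cases b)
    case (Suc b')
    then show ?thesis using Suc.IH[of b'] Suc.IH[of b] even_choose_double_odd[of n b'] by auto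
  qed simp
next
  case 0
  then show ?case by (cases b) simp_all
qed

lemma odd_choose_Suc_double: "odd (Suc (2 * n) choose (2 * b)) \<longleftrightarrow> odd (n choose b)"
proof (cases b)
  case (Suc b')
  then show ?thesis using odd_choose_double[of n b] even_choose_double_odd[of n b'] by simp
qed simp

text \<open>In binary \<open>b\<close> is the complement of \<open>c\<close>, so a nonzero
  \<open>b\<close> has a digit 1 where \<open>c\<close> has 0, and Lucas' theorem gives an even
  binomial. The induction strips the last digit.\<close>

lemma even_spike_choose:
  assumes "c + b = 2 ^ k - 1" "b > 0"
  shows "even (c choose b)"
  using assms
proof (induction k arbitrary: b c)
  case (Suc k)
  have odd: "odd (c + b)" using Suc.prems by simp
  show ?case
  proof (cases "even b")
    case True
    with odd obtain b' c' where bc: "b = 2 * b'" "c = Suc (2 * c')" by (auto elim!: evenE oddE)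
    have "c' + b' = 2 ^ k - 1" using Suc.prems bc by simp
    then have "even (c' choose b')" using Suc.IH Suc.prems bc by simp
    then show ?thesis using bc odd_choose_Suc_double by simp
  next
    case False
    with odd obtain b' c' where bc: "b = Suc (2 * b')" "c = 2 * c'" by (auto elim!: evenE oddE)
    show ?thesis unfolding bc by (rule even_choose_double_odd)
  qed
qed simp

definition spike :: "('n \<Rightarrow>\<^sub>0 nat) \<Rightarrow> bool" where
  "spike m \<longleftrightarrow> (\<forall>i. \<exists>k. Poly_Mapping.lookup m i = 2 ^ k - 1)"

lemma of_nat_bit: "(of_nat n :: bit) = (if even n then 0 else 1)"
  by (induction n) auto

text \<open>Since \<open>k > 0\<close>, every term of \<open>Sq k (mon m')\<close> raises some
  exponent by \<open>b i > 0\<close>. If the result is a spike, the factor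
  \<open>m' i choose b i\<close> is even by \<open>even_spike_choose\<close>.\<close>

lemma lookup_hit_spike:
  fixes m :: "'n::finite \<Rightarrow>\<^sub>0 nat"
  assumes "f \<in> hit" "spike m"
  shows "Poly_Mapping.lookup f m = 0"
  using assms(1)
proof (induction rule: hit_induct)
  case (add k m' f)
  have "Poly_Mapping.lookup (of_nat (\<Prod>i\<in>UNIV. Poly_Mapping.lookup m' i choose b i) * mon (m' + expo b)) m = 0"
    if b: "sum b UNIV = k" for b
  proof (cases "m' + expo b = m")
    case True
    from b add(1) obtain i where i: "b i > 0" by (metis gr0I sum.neutral)
    from assms(2) obtain e where "Poly_Mapping.lookup m i = 2 ^ e - 1" by (auto simp: spike_def)
    with True i have "even (Poly_Mapping.lookup m' i choose b i)"
      by (intro even_spike_choose[where k = e]) (auto simp: lookup_add)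
    then have "even (\<Prod>i\<in>UNIV. Poly_Mapping.lookup m' i choose b i)"
      by (subst prod.remove[of _ i]) auto
    then show ?thesis by (simp only: lookup_of_nat_mult_mon of_nat_bit if_True if_cancel)
  qed (simp only: lookup_of_nat_mult_mon if_False)
  then have "Poly_Mapping.lookup (Sq k (mon m')) m = 0"
    by (simp only: Sq_mon lookup_sum) (rule sum.neutral, auto)
  then show ?case using add by (simp add: lookup_add)
qed simp

subsection \<open>Transvections\<close>

lemma odd_choose_Suc_Suc_double: "odd (Suc (2 * n) choose Suc (2 * b)) \<longleftrightarrow> odd (n choose b)"
  using odd_choose_double[of n b] even_choose_double_odd[of n b] by simp

text \<open>By Lucas' theorem the binomial is odd exactly if the last \<open>k\<close> digits of
  \<open>n\<close> are ones, that is, n is congruent to a modulo a + 1. After a and 2a + 1 the next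
  such number is 3a + 2, just outside the range.\<close>

lemma odd_choose_spike:
  assumes "a = 2 ^ k - 1" "a \<le> n" "n \<le> 3 * a + 1"
  shows "odd (n choose a) \<longleftrightarrow> n = a \<or> n = 2 * a + 1"
  using assms
proof (induction k arbitrary: a n)
  case (Suc k)
  define a' where "a' = (2 :: nat) ^ k - 1"
  have a: "a = Suc (2 * a')"
    using one_le_power[of "2 :: nat" k] unfolding a'_def Suc.prems(1) power_Suc by linarith
  show ?case
  proof (cases "even n")
    case True
    then obtain n' where n: "n = 2 * n'" by (elim evenE)
    show ?thesis using even_choose_double_odd[of n' a'] unfolding a n by presburger
  next
    case False
    then obtain n' where n: "n = Suc (2 * n')" by (auto elim: oddE)
    have "odd (n' choose a') \<longleftrightarrow> n' = a' \<or> n' = 2 * a' + 1"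
      using Suc.prems a n by (intro Suc.IH[OF a'_def]) auto
    then show ?thesis unfolding a n odd_choose_Suc_Suc_double by presburger
  qed
qed auto

text \<open>Sum and difference agree in characteristic 2, so this is invariance of the class of
  \<open>f\<close>.\<close>

definition invariant_mod_hit :: "'n::finite P \<Rightarrow> bool" where
  "invariant_mod_hit f \<longleftrightarrow> (\<forall>A :: bit ^ 'n ^ 'n. invertible A \<longrightarrow> linear_subst A f + f \<in> hit)"

definition transvection :: "'n::finite \<Rightarrow> 'n \<Rightarrow> bit ^ 'n ^ 'n" where
  "transvection i j = (\<chi> a b. of_bool (a = b) + of_bool (a = j \<and> b = i))"

lemma transvection_mult_self:
  fixes i j :: "'n::finite"
  assumes "i \<noteq> j"
  shows "transvection i j ** transvection i j = mat 1"
proof -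
  have d: "(\<Sum>k\<in>UNIV. of_bool (a = k) * c k) = (c a :: bit)"
    "(\<Sum>k\<in>UNIV. of_bool (k = a) * c k) = (c a :: bit)" for a :: 'n and c
  proof -
    have "(\<Sum>k\<in>UNIV. of_bool (a = k) * c k) = (\<Sum>k\<in>UNIV. if a = k then c k else 0)"
      "(\<Sum>k\<in>UNIV. of_bool (k = a) * c k) = (\<Sum>k\<in>UNIV. if k = a then c k else 0)"
      by (rule sum.cong; simp only: of_bool_def if_True if_False mult_1_left mult_zero_left split: if_splits; simp)+
    then show "(\<Sum>k\<in>UNIV. of_bool (a = k) * c k) = c a" "(\<Sum>k\<in>UNIV. of_bool (k = a) * c k) = c a"
      by (simp_all only: sum.delta sum.delta' finite UNIV_I if_True)
  qed
  have "(\<Sum>k\<in>UNIV. (of_bool (a = k) + of_bool (a = j \<and> k = i)) * (of_bool (k = b) + of_bool (k = j \<and> b = i)))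
     = (of_bool (a = b) :: bit)" for a b
  proof -
    have "(\<Sum>k\<in>UNIV. (of_bool (a = k) + of_bool (a = j \<and> k = i)) * (of_bool (k = b) + of_bool (k = j \<and> b = i)))
      = (\<Sum>k\<in>UNIV. of_bool (a = k) * (of_bool (k = b) + of_bool (k = j \<and> b = i)) +
           of_bool (k = i) * (of_bool (a = j) * (of_bool (k = b) + of_bool (k = j \<and> b = i)) :: bit))"
      by (rule sum.cong, rule refl, rename_tac k)
        (case_tac "a = j"; case_tac "k = i"; simp only: of_bool_eq simp_thms distrib_right add_0_right mult_1_left mult_zero_left)
    also have "\<dots> = of_bool (a = b) + of_bool (a = j \<and> b = i) + of_bool (a = j) * of_bool (i = b)"
      using assms by (simp only: sum.distrib d simp_thms of_bool_eq add_0_right)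
    also have "\<dots> = of_bool (a = b)"
      by (cases "a = j"; cases "i = b"; cases "a = b") simp_all
    finally show ?thesis .
  qed
  then show ?thesis
    by (simp only: matrix_matrix_mult_def transvection_def mat_def vec_eq_iff vec_lambda_beta of_bool_def) blast
qed

lemma invertible_transvection: "i \<noteq> j \<Longrightarrow> invertible (transvection i j)"
  unfolding invertible_def using transvection_mult_self by blast

lemma linform_transvection:
  assumes "i \<noteq> j"
  shows "linform (transvection i j) l = (if l = i then X i + X j else X l)"
proof -
  have "linform (transvection i j) l =
      (\<Sum>a\<in>UNIV. (if a = l then X a else 0) + (if a = j then if l = i then X a else 0 else 0))"
    unfolding linform_def transvection_def scaleP_def
    using assms by (intro sum.cong) (auto simp: of_bool_def)
  also have "\<dots> = (if l = i then X i + X j else X l)"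
    by (simp only: sum.distrib sum.delta finite UNIV_I if_True) simp
  finally show ?thesis .
qed

lemma linear_subst_power: "linear_subst A (f ^ k) = linear_subst A f ^ k"
  by (induction k) (simp_all add: linear_subst_simps)

lemma linear_subst_prod: "linear_subst A (\<Prod>i\<in>K. f i) = (\<Prod>i\<in>K. linear_subst A (f i))"
  by (induction K rule: infinite_finite_induct) (simp_all add: linear_subst_simps)

lemma linear_subst_mon: "linear_subst A (mon m) = (\<Prod>i\<in>UNIV. linform A i ^ Poly_Mapping.lookup m i)"
  by (simp only: mon_eq_prod linear_subst_prod linear_subst_power linear_subst_simps)

lemma linear_subst_transvection_mon:
  fixes i j :: "'n::finite"
  assumes "i \<noteq> j"
  defines "e m b \<equiv> expo ((Poly_Mapping.lookup m)(i := b, j := Poly_Mapping.lookup m j + (Poly_Mapping.lookup m i - b)))"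
  shows "linear_subst (transvection i j) (mon m) =
    (\<Sum>b\<le>Poly_Mapping.lookup m i. of_nat (Poly_Mapping.lookup m i choose b) * mon (e m b))"
proof -
  let ?m = "Poly_Mapping.lookup m"
  have "linear_subst (transvection i j) (mon m) = (X i + X j) ^ ?m i * (\<Prod>l\<in>UNIV - {i}. X l ^ ?m l)"
    unfolding linear_subst_mon using assms(1)
    by (subst prod.remove[of _ i]) (auto simp: linform_transvection intro!: prod.cong)
  also have "\<dots> = (\<Sum>b\<le>?m i. of_nat (?m i choose b) * (X i ^ b * X j ^ (?m i - b) * (\<Prod>l\<in>UNIV - {i}. X l ^ ?m l)))"
    by (simp only: binomial_ring sum_distrib_right mult.assoc)
  also have "\<dots> = (\<Sum>b\<le>?m i. of_nat (?m i choose b) * mon (e m b))"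
  proof (rule sum.cong, rule refl)
    fix b
    have "(\<Prod>l\<in>UNIV. X l ^ Poly_Mapping.lookup (e m b) l) =
        X i ^ b * (X j ^ (?m j + (?m i - b)) * (\<Prod>l\<in>UNIV - {i} - {j}. X l ^ ?m l))"
      using assms(1) by (simp add: e_def prod.remove[of _ i] prod.remove[of "UNIV - {i}" j])
    moreover have "(\<Prod>l\<in>UNIV - {i}. X l ^ ?m l) = X j ^ ?m j * (\<Prod>l\<in>UNIV - {i} - {j}. X l ^ ?m l)"
      using assms(1) by (simp add: prod.remove[of "UNIV - {i}" j])
    ultimately show "of_nat (?m i choose b) * (X i ^ b * X j ^ (?m i - b) * (\<Prod>l\<in>UNIV - {i}. X l ^ ?m l)) =
        of_nat (?m i choose b) * mon (e m b)"
      by (simp add: mon_eq_prod power_add mult_ac)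
  qed
  finally show ?thesis .
qed

text \<open>The substitution of x_i + x_j for x_i takes \<open>m\<close> to \<open>s'\<close> only
  with b = s_j and m_i + m_j = s_i + s_j, so m_i lies between s_j and 3 s_j + 1. By
  \<open>odd_choose_spike\<close> the coefficient is odd only for m_i = s_j and m_i = 2 s_j + 1,
  that is, for \<open>s'\<close> and \<open>s\<close>.\<close>

lemma lookup_transvection:
  fixes i j :: "'n::finite"
  assumes ij: "i \<noteq> j" and s: "Poly_Mapping.lookup s j = 2 ^ k - 1" "Poly_Mapping.lookup s i = 2 * Poly_Mapping.lookup s j + 1"
  defines "s' \<equiv> expo ((Poly_Mapping.lookup s)(i := Poly_Mapping.lookup s j, j := Poly_Mapping.lookup s i))"
  shows "Poly_Mapping.lookup (linear_subst (transvection i j) f) s' = Poly_Mapping.lookup f s + Poly_Mapping.lookup f s'"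
proof (induction f rule: P_mon_induct)
  case (add m f)
  let ?m = "Poly_Mapping.lookup m" and ?s = "Poly_Mapping.lookup s"
  let ?e = "\<lambda>b. expo (?m(i := b, j := ?m j + (?m i - b)))"
  have ss': "s \<noteq> s'"
    using s(2) ij by (auto simp: s'_def dest!: arg_cong[where f = "\<lambda>m. Poly_Mapping.lookup m i"])
  have e: "?e b = s' \<longleftrightarrow> (\<forall>l. l \<noteq> i \<and> l \<noteq> j \<longrightarrow> ?m l = ?s l) \<and> b = ?s j \<and> ?m j + (?m i - b) = ?s i" for b
    using ij by (auto simp: s'_def poly_mapping_eq_iff fun_eq_iff)
  have m_s: "m = s \<longleftrightarrow> (\<forall>l. l \<noteq> i \<and> l \<noteq> j \<longrightarrow> ?m l = ?s l) \<and> ?m i = ?s i \<and> ?m j = ?s j"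
    "m = s' \<longleftrightarrow> (\<forall>l. l \<noteq> i \<and> l \<noteq> j \<longrightarrow> ?m l = ?s l) \<and> ?m i = ?s j \<and> ?m j = ?s i"
    using ij by (auto simp: s'_def poly_mapping_eq_iff fun_eq_iff)
  have "Poly_Mapping.lookup (linear_subst (transvection i j) (mon m)) s' =
      (\<Sum>b\<le>?m i. if ?e b = s' then of_nat (?m i choose b) else 0)"
    using ij by (simp add: linear_subst_transvection_mon lookup_sum lookup_of_nat_mult_mon)
  also have "\<dots> = (if m = s \<or> m = s' then 1 else 0)"
  proof (cases "(\<forall>l. l \<noteq> i \<and> l \<noteq> j \<longrightarrow> ?m l = ?s l) \<and> ?s j \<le> ?m i \<and> ?m j + (?m i - ?s j) = ?s i")
    case True
    then have "?e b = s' \<longleftrightarrow> b = ?s j" for b unfolding e by blast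
    then have "(\<Sum>b\<le>?m i. if ?e b = s' then of_nat (?m i choose b) else 0) =
        (\<Sum>b\<le>?m i. if b = ?s j then of_nat (?m i choose b) else (0 :: bit))"
      by (simp only:)
    also have "\<dots> = of_nat (?m i choose ?s j)" using True by simp
    also have "\<dots> = (if ?m i = ?s j \<or> ?m i = 2 * ?s j + 1 then 1 else 0)"
    proof -
      have "?s j \<le> ?m i" "?m i \<le> 3 * ?s j + 1" using True s(2) by linarith+
      then have odd: "odd (?m i choose ?s j) \<longleftrightarrow> ?m i = ?s j \<or> ?m i = 2 * ?s j + 1"
        by (rule odd_choose_spike[OF s(1)])
      show ?thesis
        unfolding of_nat_bit odd[symmetric] by (cases "even (?m i choose ?s j)") (simp_all only: if_True if_False not_True_eq_False not_False_eq_True)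
    qed
    also have "\<dots> = (if m = s \<or> m = s' then 1 else 0)"
      using True s(2) by (auto simp: m_s)
    finally show ?thesis .
  next
    case False
    then have "?e b \<noteq> s'" if "b \<le> ?m i" for b using that unfolding e by blast
    then have "(\<Sum>b\<le>?m i. if ?e b = s' then of_nat (?m i choose b) else 0) = (0 :: bit)"
      by (intro sum.neutral ballI) (simp only: atMost_iff if_False)
    moreover have "\<not> (m = s \<or> m = s')" using False s(2) by (auto simp: m_s)
    ultimately show ?thesis by simp
  qed
  also have "\<dots> = Poly_Mapping.lookup (mon m) s + Poly_Mapping.lookup (mon m) s'"
    using ss' by (auto simp: lookup_single when_def)
  finally show ?case using add by (simp only: linear_subst_simps lookup_add ac_simps)
qed (simp add: linear_subst_simps)

text \<open>Interchanging the two exponents gives another spike \<open>s'\<close>. Its coefficient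
  in the hit element \<open>linear_subst (transvection i j) f + f\<close> vanishes, but by
  \<open>lookup_transvection\<close> it equals the coefficient of \<open>s\<close> in
  \<open>f\<close>.\<close>

lemma lookup_invariant_spike:
  fixes i j :: "'n::finite"
  assumes "invariant_mod_hit f" "spike s" "i \<noteq> j"
    and s: "Poly_Mapping.lookup s i = 2 * Poly_Mapping.lookup s j + 1"
  shows "Poly_Mapping.lookup f s = 0"
proof -
  define s' where "s' = expo ((Poly_Mapping.lookup s)(i := Poly_Mapping.lookup s j, j := Poly_Mapping.lookup s i))"
  have "spike s'" using assms(2) by (auto simp: spike_def s'_def)
  moreover have "linear_subst (transvection i j) f + f \<in> hit"
    using assms by (simp add: invariant_mod_hit_def invertible_transvection)
  ultimately have "Poly_Mapping.lookup (linear_subst (transvection i j) f + f) s' = 0"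
    by (intro lookup_hit_spike)
  moreover obtain k where "Poly_Mapping.lookup s j = 2 ^ k - 1" using assms(2) by (auto simp: spike_def)
  then have "Poly_Mapping.lookup (linear_subst (transvection i j) f) s' = Poly_Mapping.lookup f s + Poly_Mapping.lookup f s'"
    unfolding s'_def using assms by (intro lookup_transvection) auto
  moreover have "b + b = 0" for b :: bit by (cases b) simp_all
  ultimately show ?thesis by (metis add.assoc add.right_neutral lookup_add)
qed

subsection \<open>Extension of scalars\<close>

type_synonym ('n, 'k) kP = "('n \<Rightarrow>\<^sub>0 nat) \<Rightarrow>\<^sub>0 'k"

definition cK :: "'k::zero \<Rightarrow> ('n, 'k) kP" where
  "cK c = Poly_Mapping.single 0 c"

definition XK :: "'n \<Rightarrow> ('n, 'k::zero_neq_one) kP" where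
  "XK i = Poly_Mapping.single (Poly_Mapping.single i 1) 1"

definition evalK :: "('k::zero \<Rightarrow> 'r::comm_ring_1) \<Rightarrow> ('n::finite \<Rightarrow> 'r) \<Rightarrow> ('n, 'k) kP \<Rightarrow> 'r" where
  "evalK h \<sigma> f = (\<Sum>m\<in>Poly_Mapping.keys f.
     h (Poly_Mapping.lookup f m) * (\<Prod>i\<in>UNIV. \<sigma> i ^ Poly_Mapping.lookup m i))"

lemma cK_simps [simp]:
  "cK 0 = 0" "cK 1 = 1" "cK (c + d) = cK c + cK d" "cK (c * d) = cK c * cK (d :: 'k::comm_ring_1)"
  unfolding cK_def by (simp_all only: single_zero single_one single_add mult_single add_0_left)

lemma cK_power: "cK (c ^ k) = cK (c :: 'k::comm_ring_1) ^ k"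
  by (induction k) simp_all

lemma cK_sum: "cK (sum c K) = (\<Sum>i\<in>K. cK (c i :: 'k::comm_ring_1))"
  by (induction K rule: infinite_finite_induct) simp_all

lemma lookup_cK_mult: "Poly_Mapping.lookup (cK c * f) m = c * Poly_Mapping.lookup (f :: ('n, 'k::comm_ring_1) kP) m"
proof (induction f rule: update_induct)
  case (update f a b)
  have u: "Poly_Mapping.update a b f = Poly_Mapping.single a b + f"
    using update by (intro poly_mapping_eqI)
      (auto simp: lookup_update lookup_add lookup_single when_def in_keys_iff)
  show ?case unfolding u distrib_left lookup_add update(3)
    by (simp add: cK_def mult_single lookup_single when_def distrib_left)
qed simp

lemma kP_induct [case_names zero add]:
  fixes f :: "('n, 'k::comm_monoid_add) kP"
  assumes "Q 0" and "\<And>m c f. Q f \<Longrightarrow> Q (Poly_Mapping.single m c + f)"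
  shows "Q f"
proof (induction f rule: update_induct)
  case const
  then show ?case using assms(1) by simp
next
  case (update f a b)
  have "Poly_Mapping.update a b f = Poly_Mapping.single a b + f"
    using update by (intro poly_mapping_eqI)
      (auto simp: lookup_update lookup_add lookup_single when_def in_keys_iff)
  then show ?case using assms(2)[OF update(3)] by simp
qed

locale coeff_hom =
  fixes h :: "'k::comm_ring_1 \<Rightarrow> 'r::comm_ring_1"
  assumes h0 [simp]: "h 0 = 0" and h1 [simp]: "h 1 = 1"
    and hadd: "h (c + d) = h c + h d" and hmult: "h (c * d) = h c * h d"
begin

lemma evalK_superset:
  assumes "finite K" "Poly_Mapping.keys f \<subseteq> K"
  shows "evalK h \<sigma> f =
    (\<Sum>m\<in>K. h (Poly_Mapping.lookup f m) * (\<Prod>i\<in>UNIV. \<sigma> i ^ Poly_Mapping.lookup m i))"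
  unfolding evalK_def using assms
  by (intro sum.mono_neutral_left) (auto simp: in_keys_iff)

lemma evalK_0 [simp]: "evalK h \<sigma> 0 = 0"
  by (simp add: evalK_def)

lemma evalK_add: "evalK h \<sigma> (f + g) = evalK h \<sigma> f + evalK h \<sigma> g"
proof -
  let ?K = "Poly_Mapping.keys f \<union> Poly_Mapping.keys g"
  have "Poly_Mapping.keys (f + g) \<subseteq> ?K" by (rule Poly_Mapping.keys_add)
  then show ?thesis
    by (simp only: evalK_superset[where K = ?K] finite_Un finite_keys Un_upper1 Un_upper2
        lookup_add hadd distrib_right sum.distrib)
qed

lemma evalK_single:
  "evalK h \<sigma> (Poly_Mapping.single m c) = h c * (\<Prod>i\<in>UNIV. \<sigma> i ^ Poly_Mapping.lookup m i)"
  by (subst evalK_superset[where K = "{m}"]) auto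

lemma evalK_mult_single: "evalK h \<sigma> (Poly_Mapping.single m c * g) =
    evalK h \<sigma> (Poly_Mapping.single m c) * evalK h \<sigma> g"
  by (induction g rule: kP_induct)
    (simp_all add: distrib_left evalK_add mult_single evalK_single lookup_add power_add
      prod.distrib hmult algebra_simps)

lemma evalK_mult: "evalK h \<sigma> (f * g) = evalK h \<sigma> f * evalK h \<sigma> g"
  by (induction f rule: kP_induct) (simp_all add: distrib_right evalK_add evalK_mult_single)

lemma evalK_XK [simp]: "evalK h \<sigma> (XK i) = \<sigma> i"
proof -
  have "(\<Prod>j\<in>UNIV. \<sigma> j ^ Poly_Mapping.lookup (Poly_Mapping.single i (1::nat)) j) =
      (\<Prod>j\<in>UNIV. if j = i then \<sigma> j else 1)"
    by (rule prod.cong) (auto simp: lookup_single when_def)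
  then show ?thesis by (simp add: XK_def evalK_single)
qed

lemma evalK_cK [simp]: "evalK h \<sigma> (cK c) = h c"
  by (simp add: cK_def evalK_single)

lemma evalK_1 [simp]: "evalK h \<sigma> 1 = 1"
  using evalK_cK[of \<sigma> 1] by simp

lemma evalK_power: "evalK h \<sigma> (f ^ k) = evalK h \<sigma> f ^ k"
  by (induction k) (simp_all add: evalK_mult)

lemma evalK_sum: "evalK h \<sigma> (sum f K) = (\<Sum>i\<in>K. evalK h \<sigma> (f i))"
  by (induction K rule: infinite_finite_induct) (simp_all add: evalK_add)

end

interpretation coeff_hom_cK: coeff_hom "cK :: 'k::comm_ring_1 \<Rightarrow> ('n, 'k) kP"
  by standard simp_all

interpretation coeff_hom_pCons_cK: coeff_hom "\<lambda>c :: 'k::comm_ring_1. [:cK c :: ('n, 'k) kP:]"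
  by standard (simp_all add: one_pCons)

text \<open>Scalars go to constant polynomials, so the coefficients of this ring homomorphism are
  the linear, not Frobenius-semilinear, extensions of the squares.\<close>

definition total_square_K :: "('n::finite, 'k::comm_ring_1) kP \<Rightarrow> ('n, 'k) kP poly" where
  "total_square_K = evalK (\<lambda>c. [:cK c:]) (\<lambda>i. [:XK i, XK i ^ 2:])"

lemma total_square_K_simps:
  "total_square_K (f + g) = total_square_K f + total_square_K g"
  "total_square_K (f * g) = total_square_K f * total_square_K g"
  "total_square_K (XK i) = [:XK i, XK i ^ 2:]"
  "total_square_K (cK c) = [:cK c:]"
  "total_square_K 1 = 1"
  "total_square_K 0 = 0"
  "total_square_K (f ^ k) = total_square_K f ^ k"
  "total_square_K (sum F K) = (\<Sum>i\<in>K. total_square_K (F i))"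
  unfolding total_square_K_def
  by (rule coeff_hom_pCons_cK.evalK_add coeff_hom_pCons_cK.evalK_mult coeff_hom_pCons_cK.evalK_XK
      coeff_hom_pCons_cK.evalK_cK coeff_hom_pCons_cK.evalK_1 coeff_hom_pCons_cK.evalK_0
      coeff_hom_pCons_cK.evalK_power coeff_hom_pCons_cK.evalK_sum)+

definition bit_K :: "bit \<Rightarrow> 'k::comm_ring_1" where
  "bit_K b = (if b = 0 then 0 else 1)"

definition linear_subst_K :: "bit ^ 'n ^ 'n \<Rightarrow> ('n::finite, 'k::comm_ring_1) kP \<Rightarrow> ('n, 'k) kP" where
  "linear_subst_K A = evalK cK (\<lambda>j. \<Sum>i\<in>UNIV. cK (bit_K (A $ i $ j)) * XK i)"

lemma linear_subst_K_simps:
  "linear_subst_K A (f + g) = linear_subst_K A f + linear_subst_K A g"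
  "linear_subst_K A (f * g) = linear_subst_K A f * linear_subst_K A g"
  "linear_subst_K A (XK j) = (\<Sum>i\<in>UNIV. cK (bit_K (A $ i $ j)) * XK i)"
  "linear_subst_K A (cK c) = cK c"
  "linear_subst_K A 1 = 1"
  "linear_subst_K A 0 = 0"
  "linear_subst_K A (f ^ k) = linear_subst_K A f ^ k"
  "linear_subst_K A (sum F K) = (\<Sum>i\<in>K. linear_subst_K A (F i))"
  unfolding linear_subst_K_def
  by (rule coeff_hom_cK.evalK_add coeff_hom_cK.evalK_mult coeff_hom_cK.evalK_XK
      coeff_hom_cK.evalK_cK coeff_hom_cK.evalK_1 coeff_hom_cK.evalK_0
      coeff_hom_cK.evalK_power coeff_hom_cK.evalK_sum)+

global_interpretation kP: vector_space "\<lambda>(c :: 'k::field) (f :: ('n, 'k) kP). cK c * f"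
  by standard (simp_all add: algebra_simps)

text \<open>The condition \<open>lam 1 = 1\<close> makes \<open>lamP\<close> a left inverse of
  \<open>incl\<close>, which is how results return to the field with two elements.\<close>

locale char_2_functional =
  fixes lam :: "'k::field \<Rightarrow> bit"
  assumes char_2: "(1 :: 'k) + 1 = 0"
    and lam_add: "lam (x + y) = lam x + lam y"
    and lam_1: "lam 1 = 1"
begin

lemma two_eq_0 [simp]: "(2 :: 'k) = 0"
  using char_2 by simp

lemma add_self: "(x :: 'k) + x = 0"
  using char_2 by (metis distrib_left mult_1_right mult_zero_right)

lemma kP_add_self: "(f :: ('n, 'k) kP) + f = 0"
  by (intro poly_mapping_eqI) (simp only: lookup_add add_self lookup_zero)

lemma lam_0 [simp]: "lam 0 = 0"
  using lam_add[of 0 0] by simp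

sublocale bit_K: bit_hom "bit_K :: bit \<Rightarrow> 'k"
proof
  show "bit_K (c + d) = bit_K c + (bit_K d :: 'k)" for c d
    by (cases c; cases d) (simp_all add: bit_K_def char_2)
qed (simp_all add: bit_K_def)

sublocale cK_bit_K: bit_hom "\<lambda>b. cK (bit_K b) :: ('n, 'k) kP"
  by standard (simp_all only: bit_K.hadd cK_simps bit_K.h0 bit_K.h1)

definition incl :: "'n::finite P \<Rightarrow> ('n, 'k) kP" where
  "incl = evalP (\<lambda>b. cK (bit_K b)) XK"

lemma incl_simps:
  "incl (f + g) = incl f + incl g"
  "incl (f * g) = incl f * incl g"
  "incl (X i) = XK i"
  "incl 1 = 1"
  "incl 0 = 0"
  unfolding incl_def
  by (rule cK_bit_K.evalP_add cK_bit_K.evalP_mult cK_bit_K.evalP_X cK_bit_K.evalP_1 cK_bit_K.evalP_0)+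

lemma incl_sum: "incl (sum f K) = (\<Sum>i\<in>K. incl (f i))"
  by (induction K rule: infinite_finite_induct) (simp_all add: incl_simps)

lemma XK_power: "(XK i :: ('n, 'k) kP) ^ k = Poly_Mapping.single (Poly_Mapping.single i k) 1"
  by (induction k) (simp_all add: XK_def mult_single flip: single_one single_add)

lemma incl_mon: "incl (mon m) = Poly_Mapping.single m 1"
proof -
  have s: "Poly_Mapping.single (sum g K) 1 = (\<Prod>i\<in>K. Poly_Mapping.single (g i) (1 :: 'k))"
    if "finite K" for g :: "'n \<Rightarrow> 'n \<Rightarrow>\<^sub>0 nat" and K
    using that
  proof (induction K rule: finite_induct)
    case (insert x F)
    have "Poly_Mapping.single (g x + sum g F) 1 = Poly_Mapping.single (g x) 1 * Poly_Mapping.single (sum g F) (1 :: 'k)"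
      by (simp add: mult_single)
    then show ?case using insert by simp
  qed simp
  have "incl (mon m) = (\<Prod>i\<in>UNIV. XK i ^ Poly_Mapping.lookup m i)"
    by (simp add: incl_def cK_bit_K.evalP_single)
  also have "\<dots> = Poly_Mapping.single (\<Sum>i\<in>UNIV. Poly_Mapping.single i (Poly_Mapping.lookup m i)) 1"
    by (simp only: XK_power s finite)
  finally show ?thesis by (simp only: sum_single_self)
qed

lemma lookup_incl: "Poly_Mapping.lookup (incl f) m = bit_K (Poly_Mapping.lookup f m)"
proof (induction f rule: P_mon_induct)
  case (add m f)
  then show ?case
    by (simp add: incl_simps lookup_add incl_mon bit_K.hadd lookup_single when_def)
qed (simp add: incl_simps)

lemma coeff_total_square_incl: "coeff (total_square_K (incl f)) k = incl (Sq k f)"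
proof -
  have "\<forall>k. coeff (total_square_K (incl f)) k = incl (coeff (total_square f) k)"
  proof (induction f rule: P_mult_induct)
    case one
    show ?case by (simp add: incl_simps total_square_K_simps total_square_simps one_pCons coeff_pCons split: nat.split)
  next
    case (X i)
    show ?case
      by (auto simp: incl_simps total_square_K_simps total_square_simps coeff_pCons
          power2_eq_square split: nat.split)
  qed (simp_all add: incl_simps total_square_K_simps total_square_simps coeff_mult incl_sum)
  then show ?thesis by (simp add: Sq_eq_coeff)
qed

lemma linear_subst_K_incl:
  fixes f :: "'n::finite P"
  shows "linear_subst_K A (incl f) = incl (linear_subst A f)"
proof (induction f rule: P_mult_induct)
  case (X i)
  have "incl (const c :: 'n P) = cK (bit_K c)" for c
    by (cases c) (simp_all add: incl_simps)
  then show ?case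
    by (simp add: incl_simps linear_subst_K_simps linear_subst_simps linform_def scaleP_def incl_sum)
qed (simp_all add: incl_simps linear_subst_K_simps linear_subst_simps)

definition lamP :: "('n, 'k) kP \<Rightarrow> 'n P" where
  "lamP f = Poly_Mapping.map lam f"

lemma lookup_lamP [simp]: "Poly_Mapping.lookup (lamP f) m = lam (Poly_Mapping.lookup f m)"
  by (simp add: lamP_def Poly_Mapping.map.rep_eq when_def)

lemma lamP_simps:
  "lamP (f + g) = lamP f + lamP g"
  "lamP 0 = 0"
  "lamP (incl p) = p"
proof -
  show "lamP (incl p) = p"
  proof (rule poly_mapping_eqI)
    fix m show "Poly_Mapping.lookup (lamP (incl p)) m = Poly_Mapping.lookup p m"
      by (cases "Poly_Mapping.lookup p m") (simp_all add: lookup_incl lam_1)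
  qed
qed (intro poly_mapping_eqI, simp add: lookup_add lam_add)+

lemma lamP_cK_incl: "lamP (cK c * incl f) = const (lam c) * f"
proof (rule poly_mapping_eqI)
  fix m
  have "Poly_Mapping.lookup (const (lam c) * f) m = lam c * Poly_Mapping.lookup f m"
    by (cases "lam c") simp_all
  then show "Poly_Mapping.lookup (lamP (cK c * incl f)) m = Poly_Mapping.lookup (const (lam c) * f) m"
    by (cases "Poly_Mapping.lookup f m") (simp_all add: lookup_cK_mult lookup_incl)
qed

lemma single_eq: "Poly_Mapping.single m c = cK c * incl (mon m)"
  by (simp add: incl_mon cK_def mult_single)

text \<open>The square of a monomial has coefficients in the prime field, so on a scalar multiple of
  it both sides only apply \<open>lam\<close> to the scalar.\<close>

lemma lamP_total_square: "lamP (coeff (total_square_K f) k) = Sq k (lamP f)"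
proof (induction f rule: kP_induct)
  case (add m c f)
  have "Sq k (const b * g) = const b * Sq k g" for b and g :: "'a P"
    by (cases b) simp_all
  then have "lamP (coeff (total_square_K (Poly_Mapping.single m c)) k) = Sq k (lamP (Poly_Mapping.single m c))"
    by (simp add: single_eq total_square_K_simps coeff_total_square_incl lamP_cK_incl)
  then show ?case using add by (simp add: total_square_K_simps lamP_simps Sq_simps)
qed (simp add: total_square_K_simps lamP_simps)

text \<open>The extension of scalars of the subspace \<^term>\<open>hit\<close>, described through all its coordinates.\<close>

definition hit_K :: "('n::finite, 'k) kP set" where
  "hit_K = {f. \<forall>c. lamP (cK c * f) \<in> hit}"

lemma hit_K_add: "f \<in> hit_K \<Longrightarrow> g \<in> hit_K \<Longrightarrow> f + g \<in> hit_K"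
  by (simp add: hit_K_def distrib_left lamP_simps hit_add)

lemma hit_K_scale: "f \<in> hit_K \<Longrightarrow> cK c * f \<in> hit_K"
  by (simp add: hit_K_def flip: mult.assoc cK_simps)

lemma hit_K_0: "0 \<in> hit_K"
  by (simp add: hit_K_def lamP_simps)

lemma subspace_hit_K: "kP.subspace hit_K"
  by (simp add: kP.subspace_def hit_K_0 hit_K_add hit_K_scale)

lemma hit_K_total_square: "k > 0 \<Longrightarrow> coeff (total_square_K f) k \<in> hit_K"
proof -
  assume k: "k > 0"
  have "cK c * coeff (total_square_K f) k = coeff (total_square_K (cK c * f)) k" for c
    by (simp add: total_square_K_simps)
  then show ?thesis using k by (simp add: hit_K_def lamP_total_square hit_Sq)
qed

lemma hit_if_incl_hit_K: "incl f \<in> hit_K \<Longrightarrow> f \<in> hit"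
  unfolding hit_K_def by (drule CollectD, drule spec[of _ 1]) (simp add: lamP_simps)

lemma lookup_hit_K_spike:
  assumes "f \<in> hit_K" "spike m"
  shows "Poly_Mapping.lookup f m = 0"
proof (rule ccontr)
  assume n: "Poly_Mapping.lookup f m \<noteq> 0"
  \<comment> \<open>Scaling makes the coefficient 1, where \<open>lam\<close> is known not to
    vanish.\<close>
  let ?c = "inverse (Poly_Mapping.lookup f m)"
  have "Poly_Mapping.lookup (lamP (cK ?c * f)) m = 0"
    using assms by (intro lookup_hit_spike) (simp_all add: hit_K_def)
  then show False using n by (simp add: lookup_cK_mult lam_1)
qed

end

subsection \<open>The normaliser of a Singer cycle\<close>

text \<open>Any numbering will do. The variable numbered \<open>l\<close> plays the role of the
  basis element z^l.\<close>

definition idx :: "5 \<Rightarrow> nat" where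
  "idx = (SOME f. bij_betw f UNIV {..<5})"

lemma bij_idx: "bij_betw idx UNIV {..<5}"
proof -
  have "\<exists>f. bij_betw f (UNIV :: 5 set) {..<5 :: nat}"
    using ex_bij_betw_finite_nat[of "UNIV :: 5 set"] by (simp add: atLeast0LessThan)
  then show ?thesis unfolding idx_def by (rule someI_ex)
qed

lemma idx_less: "idx a < 5"
  using bij_idx by (auto simp: bij_betw_def)

lemma idx_eq_iff [simp]: "idx a = idx b \<longleftrightarrow> a = b"
  using bij_idx by (auto simp: bij_betw_def inj_on_def)

lemma sum_idx: "(\<Sum>a\<in>UNIV. g (idx a)) = (\<Sum>j<5. g j)"
  using sum.reindex_bij_betw[OF bij_idx, of g] by simp

definition rows_matrix :: "nat list list \<Rightarrow> bit ^ 5 ^ 5" where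
  "rows_matrix R = (\<chi> l j. of_bool (idx j \<in> set (R ! idx l)))"

lemma rows_matrix_mult:
  assumes "\<forall>l<5. \<forall>j<5. odd (\<Sum>k<5. of_bool (k \<in> set (R ! l) \<and> j \<in> set (R' ! k)) :: nat) \<longleftrightarrow> l = j"
  shows "rows_matrix R ** rows_matrix R' = mat 1"
proof -
  have "(\<Sum>k\<in>UNIV. of_bool (idx k \<in> set (R ! idx l)) * of_bool (idx j \<in> set (R' ! idx k))) =
      (if l = j then 1 else (0 :: bit))" for l j
  proof -
    have "(\<Sum>k\<in>UNIV. of_bool (idx k \<in> set (R ! idx l)) * of_bool (idx j \<in> set (R' ! idx k))) =
        (\<Sum>k\<in>UNIV. of_nat (of_bool (idx k \<in> set (R ! idx l) \<and> idx j \<in> set (R' ! idx k))) :: bit)"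
      by (rule sum.cong) (simp_all only: of_bool_conj of_nat_mult of_nat_of_bool)
    also have "\<dots> = (\<Sum>k<5. of_nat (of_bool (k \<in> set (R ! idx l) \<and> idx j \<in> set (R' ! k))))"
      by (rule sum_idx)
    also have "\<dots> = of_nat (\<Sum>k<5. of_bool (k \<in> set (R ! idx l) \<and> idx j \<in> set (R' ! k)))"
      by (simp only: of_nat_sum)
    also have "\<dots> = (if l = j then 1 else 0)"
    proof -
      have "odd (\<Sum>k<5. of_bool (k \<in> set (R ! idx l) \<and> idx j \<in> set (R' ! k)) :: nat) \<longleftrightarrow> l = j"
        using assms idx_less[of l] idx_less[of j] by (simp only: idx_eq_iff)
      then show ?thesis unfolding of_nat_bit by presburger
    qed
    finally show ?thesis .
  qed
  then show ?thesis
    by (simp only: rows_matrix_def matrix_matrix_mult_def mat_def vec_eq_iff vec_lambda_beta) blast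
qed

abbreviation "cycle_rows \<equiv> [[1], [2], [3], [4], [0, 2]] :: nat list list"
abbreviation "frobenius_rows \<equiv> [[0], [2], [4], [1, 3], [0, 2, 3]] :: nat list list"

text \<open>
  Multiplication by \<open>z\<close> and squaring on the field with 32 elements, in the basis \<open>1, z, \<dots>, z\<^sup>4\<close>
  where \<open>z\<^sup>5 = z\<^sup>2 + 1\<close>.
\<close>

definition cycle_matrix :: "bit ^ 5 ^ 5" where
  "cycle_matrix = rows_matrix cycle_rows"

definition frobenius_matrix :: "bit ^ 5 ^ 5" where
  "frobenius_matrix = rows_matrix frobenius_rows"

lemma forall_less_5: "(\<forall>l<5::nat. Q l) \<longleftrightarrow> Q 0 \<and> Q 1 \<and> Q 2 \<and> Q 3 \<and> Q 4"
  by (auto simp: less_Suc_eq numeral_eq_Suc)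

lemma sum_less_5: "(\<Sum>k<5. g k) = g 0 + g 1 + g 2 + g 3 + g (4::nat)"
  by (simp add: numeral_eq_Suc)

lemma invertible_cycle: "invertible cycle_matrix"
proof -
  let ?R = "[[1, 4], [0], [1], [2], [3]] :: nat list list"
  have "rows_matrix cycle_rows ** rows_matrix ?R = mat 1" "rows_matrix ?R ** rows_matrix cycle_rows = mat 1"
    by (rule rows_matrix_mult; simp add: forall_less_5 sum_less_5)+
  then show ?thesis unfolding invertible_def cycle_matrix_def by blast
qed

lemma invertible_frobenius: "invertible frobenius_matrix"
proof -
  let ?R = "[[0], [0, 1, 3, 4], [1], [0, 1, 4], [2]] :: nat list list"
  have "rows_matrix frobenius_rows ** rows_matrix ?R = mat 1" "rows_matrix ?R ** rows_matrix frobenius_rows = mat 1"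
    by (rule rows_matrix_mult; simp add: forall_less_5 sum_less_5)+
  then show ?thesis unfolding invertible_def frobenius_matrix_def by blast
qed

section \<open>Averages of invariant classes\<close>

lemma invariant_mod_hit_funpow:
  assumes "invariant_mod_hit f" "invertible A"
  shows "(linear_subst A ^^ k) f + f \<in> hit"
proof (induction k)
  case (Suc k)
  have "linear_subst A ((linear_subst A ^^ k) f + f) \<in> hit" by (rule linear_subst_hit[OF Suc])
  moreover have "linear_subst A f + f \<in> hit" using assms by (simp add: invariant_mod_hit_def)
  ultimately have "linear_subst A ((linear_subst A ^^ k) f + f) + (linear_subst A f + f) \<in> hit" by (rule hit_add)
  moreover have "linear_subst A ((linear_subst A ^^ k) f + f) + (linear_subst A f + f) = (linear_subst A ^^ Suc k) f + f"
    by (simp add: linear_subst_simps add.assoc flip: add.assoc[of "linear_subst A f" "linear_subst A f" f])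
  ultimately show ?case by simp
qed simp

lemma invariant_mod_hit_cong:
  assumes "invariant_mod_hit f" "g + f \<in> hit"
  shows "invariant_mod_hit g"
  unfolding invariant_mod_hit_def
proof (intro allI impI)
  fix A :: "bit ^ 'a ^ 'a" assume "invertible A"
  then have "linear_subst A f + f \<in> hit" using assms(1) by (simp add: invariant_mod_hit_def)
  from hit_add[OF hit_add[OF linear_subst_hit[OF assms(2)] this] assms(2)]
  have "linear_subst A (g + f) + (linear_subst A f + f) + (g + f) \<in> hit" .
  moreover have "linear_subst A (g + f) + (linear_subst A f + f) + (g + f) = linear_subst A g + g"
    unfolding linear_subst_simps by (simp add: add_ac)
  ultimately show "linear_subst A g + g \<in> hit" by simp
qed

text \<open>An odd number of copies of \<open>f\<close> adds up to \<open>f\<close> modulo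
  2.\<close>

lemma average_mod_hit:
  fixes n :: nat and f :: "'n::finite P"
  assumes "\<And>k. k < n \<Longrightarrow> F k + f \<in> hit" "odd n"
  shows "(\<Sum>k<n. F k) + f \<in> hit"
proof -
  have f: "(\<Sum>k<n. f) = f" for f :: "'n P"
    using assms(2) by (elim oddE) (simp add: distrib_right mult.assoc)
  have "(\<Sum>k<n. F k + f) \<in> hit" using assms(1) by (intro hit_sum) auto
  then show ?thesis by (simp only: sum.distrib f)
qed

definition average :: "5 P \<Rightarrow> 5 P" where
  "average f = (\<Sum>k<5. (linear_subst frobenius_matrix ^^ k)
     (\<Sum>j<31. (linear_subst cycle_matrix ^^ j) f))"

text \<open>Both 31 and 5 are odd. The inner sum is congruent to \<open>f\<close> and therefore
  itself invariant modulo hit elements, as the second averaging requires.\<close>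

lemma average_congruent:
  assumes f: "invariant_mod_hit f"
  shows "average f + f \<in> hit"
proof -
  let ?g = "\<Sum>j<31. (linear_subst cycle_matrix ^^ j) f"
  have g: "?g + f \<in> hit"
    using invariant_mod_hit_funpow[OF f invertible_cycle] by (intro average_mod_hit) auto
  then have "invariant_mod_hit ?g" by (rule invariant_mod_hit_cong[OF f])
  then have "average f + ?g \<in> hit"
    unfolding average_def
    using invariant_mod_hit_funpow[OF _ invertible_frobenius] by (intro average_mod_hit) auto
  then have "average f + ?g + (?g + f) \<in> hit" using g by (rule hit_add)
  then show ?thesis by (simp only: add.assoc P_add_self flip: add.assoc[of ?g]) simp
qed

section \<open>The field with 32 elements and its trace\<close>

definition trace_exp :: "nat \<Rightarrow> bool" where
  "trace_exp e \<longleftrightarrow> e mod 31 \<in> {0, 3, 5, 6, 9, 10, 11, 12, 13, 17, 18, 20, 21, 22, 24, 26}"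

text \<open>This mirrors z^(e+5) = z^(e+2) + z^e: the exponents in \<open>trace_exp\<close> are
  those for which z^e has trace 1, see \<open>trace_K_z\<close>.\<close>

lemma trace_exp_add_5: "trace_exp (e + 5) \<longleftrightarrow> trace_exp (e + 2) \<noteq> trace_exp e"
proof -
  have "\<forall>r\<in>set [0..<31]. trace_exp (r + 5) \<longleftrightarrow> trace_exp (r + 2) \<noteq> trace_exp r"
    by (simp add: trace_exp_def upt_rec)
  then have "trace_exp (e mod 31 + 5) \<longleftrightarrow> trace_exp (e mod 31 + 2) \<noteq> trace_exp (e mod 31)" by simp
  then show ?thesis by (simp only: trace_exp_def mod_add_left_eq mod_mod_trivial)
qed

locale field_32 = char_2_functional lam for lam :: "'k::field \<Rightarrow> bit" +
  fixes z :: 'k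
  assumes z5: "z ^ 5 = z ^ 2 + 1"
begin

lemma square_add: "(x + y) ^ 2 = x ^ 2 + (y :: 'k) ^ 2"
  by (simp add: power2_sum)

lemma frobenius_add: "(x + y) ^ (2 ^ i) = x ^ (2 ^ i) + (y :: 'k) ^ (2 ^ i)"
  by (induction i) (simp_all add: square_add power_mult mult.commute[of 2])

lemma frobenius_sum: "(sum g S) ^ (2 ^ i) = (\<Sum>j\<in>S. (g j :: 'k) ^ (2 ^ i))"
  by (induction S rule: infinite_finite_induct) (simp_all add: frobenius_add)

lemma kP_square_add: "(x + y) ^ 2 = x ^ 2 + (y :: ('n, 'k) kP) ^ 2"
proof -
  have "(2 :: ('n, 'k) kP) = 0" using kP_add_self[of 1] by simp
  then show ?thesis by (simp add: power2_sum)
qed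

lemma kP_square_sum: "(sum g S) ^ 2 = (\<Sum>j\<in>S. (g j :: ('n, 'k) kP) ^ 2)"
  by (induction S rule: infinite_finite_induct) (simp_all add: kP_square_add)

lemma add_left_self: "x + (x + y) = (y :: 'k)"
  by (simp add: add_self flip: add.assoc)

lemma z_powers:
  "z ^ 6 = z ^ 3 + z" "z ^ 8 = z ^ 3 + z ^ 2 + 1" "z ^ 12 = z ^ 3 + z ^ 2 + z"
  "z ^ 16 = z ^ 4 + z ^ 3 + z + 1" "z ^ 17 = z ^ 4 + z + 1" "z ^ 24 = z ^ 4 + z ^ 3 + z ^ 2 + z" "z ^ 32 = z"
  "z ^ 48 = z ^ 4 + z + 1" "z ^ 64 = z ^ 2"
proof -
  note ac = add_ac add_self add_left_self
  have "z ^ 6 = z * z ^ 5" by (simp flip: power_Suc)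
  then show z6: "z ^ 6 = z ^ 3 + z" by (simp add: z5 distrib_left power3_eq_cube power2_eq_square)
  have "z ^ 8 = z ^ 3 * z ^ 5" by (simp flip: power_add)
  also have "\<dots> = z ^ 5 + z ^ 3" unfolding z5 by (simp add: distrib_left flip: power_add) (simp add: z5)
  finally show z8: "z ^ 8 = z ^ 3 + z ^ 2 + 1" by (simp add: z5 add_ac)
  have "z ^ 12 = (z ^ 6) ^ 2" by (simp flip: power_mult)
  then show z12: "z ^ 12 = z ^ 3 + z ^ 2 + z"
    unfolding z6 square_add by (simp add: z6 ac flip: power_mult)
  have "z ^ 16 = (z ^ 8) ^ 2" by (simp flip: power_mult)
  then show z16: "z ^ 16 = z ^ 4 + z ^ 3 + z + 1"
    unfolding z8 square_add by (simp add: z6 ac flip: power_mult)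
  have "z ^ 17 = z * z ^ 16" by (simp flip: power_Suc)
  also have "\<dots> = z ^ 5 + z ^ 4 + z ^ 2 + z"
    unfolding z16 by (simp add: distrib_left flip: power_Suc power_Suc2) (simp add: power2_eq_square)
  finally show "z ^ 17 = z ^ 4 + z + 1" by (simp add: z5 ac)
  have "z ^ 24 = (z ^ 12) ^ 2" by (simp flip: power_mult)
  then show z24: "z ^ 24 = z ^ 4 + z ^ 3 + z ^ 2 + z"
    unfolding z12 square_add by (simp add: z6 ac flip: power_mult)
  have "z ^ 32 = (z ^ 16) ^ 2" by (simp flip: power_mult)
  then show z32: "z ^ 32 = z"
    unfolding z16 square_add by (simp add: z6 z8 ac flip: power_mult)
  have "z ^ 48 = (z ^ 24) ^ 2" by (simp flip: power_mult)
  then show "z ^ 48 = z ^ 4 + z + 1"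
    unfolding z24 square_add by (simp add: z6 z8 ac flip: power_mult)
  have "z ^ 64 = (z ^ 32) ^ 2" by (simp flip: power_mult)
  then show "z ^ 64 = z ^ 2" unfolding z32 .
qed

lemma z_nonzero: "z \<noteq> 0"
  using z5 by (auto simp: power_0_left)

lemma z_not_1: "z \<noteq> 1"
proof
  assume "z = 1"
  then have "1 = (1 :: 'k) + 1" using z5 by (metis power_one)
  then show False by (simp add: char_2)
qed

lemma z_pow_31: "z ^ 31 = 1"
proof -
  have "z ^ 31 * z = 1 * z" by (simp add: z_powers flip: power_Suc2)
  then show ?thesis using z_nonzero by simp
qed

lemma z_pow_mod: "z ^ (e mod 31) = z ^ e"
proof -
  have "z ^ e = z ^ (31 * (e div 31) + e mod 31)" by simp
  also have "\<dots> = z ^ (e mod 31)" by (simp only: power_add power_mult z_pow_31 power_one mult_1_left)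
  finally show ?thesis by simp
qed

text \<open>The prime 31 does not divide \<open>w\<close>, so z^w = 1 together with z^31 = 1 would
  give z = 1 by Bezout.\<close>

lemma z_pow_neq_1:
  assumes "w mod 31 \<noteq> 0"
  shows "z ^ w \<noteq> 1"
proof
  assume w: "z ^ w = 1"
  have "prime (31 :: nat)" by code_simp
  moreover have "\<not> 31 dvd w" using assms by (simp add: dvd_eq_mod_eq_0)
  ultimately have "coprime 31 w" by (rule prime_imp_coprime)
  then obtain x y where "w * x = 31 * y + 1"
    using coprime_bezout_strong[of w 31] by (auto simp: coprime_commute)
  then have "(z ^ w) ^ x = (z ^ 31) ^ y * z" by (metis power_add power_mult power_one_right)
  then show False using z_not_1 by (simp add: w z_pow_31)
qed

text \<open>Orthogonality of characters of the cyclic group of order 31, whose order is 1 in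
  characteristic 2.\<close>

lemma sum_z_pow: "(\<Sum>j<31. z ^ (j * w)) = (if w mod 31 = 0 then 1 else 0)"
proof (cases "w mod 31 = 0")
  case True
  then have "z ^ (j * w) = 1" for j
    using z_pow_mod[of "j * w"] by (simp add: mod_mult_right_eq[of j w, symmetric] del: mod_mult_right_eq)
  moreover have "(31 :: 'k) = 1"
  proof -
    have "(31 :: 'k) = 2 * 15 + 1" by (simp del: two_eq_0)
    also have "\<dots> = 1" by (simp only: two_eq_0 mult_zero_left add_0_left)
    finally show ?thesis .
  qed
  ultimately show ?thesis using True by simp
next
  case False
  have "(z ^ w - 1) * (\<Sum>j<31. (z ^ w) ^ j) = (z ^ w) ^ 31 - 1"
    by (rule power_diff_1_eq[symmetric])
  also have "\<dots> = 0" by (simp add: z_pow_31 mult.commute[of w] power_mult flip: power_mult[of z w 31])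
  finally have "(\<Sum>j<31. (z ^ w) ^ j) = 0" using z_pow_neq_1[OF False] by simp
  then show ?thesis using False by (simp add: mult.commute[of _ w] power_mult)
qed

definition trace_K :: "'k \<Rightarrow> 'k" where
  "trace_K x = (\<Sum>i<5. x ^ (2 ^ i))"

lemma trace_K_add: "trace_K (x + y) = trace_K x + trace_K y"
  by (simp add: trace_K_def frobenius_add sum.distrib)

text \<open>From exponent 5 on, z^5 = z^2 + 1 reduces to smaller exponents; the traces of 1, z, ...,
  z^4 are computed from the table \<open>z_powers\<close>.\<close>

lemma trace_K_z: "trace_K (z ^ e) = of_bool (trace_exp e)"
proof (induction e rule: less_induct)
  case (less e)
  note ac = add_ac add_self add_left_self
  consider "e = 0" | "e = 1" | "e = 2" | "e = 3" | "e = 4" | e' where "e = e' + 5"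
  proof -
    have "e = 0 \<or> e = 1 \<or> e = 2 \<or> e = 3 \<or> e = 4 \<or> e = (e - 5) + 5" by linarith
    then show ?thesis using that by metis
  qed
  then show ?case
  proof cases
    case 6
    have "z ^ e = z ^ (e' + 2) + z ^ e'" by (simp add: 6 power_add z5 distrib_left power2_eq_square)
    then have "trace_K (z ^ e) = of_bool (trace_exp (e' + 2)) + of_bool (trace_exp e')"
      using less[of "e' + 2"] less[of e'] 6 by (simp add: trace_K_add)
    also have "\<dots> = of_bool (trace_exp e)"
      unfolding 6 trace_exp_add_5 by (cases "trace_exp e'"; cases "trace_exp (e' + 2)") simp_all
    finally show ?thesis .
  next
    case 1
    have "(5 :: 'k) = 2 * 2 + 1" by (simp del: two_eq_0)
    also have "\<dots> = 1" by (simp only: two_eq_0 mult_zero_left add_0_left)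
    finally show ?thesis by (simp add: 1 trace_K_def trace_exp_def)
  next
    case 2
    have "trace_K z = z + z ^ 2 + z ^ 4 + z ^ 8 + z ^ 16"
      by (simp add: trace_K_def sum_less_5 flip: power_mult)
    then show ?thesis by (simp add: 2 trace_exp_def z_powers ac)
  next
    case 3
    have "trace_K (z ^ 2) = z ^ 2 + z ^ 4 + z ^ 8 + z ^ 16 + z ^ 32"
      by (simp add: trace_K_def sum_less_5 flip: power_mult)
    then show ?thesis by (simp add: 3 trace_exp_def z_powers ac)
  next
    case 4
    have "trace_K (z ^ 3) = z ^ 3 + z ^ 6 + z ^ 12 + z ^ 24 + z ^ 48"
      by (simp add: trace_K_def sum_less_5 flip: power_mult)
    then show ?thesis by (simp add: 4 trace_exp_def z_powers ac)
  next
    case 5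
    have "trace_K (z ^ 4) = z ^ 4 + z ^ 8 + z ^ 16 + z ^ 32 + z ^ 64"
      by (simp add: trace_K_def sum_less_5 flip: power_mult)
    then show ?thesis by (simp add: 5 trace_exp_def z_powers ac)
  qed
qed

text \<open>The coefficients z^l of \<open>Y 0\<close> are raised to the power 2^i, which makes the
  five forms conjugate. Since z^32 = z, only i modulo 5 matters.\<close>

definition Y :: "nat \<Rightarrow> (5, 'k) kP" where
  "Y i = (\<Sum>a\<in>UNIV. cK (z ^ (idx a * 2 ^ i)) * XK a)"

lemma z_pow_periodic: "z ^ (e * 2 ^ (i + 5)) = z ^ (e * 2 ^ i)"
proof -
  have "e * 2 ^ (i + 5) = e * 2 ^ i + 31 * (e * 2 ^ i)" by (simp add: power_add)
  then show ?thesis by (simp only: power_add power_mult[of z 31] z_pow_31 power_one mult_1_right)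
qed

lemma Y_periodic: "Y (i + 5) = Y i"
  by (simp only: Y_def z_pow_periodic)

text \<open>The index i + 4 stands for i - 1 modulo 5: the coefficient of x_l^2 in the first square
  of \<open>Y i\<close> is z^(l 2^i), the square of the coefficient of x_l in
  \<open>Y (i + 4)\<close>.\<close>

lemma total_square_Y: "total_square_K (Y i) = [:Y i, Y (i + 4) ^ 2:]"
proof -
  have p: "(\<Sum>a\<in>S. [:F a, G a:]) = [:sum F S, sum G S:]" for F G :: "5 \<Rightarrow> (5, 'k) kP" and S
    by (induction S rule: infinite_finite_induct) simp_all
  have "Y (i + 4) ^ 2 = (\<Sum>a\<in>UNIV. cK (z ^ (idx a * 2 ^ (i + 5))) * XK a ^ 2)"
    by (simp add: Y_def kP_square_sum power_mult_distrib power_add mult_ac flip: cK_power power_mult)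
  also have "\<dots> = (\<Sum>a\<in>UNIV. cK (z ^ (idx a * 2 ^ i)) * XK a ^ 2)"
    by (simp only: z_pow_periodic)
  finally show ?thesis
    by (simp add: Y_def[of i] total_square_K_simps p mult.commute)
qed

text \<open>Row \<open>l\<close> of \<open>R\<close> lists the powers of z with sum
  \<open>u l\<close>. The coefficient of x_l in the image is the sum of their 2^i-th powers, which
  is the 2^i-th power of \<open>u l\<close> because Frobenius is additive.\<close>

lemma linear_subst_rows_Y:
  assumes "\<forall>l<5. distinct (R ! l) \<and> set (R ! l) \<subseteq> {..<5} \<and> (\<Sum>j\<leftarrow>R ! l. z ^ j) = u l"
  shows "linear_subst_K (rows_matrix R) (Y i) = (\<Sum>a\<in>UNIV. cK (u (idx a) ^ (2 ^ i)) * XK a)"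
proof -
  have "linear_subst_K (rows_matrix R) (Y i) =
      (\<Sum>b\<in>UNIV. \<Sum>a\<in>UNIV. cK (z ^ (idx b * 2 ^ i) * of_bool (idx b \<in> set (R ! idx a))) * XK a)"
  proof -
    have "bit_K (of_bool P) = (of_bool P :: 'k)" for P by (cases P) (simp_all add: bit_K_def)
    then show ?thesis
      by (simp only: Y_def linear_subst_K_simps rows_matrix_def vec_lambda_beta sum_distrib_left cK_simps mult.assoc)
  qed
  also have "\<dots> = (\<Sum>a\<in>UNIV. cK (\<Sum>b\<in>UNIV. z ^ (idx b * 2 ^ i) * of_bool (idx b \<in> set (R ! idx a))) * XK a)"
    by (subst sum.swap) (simp only: cK_sum sum_distrib_right)
  also have "\<dots> = (\<Sum>a\<in>UNIV. cK (u (idx a) ^ (2 ^ i)) * XK a)"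
  proof (rule sum.cong, rule refl)
    fix a
    let ?S = "set (R ! idx a)"
    have S: "distinct (R ! idx a)" "?S \<subseteq> {..<5}" "(\<Sum>j\<leftarrow>R ! idx a. z ^ j) = u (idx a)"
      using assms idx_less by blast+
    have "(\<Sum>b\<in>UNIV. z ^ (idx b * 2 ^ i) * of_bool (idx b \<in> ?S)) = (\<Sum>j<5. z ^ (j * 2 ^ i) * of_bool (j \<in> ?S))"
      by (rule sum_idx)
    also have "\<dots> = (\<Sum>j\<in>?S. z ^ (j * 2 ^ i))"
      using S(2) by (intro sum.mono_neutral_cong_right) auto
    also have "\<dots> = u (idx a) ^ (2 ^ i)"
      unfolding S(3)[symmetric] sum_list_distinct_conv_sum_set[OF S(1)] frobenius_sum power_mult ..
    finally show "cK (\<Sum>b\<in>UNIV. z ^ (idx b * 2 ^ i) * of_bool (idx b \<in> ?S)) * XK a = cK (u (idx a) ^ (2 ^ i)) * XK a"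
      by simp
  qed
  finally show ?thesis .
qed

lemma cycle_Y: "linear_subst_K cycle_matrix (Y i) = cK (z ^ (2 ^ i)) * Y i"
proof -
  have "linear_subst_K (rows_matrix cycle_rows) (Y i) = (\<Sum>a\<in>UNIV. cK ((z ^ (idx a + 1)) ^ (2 ^ i)) * XK a)"
  proof (rule linear_subst_rows_Y)
    have "z * (z * (z * (z * z))) = 1 + z * z"
      using z5 by (simp add: power_numeral_reduce power2_eq_square add.commute)
    then show "\<forall>l<5. distinct (cycle_rows ! l) \<and> set (cycle_rows ! l) \<subseteq> {..<5} \<and> (\<Sum>j\<leftarrow>cycle_rows ! l. z ^ j) = z ^ (l + 1)"
      by (simp add: forall_less_5 power2_eq_square power3_eq_cube power4_eq_xxxx mult.assoc)
  qed
  also have "\<dots> = cK (z ^ (2 ^ i)) * Y i"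
    by (simp add: Y_def sum_distrib_left power_mult_distrib power_add mult_ac flip: power_mult)
  finally show ?thesis unfolding cycle_matrix_def .
qed

lemma frobenius_Y: "linear_subst_K frobenius_matrix (Y i) = Y (Suc i)"
proof -
  have "linear_subst_K (rows_matrix frobenius_rows) (Y i) = (\<Sum>a\<in>UNIV. cK ((z ^ (2 * idx a)) ^ (2 ^ i)) * XK a)"
    by (rule linear_subst_rows_Y) (simp add: forall_less_5 z_powers add_ac power2_eq_square)
  also have "\<dots> = Y (Suc i)"
    by (simp add: Y_def mult_ac flip: power_mult)
  finally show ?thesis unfolding frobenius_matrix_def .
qed

end

subsection \<open>Squares in the eigenvariables\<close>

text \<open>The cycle multiplies the monomial with exponents \<open>ms\<close>, starting at
  \<open>Y i\<close>, by z to this power (\<open>cycle_Ymon\<close>).\<close>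

primrec weight :: "nat \<Rightarrow> nat list \<Rightarrow> nat" where
  "weight i [] = 0"
| "weight i (m # ms) = m * 2 ^ i + weight (Suc i) ms"

text \<open>By Lucas' theorem these are the \<open>b\<close> for which \<open>n choose b\<close> is odd.\<close>

fun submasks :: "nat \<Rightarrow> nat list" where
  "submasks n = (if n = 0 then [0] else
     let r = map ((*) 2) (submasks (n div 2)) in if even n then r else r @ map Suc r)"
declare submasks.simps [simp del]

text \<open>One submask is chosen for every entry, with total \<open>k\<close>. The loop over the
  submasks is an explicit recursion for evaluation; \<open>splits_Cons\<close> restates it for
  proofs.\<close>

fun splits :: "nat list \<Rightarrow> nat \<Rightarrow> nat list list"
  and splits_over :: "nat list \<Rightarrow> nat \<Rightarrow> nat list \<Rightarrow> nat list list" where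
  "splits [] k = (if k = 0 then [[]] else [])"
| "splits (m # ms) k = splits_over ms k (submasks m)"
| "splits_over ms k [] = []"
| "splits_over ms k (b # bs) =
     (if b \<le> k then map ((#) b) (splits ms (k - b)) @ splits_over ms k bs else splits_over ms k bs)"

text \<open>The square turns b_i of the m_i factors Y_i into Y_(i-1)^2. Hence exponent i becomes m_i
  - b_i + 2 b_(i+1), with indices modulo 5; \<open>rotate1\<close> supplies the shift.\<close>

definition twist :: "nat list \<Rightarrow> nat list \<Rightarrow> nat list" where
  "twist ms bs = map2 (+) (map2 (-) ms bs) (map ((*) 2) (rotate1 bs))"

definition twisted_square :: "nat \<Rightarrow> nat list \<Rightarrow> nat list list" where
  "twisted_square k ms = map (twist ms) (splits ms k)"

lemma splits_Cons:
  "splits (m # ms) k = concat (map (\<lambda>b. map ((#) b) (splits ms (k - b))) (filter (\<lambda>b. b \<le> k) (submasks m)))"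
proof -
  have "splits_over ms k bs = concat (map (\<lambda>b. map ((#) b) (splits ms (k - b))) (filter (\<lambda>b. b \<le> k) bs))" for bs
    by (induction bs) simp_all
  then show ?thesis by simp
qed

declare splits.simps(2) [simp del]

lemma submasks_le: "b \<in> set (submasks n) \<Longrightarrow> b \<le> n"
proof (induction n arbitrary: b rule: submasks.induct)
  case (1 n)
  show ?case
  proof (cases "n = 0")
    case True
    then show ?thesis using "1.prems" by (simp add: submasks.simps)
  next
    case False
    then obtain b' where b': "b' \<in> set (submasks (n div 2))" "b = 2 * b' \<or> (odd n \<and> b = Suc (2 * b'))"
      using "1.prems" by (subst (asm) submasks.simps) (auto simp: Let_def split: if_splits)
    then have "b' \<le> n div 2" using "1.IH" False by blast
    then show ?thesis using b'(2) by (auto elim!: oddE)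
  qed
qed

lemma splits_length: "bs \<in> set (splits ms k) \<Longrightarrow> length bs = length ms"
  by (induction ms arbitrary: bs k) (auto simp: splits_Cons split: if_splits)

lemma length_5_E:
  assumes "length ms = 5"
  obtains a b c d e where "ms = [a, b, c, d, e]"
  using assms by (auto simp: numeral_eq_Suc length_Suc_conv)

text \<open>The powers z^26, z^25, z^29, z^28, z^27 form the basis dual to 1, z, ..., z^4 under the
  trace form.\<close>

definition dual_exp :: "nat \<Rightarrow> nat" where
  "dual_exp l = [26, 25, 29, 28, 27] ! l"

context field_32
begin

primrec Ymon :: "nat \<Rightarrow> nat list \<Rightarrow> (5, 'k) kP" where
  "Ymon i [] = 1"
| "Ymon i (m # ms) = Y i ^ m * Ymon (Suc i) ms"

text \<open>All five shifts are always summed: exponents that are constant, and so fixed by the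
  shift, are counted five times, which is once modulo 2.\<close>

definition Yorbit :: "nat list \<Rightarrow> (5, 'k) kP" where
  "Yorbit ms = (\<Sum>r<5. Ymon r ms)"

lemma cycle_Ymon: "linear_subst_K cycle_matrix (Ymon i ms) = cK (z ^ weight i ms) * Ymon i ms"
proof (induction ms arbitrary: i)
  case (Cons m ms)
  have "cK (z ^ (m * 2 ^ i + weight (Suc i) ms)) = cK (z ^ (2 ^ i)) ^ m * (cK (z ^ weight (Suc i) ms) :: (5, 'k) kP)"
    by (simp add: power_add mult.commute[of m] power_mult cK_power)
  then show ?case
    by (simp add: linear_subst_K_simps cycle_Y Cons power_mult_distrib)
qed (simp add: linear_subst_K_simps)

lemma cycle_Ymon_funpow:
  "(linear_subst_K cycle_matrix ^^ j) (Ymon i ms) = cK (z ^ (j * weight i ms)) * Ymon i ms"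
  by (induction j) (simp_all add: linear_subst_K_simps cycle_Ymon power_add mult_ac)

lemma frobenius_Ymon: "linear_subst_K frobenius_matrix (Ymon i ms) = Ymon (Suc i) ms"
  by (induction ms arbitrary: i) (simp_all add: linear_subst_K_simps frobenius_Y)

lemma frobenius_Ymon_funpow: "(linear_subst_K frobenius_matrix ^^ k) (Ymon i ms) = Ymon (k + i) ms"
  by (induction k) (simp_all add: frobenius_Ymon)

definition average_K :: "(5, 'k) kP \<Rightarrow> (5, 'k) kP" where
  "average_K f = (\<Sum>k<5. (linear_subst_K frobenius_matrix ^^ k)
     (\<Sum>j<31. (linear_subst_K cycle_matrix ^^ j) f))"

lemma funpow_linear_subst_K:
  "(linear_subst_K A ^^ k) (f + g) = (linear_subst_K A ^^ k) f + (linear_subst_K A ^^ k) g"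
  "(linear_subst_K A ^^ k) (cK c * f) = cK c * (linear_subst_K A ^^ k) f"
  "(linear_subst_K A ^^ k) 0 = 0"
  "(linear_subst_K A ^^ k) (incl p) = incl ((linear_subst A ^^ k) p)"
  by (induction k) (simp_all add: linear_subst_K_simps linear_subst_K_incl)

lemma average_K_simps:
  "average_K (f + g) = average_K f + average_K g"
  "average_K (cK c * f) = cK c * average_K f"
  "average_K 0 = 0"
  "average_K (incl p) = incl (average p)"
proof -
  show "average_K (incl p) = incl (average p)"
    unfolding average_K_def average_def by (simp only: funpow_linear_subst_K(4) incl_sum[symmetric])
qed (simp_all add: average_K_def funpow_linear_subst_K sum.distrib flip: sum_distrib_left)

text \<open>The cycle acts by a scalar, so its average is the character sum
  \<open>sum_z_pow\<close>; the powers of the Frobenius matrix then run through the shifts.\<close>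

lemma average_K_Ymon:
  "average_K (Ymon 0 ms) = (if weight 0 ms mod 31 = 0 then Yorbit ms else 0)"
proof -
  have "(\<Sum>j<31. (linear_subst_K cycle_matrix ^^ j) (Ymon 0 ms)) =
      cK (\<Sum>j<31. z ^ (j * weight 0 ms)) * Ymon 0 ms"
    by (simp only: cycle_Ymon_funpow cK_sum sum_distrib_right)
  then show ?thesis
    by (simp add: average_K_def sum_z_pow funpow_linear_subst_K frobenius_Ymon_funpow Yorbit_def)
qed

lemma Y_mult_Ymon: "i < length ms \<Longrightarrow> Y (k + i) * Ymon k ms = Ymon k (ms[i := Suc (ms ! i)])"
proof (induction ms arbitrary: i k)
  case (Cons m ms)
  show ?case
  proof (cases i)
    case (Suc i')
    then have "Y (Suc k + i') * Ymon (Suc k) ms = Ymon (Suc k) (ms[i' := Suc (ms ! i')])"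
      using Cons by (intro Cons.IH) simp
    then show ?thesis using Suc by (simp add: mult.left_commute)
  qed (simp add: mult.assoc)
qed simp

text \<open>After exchanging the sums, the coefficient of x_b on the right is the trace of
  z^(dual_exp a + b), which is 1 for b = a and 0 otherwise by the choice of
  \<open>dual_exp\<close>.\<close>

lemma XK_eq_sum_Y: "XK a = (\<Sum>i<5. cK ((z ^ dual_exp (idx a)) ^ (2 ^ i)) * Y i)"
proof -
  have "trace_exp (dual_exp l + j) \<longleftrightarrow> l = j" if "l < 5" "j < 5" for l j
  proof -
    have "\<forall>l<5. \<forall>j<5. trace_exp (dual_exp l + j) \<longleftrightarrow> l = j"
      by (simp add: forall_less_5 dual_exp_def trace_exp_def)
    then show ?thesis using that by blast
  qed
  then have t: "trace_K (z ^ (dual_exp (idx a) + idx b)) = of_bool (a = b)" for b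
    by (simp add: trace_K_z idx_less)
  have "(\<Sum>i<5. cK ((z ^ dual_exp (idx a)) ^ (2 ^ i)) * Y i) =
      (\<Sum>b\<in>UNIV. \<Sum>i<5. cK ((z ^ (dual_exp (idx a) + idx b)) ^ (2 ^ i)) * XK b)"
    unfolding Y_def sum_distrib_left
    by (subst sum.swap) (simp only: power_add power_mult_distrib power_mult cK_simps mult.assoc)
  also have "\<dots> = (\<Sum>b\<in>UNIV. cK (trace_K (z ^ (dual_exp (idx a) + idx b))) * XK b)"
    by (simp only: trace_K_def cK_sum sum_distrib_right)
  also have "\<dots> = (\<Sum>b\<in>UNIV. if a = b then XK b else 0)"
    by (rule sum.cong) (auto simp: t)
  finally show ?thesis by simp
qed

definition Ymons :: "nat \<Rightarrow> (5, 'k) kP set" where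
  "Ymons d = {Ymon 0 ms | ms. length ms = 5 \<and> sum_list ms = d}"

lemma XK_mult_span_Ymons:
  assumes "f \<in> kP.span (Ymons d)"
  shows "XK a * f \<in> kP.span (Ymons (Suc d))"
  using assms
proof (induction rule: kP.span_induct_alt)
  case base
  show ?case by (simp add: kP.span_zero)
next
  case (step c x y)
  then obtain ms where ms: "x = Ymon 0 ms" "length ms = 5" "sum_list ms = d" by (auto simp: Ymons_def)
  have "Y i * x \<in> Ymons (Suc d)" if "i < 5" for i
    using that ms Y_mult_Ymon[of i ms 0] by (auto simp: Ymons_def sum_list_update intro!: exI[of _ "ms[i := Suc (ms ! i)]"])
  then have "XK a * x \<in> kP.span (Ymons (Suc d))"
    unfolding XK_eq_sum_Y sum_distrib_right mult.assoc
    by (intro kP.span_sum kP.span_scale kP.span_base) simp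
  then have "cK c * (XK a * x) + XK a * y \<in> kP.span (Ymons (Suc d))"
    using step by (intro kP.span_add kP.span_scale)
  then show ?case by (simp add: distrib_left mult.left_commute)
qed

lemma incl_span_Ymons:
  assumes "homogeneous d f"
  shows "incl f \<in> kP.span (Ymons d)"
proof -
  have mon: "incl (mon m) \<in> kP.span (Ymons (total_degree m))" for m :: "5 \<Rightarrow>\<^sub>0 nat"
  proof (induction "total_degree m" arbitrary: m)
    case 0
    then have "m = 0" by (intro poly_mapping_eqI) (simp add: total_degree_def)
    moreover have "1 \<in> Ymons 0" by (auto simp: Ymons_def intro!: exI[of _ "[0, 0, 0, 0, 0]"])
    ultimately show ?case using 0 by (simp add: incl_simps kP.span_base)
  next
    case (Suc d)
    then have "\<exists>i. Poly_Mapping.lookup m i \<noteq> 0"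
      by (metis total_degree_def nat.distinct(1) sum.neutral)
    then obtain i where i: "Poly_Mapping.lookup m i > 0" by auto
    define m' where "m' = m - Poly_Mapping.single i 1"
    have m: "m = Poly_Mapping.single i 1 + m'"
      using i by (intro poly_mapping_eqI) (auto simp: m'_def lookup_add lookup_minus lookup_single when_def)
    have "total_degree m = Suc (total_degree m')"
    proof -
      have "total_degree m = (\<Sum>j\<in>UNIV. if j = i then 1 else 0) + total_degree m'"
        unfolding total_degree_def sum.distrib[symmetric]
        by (rule sum.cong) (auto simp: m lookup_add lookup_single when_def)
      then show ?thesis by simp
    qed
    moreover have "incl (mon m) = XK i * incl (mon m')"
    proof -
      have "mon m = X i * mon m'" by (simp add: X_def mult_single m)
      then show ?thesis by (simp add: incl_simps)
    qed
    ultimately show ?case using Suc XK_mult_span_Ymons by simp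
  qed
  have "f = (\<Sum>m\<in>Poly_Mapping.keys f. mon m)" by (rule P_eq_sum_mon)
  then have "incl f = (\<Sum>m\<in>Poly_Mapping.keys f. incl (mon m))" by (metis incl_sum)
  also have "\<dots> \<in> kP.span (Ymons d)"
  proof (rule kP.span_sum)
    fix m assume "m \<in> Poly_Mapping.keys f"
    then have "total_degree m = d" using assms by (simp add: homogeneous_def total_degree_def)
    then show "incl (mon m) \<in> kP.span (Ymons d)" using mon[of m] by simp
  qed
  finally show ?thesis .
qed

text \<open>Monomials in the eigenvariables span degree \<open>d\<close>, and
  \<open>average_K\<close> sends each of them to 0 or to an orbit of weight 0 modulo 31.\<close>

lemma average_span:
  assumes "homogeneous d f" "kP.subspace U"
    "\<And>ms. length ms = 5 \<Longrightarrow> sum_list ms = d \<Longrightarrow> weight 0 ms mod 31 = 0 \<Longrightarrow> Yorbit ms \<in> U"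
  shows "incl (average f) \<in> U"
proof -
  have "average_K g \<in> U" if "g \<in> kP.span (Ymons d)" for g
    using that
  proof (induction rule: kP.span_induct_alt)
    case base
    show ?case using assms(2) by (simp add: average_K_simps kP.subspace_0)
  next
    case (step c x y)
    then obtain ms where "x = Ymon 0 ms" "length ms = 5" "sum_list ms = d" by (auto simp: Ymons_def)
    then have "average_K x \<in> U"
      using assms(2,3) by (simp add: average_K_Ymon kP.subspace_0)
    then show ?case
      using step assms(2) by (simp add: average_K_simps kP.subspace_add kP.subspace_scale)
  qed
  from this[OF incl_span_Ymons[OF assms(1)]] show ?thesis by (simp only: average_K_simps)
qed

text \<open>Induction on binary digits: in characteristic 2 the expansion for \<open>m div 2\<close>
  is squared term by term, which doubles the masks, and for odd \<open>m\<close> one more factor,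
  Y_i + Y_(i+4)^2 t, produces the masks 2b and 2b + 1.\<close>

lemma total_square_Y_power:
  "total_square_K (Y i ^ m) = (\<Sum>b\<leftarrow>submasks m. monom (Y i ^ (m - b) * Y (i + 4) ^ (2 * b)) b)"
proof (induction m rule: submasks.induct)
  case (1 m)
  let ?q = "m div 2"
  let ?c = "\<lambda>m b. Y i ^ (m - b) * Y (i + 4) ^ (2 * b)"
  show ?case
  proof (cases "m = 0")
    case True
    then show ?thesis by (simp add: submasks.simps total_square_K_simps)
  next
    case False
    have two: "(2 :: (5, 'k) kP poly) = 0"
      using kP_add_self[of "1 :: (5, 'k) kP"] by (simp add: numeral_poly)
    have sq: "(\<Sum>x\<leftarrow>xs. g x) ^ 2 = (\<Sum>x\<leftarrow>xs. g x ^ 2)" for g :: "nat \<Rightarrow> (5, 'k) kP poly" and xs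
      by (induction xs) (simp_all add: power2_sum two)
    have q: "total_square_K (Y i ^ (2 * ?q)) = (\<Sum>b\<leftarrow>submasks ?q. monom (?c (2 * ?q) (2 * b)) (2 * b))"
    proof -
      have "total_square_K (Y i ^ (2 * ?q)) = total_square_K (Y i ^ ?q) ^ 2"
        by (simp add: total_square_K_simps mult.commute flip: power_mult)
      also have "\<dots> = (\<Sum>b\<leftarrow>submasks ?q. monom (?c ?q b) b ^ 2)"
        unfolding "1.IH"[OF False] sq ..
      also have "\<dots> = (\<Sum>b\<leftarrow>submasks ?q. monom (?c (2 * ?q) (2 * b)) (2 * b))"
        by (rule arg_cong[where f = sum_list])
          (simp add: monom_power power_mult_distrib mult.commute right_diff_distrib' flip: power_mult)
      finally show ?thesis .
    qed
    show ?thesis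
    proof (cases "even m")
      case True
      then have "2 * ?q = m" by simp
      then show ?thesis using q True False by (subst submasks.simps) (simp add: comp_def)
    next
      case odd: False
      then have m: "m = Suc (2 * ?q)" by simp
      have "total_square_K (Y i ^ m) =
          (monom (Y i) 0 + monom (Y (i + 4) ^ 2) 1) * total_square_K (Y i ^ (2 * ?q))"
        by (subst m) (simp add: total_square_K_simps total_square_Y monom_altdef)
      also have "\<dots> = (\<Sum>b\<leftarrow>submasks ?q. monom (?c m (2 * b)) (2 * b)) +
          (\<Sum>b\<leftarrow>submasks ?q. monom (?c m (Suc (2 * b))) (Suc (2 * b)))"
      proof -
        have "Y i * ?c (2 * ?q) (2 * b) = ?c m (2 * b)" if "b \<in> set (submasks ?q)" for b
        proof -
          \<comment> \<open>Here \<open>submasks_le\<close> ensures that natural number subtraction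
            does not truncate.\<close>
          have "m - 2 * b = Suc (2 * ?q - 2 * b)" using submasks_le[OF that] m by linarith
          then show ?thesis by (simp add: mult.assoc)
        qed
        then have 1: "monom (Y i) 0 * (\<Sum>b\<leftarrow>submasks ?q. monom (?c (2 * ?q) (2 * b)) (2 * b)) =
            (\<Sum>b\<leftarrow>submasks ?q. monom (?c m (2 * b)) (2 * b))"
          unfolding sum_list_const_mult[symmetric] by (intro arg_cong[where f = sum_list] map_cong) (simp_all only: mult_monom add_0_left)
        have "Y (i + 4) ^ 2 * ?c (2 * ?q) (2 * b) = ?c m (Suc (2 * b))" for b
        proof -
          have "m - Suc (2 * b) = 2 * ?q - 2 * b" using m by linarith
          then show ?thesis by (simp add: power2_eq_square mult_ac)
        qed
        then have 2: "monom (Y (i + 4) ^ 2) 1 * (\<Sum>b\<leftarrow>submasks ?q. monom (?c (2 * ?q) (2 * b)) (2 * b)) =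
            (\<Sum>b\<leftarrow>submasks ?q. monom (?c m (Suc (2 * b))) (Suc (2 * b)))"
          unfolding sum_list_const_mult[symmetric] by (intro arg_cong[where f = sum_list] map_cong) (simp_all only: mult_monom plus_1_eq_Suc)
        show ?thesis unfolding q distrib_right 1 2 ..
      qed
      also have "\<dots> = (\<Sum>b\<leftarrow>submasks m. monom (?c m b) b)"
        using odd False by (subst (3) submasks.simps) (simp add: comp_def Let_def)
      finally show ?thesis .
    qed
  qed
qed

primrec split_term :: "nat \<Rightarrow> nat list \<Rightarrow> nat list \<Rightarrow> (5, 'k) kP" where
  "split_term i [] bs = 1"
| "split_term i (m # ms) bs = Y i ^ (m - hd bs) * Y (i + 4) ^ (2 * hd bs) * split_term (Suc i) ms (tl bs)"

lemma coeff_total_square_Ymon: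
  "coeff (total_square_K (Ymon i ms)) k = (\<Sum>bs\<leftarrow>splits ms k. split_term i ms bs)"
proof (induction ms arbitrary: i k)
  case Nil
  show ?case by (simp add: total_square_K_simps)
next
  case (Cons m ms)
  have c: "coeff (\<Sum>x\<leftarrow>xs. g x) k = (\<Sum>x\<leftarrow>xs. coeff (g x) k)" for g :: "nat \<Rightarrow> (5, 'k) kP poly" and xs
    by (induction xs) simp_all
  have f: "(\<Sum>b\<leftarrow>xs. if k < b then 0 else g b) = (\<Sum>b\<leftarrow>filter (\<lambda>b. b \<le> k) xs. g b)" for g :: "nat \<Rightarrow> (5, 'k) kP" and xs
    by (induction xs) simp_all
  let ?c = "\<lambda>b. Y i ^ (m - b) * Y (i + 4) ^ (2 * b)"
  have "coeff (total_square_K (Ymon i (m # ms))) k =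
      (\<Sum>b\<leftarrow>submasks m. if k < b then 0 else ?c b * (\<Sum>bs\<leftarrow>splits ms (k - b). split_term (Suc i) ms bs))"
    by (simp add: total_square_K_simps(2) total_square_Y_power c coeff_monom_mult Cons cong: if_cong
        flip: sum_list_mult_const)
  also have "\<dots> = (\<Sum>bs\<leftarrow>splits (m # ms) k. split_term i (m # ms) bs)"
  proof -
    have "(\<Sum>x\<leftarrow>concat xss. g x) = (\<Sum>xs\<leftarrow>xss. \<Sum>x\<leftarrow>xs. g x)" for g :: "nat list \<Rightarrow> (5, 'k) kP" and xss
      by (induction xss) simp_all
    then show ?thesis by (simp add: splits_Cons f comp_def sum_list_const_mult)
  qed
  finally show ?case .
qed

text \<open>Each \<open>split_term\<close> uses the index i + 4 for i - 1; with five exponents,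
  periodicity of \<open>Y\<close> folds all indices back into one round, as \<open>twist\<close>
  does.\<close>

lemma sum_list_twisted_square:
  assumes "length ms = 5"
  shows "(\<Sum>t\<leftarrow>twisted_square k ms. Ymon i t) = coeff (total_square_K (Ymon i ms)) k"
proof -
  have "Ymon i (twist ms bs) = split_term i ms bs"
    if "bs \<in> set (splits ms k)" for bs
  proof -
    have "length bs = 5" using splits_length[OF that] assms by simp
    then obtain b0 b1 b2 b3 b4 where bs: "bs = [b0, b1, b2, b3, b4]" by (rule length_5_E)
    from assms obtain m0 m1 m2 m3 m4 where ms: "ms = [m0, m1, m2, m3, m4]" by (rule length_5_E)
    have "Y (Suc (Suc (Suc (Suc (Suc i))))) = Y i" for i
      using Y_periodic[of i] by (simp add: numeral_eq_Suc)
    then show ?thesis unfolding bs ms twist_def by (simp add: power_add mult_ac numeral_eq_Suc)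
  qed
  then show ?thesis
    unfolding coeff_total_square_Ymon twisted_square_def
    by (simp add: comp_def cong: map_cong)
qed

text \<open>The same list of exponents serves all five shifts, so summing over them turns a square
  of monomials into a relation between orbits.\<close>

lemma Yorbit_twisted_square:
  assumes "length ms = 5" "k > 0"
  shows "(\<Sum>t\<leftarrow>twisted_square k ms. Yorbit t) \<in> hit_K"
proof -
  have "(\<Sum>t\<leftarrow>ts. Yorbit t) = (\<Sum>r<5. \<Sum>t\<leftarrow>ts. Ymon r t)" for ts
    by (induction ts) (simp_all add: Yorbit_def sum.distrib)
  then have "(\<Sum>t\<leftarrow>twisted_square k ms. Yorbit t) = (\<Sum>r<5. coeff (total_square_K (Ymon r ms)) k)"
    using assms by (simp add: sum_list_twisted_square)
  also have "\<dots> \<in> hit_K"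
    using assms by (intro kP.subspace_sum[OF subspace_hit_K] hit_K_total_square)
  finally show ?thesis .
qed

lemma Yorbit_rotate1:
  assumes "length ms = 5"
  shows "Yorbit (rotate1 ms) = Yorbit ms"
proof -
  from assms obtain a b c d e where ms: "ms = [a, b, c, d, e]" by (rule length_5_E)
  have p: "Y (Suc (Suc (Suc (Suc (Suc i))))) = Y i" for i
    using Y_periodic[of i] by (simp add: numeral_eq_Suc)
  have r: "Ymon i (rotate1 ms) = Ymon (Suc (Suc (Suc (Suc i)))) ms" and
    p': "Ymon (Suc (Suc (Suc (Suc (Suc i))))) ms = Ymon i ms" for i
    by (simp_all add: ms p mult_ac)
  have "Yorbit xs = Ymon 0 xs + Ymon (Suc 0) xs + Ymon (Suc (Suc 0)) xs + Ymon (Suc (Suc (Suc 0))) xs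
      + Ymon (Suc (Suc (Suc (Suc 0)))) xs" for xs
    by (simp add: Yorbit_def numeral_eq_Suc)
  then show ?thesis by (simp only: r p' add_ac)
qed

lemma Yorbit_rotate: "length ms = 5 \<Longrightarrow> Yorbit (rotate n ms) = Yorbit ms"
  by (induction n) (simp_all add: Yorbit_rotate1)

end

subsection \<open>Certificates for the reduction to a basis\<close>

fun lex_le :: "nat list \<Rightarrow> nat list \<Rightarrow> bool" where
  "lex_le (x # xs) (y # ys) \<longleftrightarrow> x < y \<or> x = y \<and> lex_le xs ys"
| "lex_le [] ys \<longleftrightarrow> True"
| "lex_le (x # xs) [] \<longleftrightarrow> False"

definition lex_min :: "nat list \<Rightarrow> nat list \<Rightarrow> nat list" where
  "lex_min xs ys = (if lex_le xs ys then xs else ys)"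

text \<open>The first argument is only a counter. In \<open>canon\<close> it has one entry fewer
  than \<open>ms\<close>, so that all rotations are compared.\<close>

primrec least_rotation :: "nat list \<Rightarrow> nat list \<Rightarrow> nat list" where
  "least_rotation [] ms = ms"
| "least_rotation (n # ns) ms = lex_min ms (least_rotation ns (rotate1 ms))"

definition canon :: "nat list \<Rightarrow> nat list" where
  "canon ms = least_rotation (tl ms) ms"

text \<open>Addition modulo 2 on lists that stand for sums: equal terms cancel.\<close>

definition toggle :: "'a \<Rightarrow> 'a list \<Rightarrow> 'a list" where
  "toggle x xs = (if x \<in> set xs then remove1 x xs else x # xs)"

definition canonical_terms :: "nat \<times> nat list \<Rightarrow> nat list list" where
  "canonical_terms r = map canon (twisted_square (fst r) (snd r))"

definition relation_terms :: "(nat \<times> nat list) list \<Rightarrow> nat list list" where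
  "relation_terms rs = fold toggle (concat (map canonical_terms rs)) []"

definition wf_relations :: "(nat \<times> nat list) list \<Rightarrow> bool" where
  "wf_relations rs \<longleftrightarrow> list_all (\<lambda>r. 0 < fst r \<and> length (snd r) = 5) rs"

definition unknown :: "nat list list \<Rightarrow> nat list \<Rightarrow> bool" where
  "unknown known t \<longleftrightarrow> t \<notin> set known"

text \<open>Back substitution: modulo hit elements the single unknown orbit of a relation is the sum
  of the known ones, and becomes known for the later relations.\<close>

fun reduce :: "nat list list \<Rightarrow> (nat \<times> nat list) list list \<Rightarrow> nat list list option" where
  "reduce known [] = Some known"
| "reduce known (rs # rss) =
     (if wf_relations rs then
        (case filter (unknown known) (relation_terms rs) of
           [t] \<Rightarrow> reduce (t # known) rss
         | _ \<Rightarrow> None)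
      else None)"

text \<open>
  Degree \<open>d < 31\<close> and weight \<open>0\<close> modulo \<open>31\<close> determine the second and third entries from the
  others, since \<open>15\<close> is inverse to \<open>-2\<close> modulo \<open>31\<close>. Up to rotation the first entry is the smallest.
\<close>

definition exponents_from_3 :: "nat \<Rightarrow> nat \<Rightarrow> nat \<Rightarrow> nat \<Rightarrow> nat list list" where
  "exponents_from_3 d a e f =
     (let s = d - (a + e + f); c = (15 * (a + 2 * s + 8 * e + 16 * f)) mod 31 in
      if a + e + f + c \<le> d \<and> a \<le> c \<and> a \<le> s - c then [[a, s - c, c, e, f]] else [])"

definition exponents_from_2 :: "nat \<Rightarrow> nat \<Rightarrow> nat \<Rightarrow> nat list list" where
  "exponents_from_2 d a e = concat (map (exponents_from_3 d a e) [a..<Suc d - (a + e)])"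

definition exponents_from_1 :: "nat \<Rightarrow> nat \<Rightarrow> nat list list" where
  "exponents_from_1 d a = concat (map (exponents_from_2 d a) [a..<Suc d - a])"

definition weight_zero_exponents :: "nat \<Rightarrow> nat list list" where
  "weight_zero_exponents d = concat (map (exponents_from_1 d) [0..<Suc (d div 5)])"

definition known_orbit :: "nat list list \<Rightarrow> nat list \<Rightarrow> bool" where
  "known_orbit known ms \<longleftrightarrow> canon ms \<in> set known"

definition certificate :: "nat \<Rightarrow> nat list list \<Rightarrow> (nat \<times> nat list) list list \<Rightarrow> bool" where
  "certificate d basis rss \<longleftrightarrow>
     (case reduce basis rss of
        Some known \<Rightarrow> list_all (known_orbit known) (weight_zero_exponents d)
      | None \<Rightarrow> False)"

lemma least_rotation_rotate: "\<exists>i. least_rotation ns ms = rotate i ms"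
proof (induction ns arbitrary: ms)
  case Nil
  show ?case by (rule exI[of _ 0]) simp
next
  case (Cons n ns)
  obtain i where "least_rotation ns (rotate1 ms) = rotate i (rotate1 ms)" using Cons by blast
  then have "least_rotation ns (rotate1 ms) = rotate (Suc i) ms" by (simp add: rotate1_rotate_swap)
  then show ?case by (auto simp: lex_min_def intro: exI[of _ 0] exI[of _ "Suc i"])
qed

lemma weight_zero_exponents_complete:
  assumes "d < 31" "length ms = 5" "sum_list ms = d" "weight 0 ms mod 31 = 0" "\<forall>x\<in>set ms. hd ms \<le> x"
  shows "ms \<in> set (weight_zero_exponents d)"
proof -
  from assms(2) obtain a b c e f where ms: "ms = [a, b, c, e, f]" by (rule length_5_E)
  define s where "s = d - (a + e + f)"
  have sum: "a + b + c + e + f = d" and le: "a \<le> b" "a \<le> c" "a \<le> e" "a \<le> f"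
    using assms(3,5) by (auto simp: ms)
  have w: "31 dvd a + 2 * b + 4 * c + 8 * e + 16 * f"
    using assms(4) by (simp add: ms mod_eq_0_iff_dvd mult.commute add.assoc)
  have s: "s = b + c" using sum by (simp add: s_def)
  have "15 * (a + 2 * s + 8 * e + 16 * f) mod 31 = c"
  proof -
    obtain k where "a + 2 * b + 4 * c + 8 * e + 16 * f = 31 * k" using w by (elim dvdE)
    \<comment> \<open>Multiplying the weight by 15 gives the terms 30 b + 60 c, the left side has 30
      b + 30 c; adding c and 31 c respectively makes them equal.\<close>
    moreover have "15 * (a + 2 * s + 8 * e + 16 * f) + 31 * c = 15 * (a + 2 * b + 4 * c + 8 * e + 16 * f) + c"
      by (simp add: s)
    ultimately have "15 * (a + 2 * s + 8 * e + 16 * f) + 31 * c = 31 * (15 * k) + c" by simp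
    then have "15 * (a + 2 * s + 8 * e + 16 * f) mod 31 = c mod 31"
      using mod_mult_self2[of "15 * (a + 2 * s + 8 * e + 16 * f)" 31 c] mod_mult_self4[of 31 "15 * k" c] by metis
    moreover have "c < 31" using sum assms(1) by linarith
    ultimately show ?thesis by simp
  qed
  then have c: "15 * (a + 2 * (d - (a + e + f)) + 8 * e + 16 * f) mod 31 = c" by (simp only: s_def)
  have range: "a \<in> set [0..<Suc (d div 5)]" "e \<in> set [a..<Suc d - a]" "f \<in> set [a..<Suc d - (a + e)]"
    using sum le by auto
  have "a + e + f + c \<le> d" "d - (a + e + f) - c = b" using sum s s_def by linarith+
  then have mem: "ms \<in> set (exponents_from_3 d a e f)"
    unfolding exponents_from_3_def Let_def c ms using le by (simp only: simp_thms if_True list.set) blast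
  have concat: "x \<in> set (concat (map g xs)) \<longleftrightarrow> (\<exists>y\<in>set xs. x \<in> set (g y))" for x :: "nat list" and g :: "nat \<Rightarrow> _" and xs
    by auto
  show ?thesis
    unfolding weight_zero_exponents_def exponents_from_1_def exponents_from_2_def concat by (intro bexI[OF _ range(1)] bexI[OF _ range(2)] bexI[OF _ range(3)] mem)
qed

text \<open>Rotation halves the weight modulo 31, because 2^5 = 32 is congruent to 1.\<close>

lemma weight_rotate1:
  assumes "length ms = 5" "weight 0 ms mod 31 = 0"
  shows "weight 0 (rotate1 ms) mod 31 = 0"
proof -
  from assms(1) obtain a b c e f where ms: "ms = [a, b, c, e, f]" by (rule length_5_E)
  have "2 * weight 0 (rotate1 ms) = weight 0 ms + 31 * a" by (simp add: ms)
  then have "31 dvd 2 * weight 0 (rotate1 ms)" using assms(2) by (metis dvd_add dvd_triv_left mod_0_imp_dvd)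
  then show ?thesis by presburger
qed

lemma weight_rotate: "length ms = 5 \<Longrightarrow> weight 0 ms mod 31 = 0 \<Longrightarrow> weight 0 (rotate n ms) mod 31 = 0"
  by (induction n) (simp_all add: weight_rotate1)

lemma exists_rotation_hd_least:
  assumes "ms \<noteq> []"
  obtains n where "\<forall>x\<in>set (rotate n ms). hd (rotate n ms) \<le> (x :: nat)"
proof -
  have "Min (set ms) \<in> set ms" using assms by simp
  then obtain n where n: "n < length ms" "ms ! n = Min (set ms)" by (metis in_set_conv_nth)
  then have "hd (rotate n ms) = Min (set ms)" using assms by (simp add: hd_rotate_conv_nth)
  then show thesis using that[of n] by simp
qed

lemma length_twisted_square: "length ms = 5 \<Longrightarrow> t \<in> set (twisted_square k ms) \<Longrightarrow> length t = 5"
  by (auto simp: twisted_square_def twist_def dest: splits_length)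

context field_32
begin

lemma Yorbit_canon: "length ms = 5 \<Longrightarrow> Yorbit (canon ms) = Yorbit ms"
  using least_rotation_rotate[of "tl ms" ms] by (auto simp: canon_def Yorbit_rotate)

lemma sum_list_remove1:
  "x \<in> set xs \<Longrightarrow> g x + (\<Sum>x\<leftarrow>remove1 x xs. g x) = (\<Sum>x\<leftarrow>xs. g x :: 'c::comm_monoid_add)"
  by (induction xs) (auto simp: add.left_commute)

lemma sum_list_toggle: "(\<Sum>x\<leftarrow>toggle x xs. g x) = g x + (\<Sum>x\<leftarrow>xs. g x :: (5, 'k) kP)"
proof (cases "x \<in> set xs")
  case True
  have "(\<Sum>x\<leftarrow>remove1 x xs. g x) = g x + (g x + (\<Sum>x\<leftarrow>remove1 x xs. g x))"
    by (simp add: kP_add_self flip: add.assoc)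
  then show ?thesis using sum_list_remove1[OF True, of g] True by (simp add: toggle_def)
qed (simp add: toggle_def)

lemma sum_list_fold_toggle:
  "(\<Sum>x\<leftarrow>fold toggle xs ys. g x) = (\<Sum>x\<leftarrow>xs. g x) + (\<Sum>x\<leftarrow>ys. g x :: (5, 'k) kP)"
  by (induction xs arbitrary: ys) (simp_all add: sum_list_toggle add_ac)

lemma relation_terms_hit_K:
  assumes "wf_relations rs"
  shows "(\<Sum>t\<leftarrow>relation_terms rs. Yorbit t) \<in> hit_K"
proof -
  have "(\<Sum>t\<leftarrow>concat (map canonical_terms rs). Yorbit t) \<in> hit_K"
    using assms
  proof (induction rs)
    case (Cons r rs)
    obtain k ms where r: "r = (k, ms)" by fastforce
    have ms: "k > 0" "length ms = 5" "wf_relations rs" using Cons.prems by (simp_all add: r wf_relations_def)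
    have "(\<Sum>t\<leftarrow>map canon (twisted_square k ms). Yorbit t) = (\<Sum>t\<leftarrow>twisted_square k ms. Yorbit t)"
      unfolding map_map comp_def
      using length_twisted_square[OF ms(2)] by (intro arg_cong[where f = sum_list] map_cong refl Yorbit_canon) auto
    then show ?case
      using Yorbit_twisted_square[OF ms(2,1)] Cons.IH[OF ms(3)] by (simp add: r canonical_terms_def hit_K_add)
  qed (simp add: hit_K_0)
  then show ?thesis by (simp add: relation_terms_def sum_list_fold_toggle)
qed

lemma subspace_sum_list: "kP.subspace U \<Longrightarrow> (\<And>x. x \<in> set xs \<Longrightarrow> g x \<in> U) \<Longrightarrow> (\<Sum>x\<leftarrow>xs. g x) \<in> (U :: (5, 'k) kP set)"
  by (induction xs) (auto intro: kP.subspace_add kP.subspace_0)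

lemma reduce_sound:
  assumes U: "kP.subspace U" "hit_K \<subseteq> U"
  shows "reduce known rss = Some known' \<Longrightarrow> \<forall>t\<in>set known. Yorbit t \<in> U \<Longrightarrow> \<forall>t\<in>set known'. Yorbit t \<in> U"
proof (induction rss arbitrary: known)
  case (Cons rs rss)
  from Cons.prems(1) have wf: "wf_relations rs" by (auto split: if_splits)
  from Cons.prems(1) obtain t where t: "filter (unknown known) (relation_terms rs) = [t]"
    and red: "reduce (t # known) rss = Some known'"
    by (auto split: if_splits list.splits)
  have "(\<Sum>x\<leftarrow>xs. g x) = (\<Sum>x\<leftarrow>filter P xs. g x) + (\<Sum>x\<leftarrow>filter (\<lambda>x. \<not> P x) xs. g x)"
    for g :: "nat list \<Rightarrow> (5, 'k) kP" and P xs
    by (induction xs) (simp_all add: add_ac)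
  from this[of Yorbit "relation_terms rs" "unknown known"]
  have "Yorbit t + (\<Sum>t\<leftarrow>filter (\<lambda>t. t \<in> set known) (relation_terms rs). Yorbit t) \<in> U"
    using relation_terms_hit_K[OF wf] U(2) by (auto simp: t unknown_def)
  moreover have "(\<Sum>t\<leftarrow>filter (\<lambda>t. t \<in> set known) (relation_terms rs). Yorbit t) \<in> U"
    using Cons.prems(2) by (intro subspace_sum_list[OF U(1)]) auto
  ultimately have "Yorbit t \<in> U"
    using kP.subspace_diff[OF U(1)] by fastforce
  then have "\<forall>x\<in>set (t # known). Yorbit x \<in> U" using Cons.prems(2) by simp
  then show ?case by (rule Cons.IH[OF red])
qed simp

text \<open>Rotation preserves orbit, degree and weight 0, so it may be assumed that the first
  exponent is least; the enumeration then contains the list, and its canonical rotation is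
  known.\<close>

lemma certificate_sound:
  assumes "certificate d basis rss" "d < 31" "homogeneous d f"
    and U: "kP.subspace U" "hit_K \<subseteq> U" "\<forall>t\<in>set basis. Yorbit t \<in> U"
  shows "incl (average f) \<in> U"
proof (rule average_span[OF assms(3) U(1)])
  fix ms :: "nat list"
  assume ms: "length ms = 5" "sum_list ms = d" "weight 0 ms mod 31 = 0"
  from assms(1) obtain known where red: "reduce basis rss = Some known"
    and known: "list_all (known_orbit known) (weight_zero_exponents d)"
    by (auto simp: certificate_def split: option.splits)
  have "ms \<noteq> []" using ms(1) by auto
  then obtain n where n: "\<forall>x\<in>set (rotate n ms). hd (rotate n ms) \<le> x" by (rule exists_rotation_hd_least)
  have "sum_list (rotate1 xs) = sum_list xs" for xs :: "nat list"
    by (cases xs) simp_all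
  then have "sum_list (rotate n ms) = d" using ms(2) by (induction n) simp_all
  then have "rotate n ms \<in> set (weight_zero_exponents d)"
    using ms n assms(2) weight_rotate by (intro weight_zero_exponents_complete) auto
  then have "canon (rotate n ms) \<in> set known" using known by (auto simp: list_all_iff known_orbit_def)
  then have "Yorbit (canon (rotate n ms)) \<in> U" using reduce_sound[OF U(1,2) red U(3)] by blast
  then show "Yorbit ms \<in> U" using ms(1) by (simp add: Yorbit_canon Yorbit_rotate)
qed

end

subsection \<open>Spike coefficients of orbits\<close>

definition spike_of :: "nat list \<Rightarrow> 5 \<Rightarrow>\<^sub>0 nat" where
  "spike_of t = expo (\<lambda>a. t ! idx a)"

primrec xor_list :: "('a \<Rightarrow> bool) \<Rightarrow> 'a list \<Rightarrow> bool" where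
  "xor_list P [] \<longleftrightarrow> False"
| "xor_list P (x # xs) \<longleftrightarrow> P x \<noteq> xor_list P xs"

text \<open>
  The product of the powers \<open>Y\<^sub>i ^ p\<close>, \<open>p = 2\<^sup>k\<close>, over a list of pairs \<open>(p, 2\<^sup>i p)\<close> is expanded by
  choosing a variable \<open>j\<close> for every pair \<open>(p, w)\<close>; the choice contributes the factor \<open>z ^ (j w)\<close>.
\<close>

primrec rev_onto :: "'a list \<Rightarrow> 'a list \<Rightarrow> 'a list" where
  "rev_onto [] ys = ys"
| "rev_onto (x # xs) ys = rev_onto xs (x # ys)"

lemma rev_onto_eq: "rev_onto xs ys = rev xs @ ys"
  by (induction xs arbitrary: ys) simp_all

fun trace_coeff :: "(nat \<times> nat) list \<Rightarrow> nat \<Rightarrow> nat list \<Rightarrow> bool"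
  and trace_coeff_over :: "(nat \<times> nat) list \<Rightarrow> nat \<Rightarrow> nat \<Rightarrow> nat \<Rightarrow> nat list \<Rightarrow> nat list \<Rightarrow> bool" where
  "trace_coeff [] e t \<longleftrightarrow> list_all (\<lambda>x. x = 0) t \<and> trace_exp e"
| "trace_coeff ((p, w) # fs) e t \<longleftrightarrow> trace_coeff_over fs p w e [] t"
| "trace_coeff_over fs p w e pre [] \<longleftrightarrow> False"
| "trace_coeff_over fs p w e pre (x # xs) \<longleftrightarrow>
     (if p \<le> x then trace_coeff fs e (rev_onto pre ((x - p) # xs)) \<noteq> trace_coeff_over fs p w (e + w) (x # pre) xs
      else trace_coeff_over fs p w (e + w) (x # pre) xs)"

text \<open>The accumulator \<open>pre\<close> holds the positions already passed, in reverse order.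
  Each of them has added \<open>w\<close> to the exponent, so position \<open>j\<close> is reached
  with e + j w.\<close>

lemma trace_coeff_Cons:
  "trace_coeff ((p, w) # fs) e t \<longleftrightarrow>
     xor_list (\<lambda>j. p \<le> t ! j \<and> trace_coeff fs (e + j * w) (t[j := t ! j - p])) [0..<length t]"
proof -
  have "trace_coeff_over fs p w (e + length pre * w) pre xs \<longleftrightarrow>
      xor_list (\<lambda>j. p \<le> t ! j \<and> trace_coeff fs (e + j * w) (t[j := t ! j - p])) [length pre..<length t]"
    if "t = rev pre @ xs" for pre xs
    using that
  proof (induction xs arbitrary: pre)
    case (Cons x xs)
    have split: "[length pre..<length t] = length pre # [length (x # pre)..<length t]"
      using upt_conv_Cons[of "length pre" "length t"] Cons.prems by (simp del: upt_Suc)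
    have t: "t ! length pre = x" "t[length pre := x - p] = rev pre @ (x - p) # xs"
      using Cons.prems by (simp_all add: nth_append list_update_append)
    have e: "e + length pre * w + w = e + length (x # pre) * w" by simp
    have IH: "trace_coeff_over fs p w (e + length (x # pre) * w) (x # pre) xs \<longleftrightarrow>
        xor_list (\<lambda>j. p \<le> t ! j \<and> trace_coeff fs (e + j * w) (t[j := t ! j - p])) [length (x # pre)..<length t]"
      using Cons.prems by (intro Cons.IH) simp
    show ?case
      unfolding split xor_list.simps trace_coeff_over.simps e IH rev_onto_eq t
      by (cases "p \<le> x") (simp_all only: if_True if_False simp_thms)
  qed simp
  from this[of "[]" t] show ?thesis by simp
qed

text \<open>High powers come first: they fit into few of the target exponents, so the test
  \<open>p \<le> x\<close> cuts off most choices early.\<close>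

definition binary_factors :: "nat list \<Rightarrow> (nat \<times> nat) list" where
  "binary_factors ms = concat (map (\<lambda>k. map (\<lambda>i. (i, k)) (filter (\<lambda>i. odd (ms ! i div 2 ^ k)) [0, 1, 2, 3, 4])) [4, 3, 2, 1, 0])"

definition factor_powers :: "(nat \<times> nat) list \<Rightarrow> (nat \<times> nat) list" where
  "factor_powers fs = map (\<lambda>(i, k). (2 ^ k, 2 ^ (i + k))) fs"

definition orbit_coeff :: "nat list \<Rightarrow> nat list \<Rightarrow> bool" where
  "orbit_coeff t ms = trace_coeff (factor_powers (binary_factors ms)) 0 t"

definition coeff_row :: "nat list list \<Rightarrow> nat list \<Rightarrow> bool list" where
  "coeff_row basis t = map (orbit_coeff t) basis"

text \<open>The pair \<open>i\<close>, \<open>j\<close> is what the transvection argument of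
  \<open>lookup_invariant_spike\<close> consumes.\<close>

definition admissible_spike :: "nat list \<Rightarrow> bool" where
  "admissible_spike t \<longleftrightarrow> length t = 5 \<and> list_all (\<lambda>x. x \<in> set [0, 1, 3, 7, 15]) t \<and>
     list_ex (\<lambda>i. list_ex (\<lambda>j. i \<noteq> j \<and> t ! i = 2 * t ! j + 1) [0, 1, 2, 3, 4]) [0, 1, 2, 3, 4]"

definition admissible_basis :: "nat list list \<Rightarrow> bool" where
  "admissible_basis basis \<longleftrightarrow> list_all (\<lambda>ms. length ms = 5 \<and> list_all (\<lambda>m. m < 32) ms) basis"

text \<open>
  The entry \<open>R ! q\<close> lists the rows of \<open>M\<close> that add up to the \<open>q\<close>-th unit vector.
\<close>

definition entry :: "bool list list \<Rightarrow> nat \<Rightarrow> nat \<Rightarrow> bool" where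
  "entry M p r = M ! r ! p"

definition unit_entry :: "bool list list \<Rightarrow> nat list list \<Rightarrow> nat \<Rightarrow> nat \<Rightarrow> bool" where
  "unit_entry M R q p \<longleftrightarrow> (xor_list (entry M p) (R ! q) \<longleftrightarrow> p = q)"

definition unit_row :: "nat \<Rightarrow> bool list list \<Rightarrow> nat list list \<Rightarrow> nat \<Rightarrow> bool" where
  "unit_row n M R q \<longleftrightarrow> list_all (\<lambda>r. r < length M) (R ! q) \<and> list_all (unit_entry M R q) [0..<n]"

definition left_inverse :: "nat \<Rightarrow> bool list list \<Rightarrow> nat list list \<Rightarrow> bool" where
  "left_inverse n M R \<longleftrightarrow> list_all (unit_row n M R) [0..<n]"

lemma spike_admissible: "admissible_spike t \<Longrightarrow> spike (spike_of t)"
proof -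
  assume t: "admissible_spike t"
  have "\<exists>k. x = 2 ^ k - 1" if "x \<in> set t" for x
  proof -
    have "x \<in> {2 ^ 0 - 1, 2 ^ 1 - 1, 2 ^ 2 - 1, 2 ^ 3 - 1, 2 ^ 4 - 1}"
      using t that by (auto simp: admissible_spike_def list_all_iff)
    then show ?thesis by blast
  qed
  then show ?thesis
    using t idx_less by (auto simp: spike_def spike_of_def admissible_spike_def)
qed

lemma lookup_invariant_admissible:
  assumes "invariant_mod_hit f" "admissible_spike t"
  shows "Poly_Mapping.lookup f (spike_of t) = 0"
proof -
  have "\<exists>i\<in>set [0, 1, 2, 3, 4]. \<exists>j\<in>set [0, 1, 2, 3, 4]. i \<noteq> j \<and> t ! i = 2 * t ! j + 1"
    using assms(2) unfolding admissible_spike_def list_ex_iff by blast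
  then obtain i j where mem: "i \<in> set [0, 1, 2, 3, 4]" "j \<in> set [0, 1, 2, 3, 4]"
    and ij: "i \<noteq> j" "t ! i = 2 * t ! j + 1" by blast
  from mem have "i < 5" "j < 5" by auto
  then obtain a b where ab: "idx a = i" "idx b = j"
    using bij_idx by (metis bij_betw_imp_surj_on imageE lessThan_iff)
  show ?thesis
    using assms(1) spike_admissible[OF assms(2)]
    by (rule lookup_invariant_spike[where i = a and j = b]) (use ij ab in \<open>auto simp: spike_of_def\<close>)
qed

context field_32
begin

lemma lookup_XK_power_mult:
  "Poly_Mapping.lookup (XK a ^ p * g) m =
     (if p \<le> Poly_Mapping.lookup m a then Poly_Mapping.lookup (g :: ('n::finite, 'k) kP) (m - Poly_Mapping.single a p) else 0)"
proof (induction g rule: kP_induct)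
  case (add m' c g)
  have "Poly_Mapping.single a p + m' = m \<longleftrightarrow> p \<le> Poly_Mapping.lookup m a \<and> m' = m - Poly_Mapping.single a p"
  proof
    assume "p \<le> Poly_Mapping.lookup m a \<and> m' = m - Poly_Mapping.single a p"
    then show "Poly_Mapping.single a p + m' = m"
      by (intro poly_mapping_eqI) (auto simp: lookup_add lookup_minus lookup_single when_def)
  qed (auto simp: lookup_add)
  then show ?case
    using add by (auto simp: distrib_left lookup_add XK_power mult_single lookup_single when_def)
qed simp

lemma Y_power_2_power: "Y i ^ (2 ^ k) = (\<Sum>a\<in>UNIV. cK (z ^ (idx a * 2 ^ (i + k))) * XK a ^ (2 ^ k))"
proof (induction k)
  case (Suc k)
  have "Y i ^ (2 ^ Suc k) = (Y i ^ (2 ^ k)) ^ 2" by (simp add: mult.commute flip: power_mult)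
  also have "\<dots> = (\<Sum>a\<in>UNIV. cK (z ^ (idx a * 2 ^ (i + Suc k))) * XK a ^ (2 ^ Suc k))"
    unfolding Suc kP_square_sum
  proof (rule sum.cong, rule refl)
    fix a
    have "(cK (z ^ (idx a * 2 ^ (i + k))) :: (5, 'k) kP) ^ 2 = cK (z ^ (idx a * 2 ^ (i + Suc k)))"
      unfolding cK_power[symmetric] power_mult[symmetric] by (simp add: mult_ac)
    moreover have "((XK a :: (5, 'k) kP) ^ (2 ^ k)) ^ 2 = XK a ^ (2 ^ Suc k)"
      unfolding power_mult[symmetric] by (simp add: mult.commute)
    ultimately show "(cK (z ^ (idx a * 2 ^ (i + k))) * XK a ^ 2 ^ k)\<^sup>2 =
        cK (z ^ (idx a * 2 ^ (i + Suc k))) * (XK a :: (5, 'k) kP) ^ (2 ^ Suc k)"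
      by (simp only: power_mult_distrib)
  qed
  finally show ?case .
qed (simp add: Y_def)

definition factor_prod :: "nat \<Rightarrow> (nat \<times> nat) list \<Rightarrow> (5, 'k) kP" where
  "factor_prod r fs = (\<Prod>(i, k)\<leftarrow>fs. Y (r + i) ^ (2 ^ k))"

lemma lookup_factor_prod_Cons:
  assumes "length t = 5"
  shows "Poly_Mapping.lookup (factor_prod r ((i, k) # fs)) (spike_of t) =
    (\<Sum>j<5. if 2 ^ k \<le> t ! j then z ^ (j * 2 ^ (r + i + k)) *
       Poly_Mapping.lookup (factor_prod r fs) (spike_of (t[j := t ! j - 2 ^ k])) else 0)"
proof -
  have upd: "spike_of t - Poly_Mapping.single a (2 ^ k) = spike_of (t[idx a := t ! idx a - 2 ^ k])" for a
    using assms idx_less by (intro poly_mapping_eqI) (auto simp: spike_of_def lookup_minus lookup_single when_def nth_list_update)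
  have "Poly_Mapping.lookup (factor_prod r ((i, k) # fs)) (spike_of t) =
      (\<Sum>a\<in>UNIV. z ^ (idx a * 2 ^ (r + i + k)) * Poly_Mapping.lookup (XK a ^ (2 ^ k) * factor_prod r fs) (spike_of t))"
    by (simp add: factor_prod_def Y_power_2_power sum_distrib_right lookup_sum mult.assoc lookup_cK_mult)
  also have "\<dots> = (\<Sum>a\<in>UNIV. if 2 ^ k \<le> t ! idx a then z ^ (idx a * 2 ^ (r + i + k)) *
       Poly_Mapping.lookup (factor_prod r fs) (spike_of (t[idx a := t ! idx a - 2 ^ k])) else 0)"
    unfolding lookup_XK_power_mult upd by (rule sum.cong) (simp_all add: spike_of_def)
  also have "\<dots> = (\<Sum>j<5. if 2 ^ k \<le> t ! j then z ^ (j * 2 ^ (r + i + k)) *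
       Poly_Mapping.lookup (factor_prod r fs) (spike_of (t[j := t ! j - 2 ^ k])) else 0)"
    by (rule sum_idx)
  finally show ?thesis .
qed

lemma sum_of_bool_xor_list: "distinct xs \<Longrightarrow> (\<Sum>j\<in>set xs. of_bool (P j)) = (of_bool (xor_list P xs) :: 'k)"
  by (induction xs) auto

text \<open>The coefficients for shift \<open>r\<close> are the 2^r-th powers of those for shift 0,
  so the sum over \<open>r\<close> is a sum of traces of powers of z. The exponent \<open>e\<close>
  collects the choices made so far; for the empty product \<open>trace_K_z\<close> evaluates the
  trace.\<close>

lemma lookup_factor_prod:
  "length t = 5 \<Longrightarrow> (\<Sum>r<5. z ^ (e * 2 ^ r) * Poly_Mapping.lookup (factor_prod r fs) (spike_of t)) = of_bool (trace_coeff (factor_powers fs) e t)"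
proof (induction fs arbitrary: e t)
  case Nil
  have "spike_of t = 0 \<longleftrightarrow> list_all (\<lambda>x. x = 0) t"
  proof
    assume "spike_of t = 0"
    then have 0: "t ! idx a = 0" for a by (metis lookup_expo lookup_zero spike_of_def)
    have "t ! i = 0" if "i < 5" for i
      using that bij_idx 0 by (metis bij_betw_imp_surj_on imageE lessThan_iff)
    then show "list_all (\<lambda>x. x = 0) t" using Nil by (simp add: list_all_length)
  next
    assume "list_all (\<lambda>x. x = 0) t"
    then show "spike_of t = 0"
      using Nil idx_less by (intro poly_mapping_eqI) (simp add: spike_of_def list_all_length)
  qed
  then have "Poly_Mapping.lookup (1 :: (5, 'k) kP) (spike_of t) = of_bool (list_all (\<lambda>x. x = 0) t)"
    by (simp add: lookup_one when_def)
  then have "(\<Sum>r<5. z ^ (e * 2 ^ r) * Poly_Mapping.lookup (factor_prod r []) (spike_of t)) =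
      trace_K (z ^ e) * of_bool (list_all (\<lambda>x. x = 0) t)"
    by (simp add: factor_prod_def trace_K_def sum_distrib_right power_mult)
  then show ?case unfolding trace_K_z factor_powers_def list.map trace_coeff.simps of_bool_conj by (simp only: mult.commute)
next
  case (Cons f fs)
  obtain i k where f: "f = (i, k)" by fastforce
  have z: "z ^ ((e + j * 2 ^ (i + k)) * 2 ^ r) = z ^ (e * 2 ^ r) * z ^ (j * 2 ^ (r + i + k))" for j r
  proof -
    have "(e + j * 2 ^ (i + k)) * 2 ^ r = e * 2 ^ r + j * 2 ^ (r + i + k)"
      by (simp add: power_add algebra_simps)
    then show ?thesis by (simp only: power_add[of z])
  qed
  have "(\<Sum>r<5. z ^ (e * 2 ^ r) * Poly_Mapping.lookup (factor_prod r (f # fs)) (spike_of t)) =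
      (\<Sum>j<5. \<Sum>r<5. if 2 ^ k \<le> t ! j then z ^ ((e + j * 2 ^ (i + k)) * 2 ^ r) *
         Poly_Mapping.lookup (factor_prod r fs) (spike_of (t[j := t ! j - 2 ^ k])) else 0)"
    unfolding f lookup_factor_prod_Cons[OF Cons.prems] sum_distrib_left
    by (subst sum.swap) (intro sum.cong refl, simp add: z mult.assoc)
  also have "\<dots> = (\<Sum>j<5. of_bool (2 ^ k \<le> t ! j \<and> trace_coeff (factor_powers fs) (e + j * 2 ^ (i + k)) (t[j := t ! j - 2 ^ k])))"
  proof (rule sum.cong, rule refl)
    fix j
    show "(\<Sum>r<5. if 2 ^ k \<le> t ! j then z ^ ((e + j * 2 ^ (i + k)) * 2 ^ r) *
         Poly_Mapping.lookup (factor_prod r fs) (spike_of (t[j := t ! j - 2 ^ k])) else 0) =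
       of_bool (2 ^ k \<le> t ! j \<and> trace_coeff (factor_powers fs) (e + j * 2 ^ (i + k)) (t[j := t ! j - 2 ^ k]))"
      using Cons.IH[of "t[j := t ! j - 2 ^ k]" "e + j * 2 ^ (i + k)"] Cons.prems
      by (cases "2 ^ k \<le> t ! j") (simp_all only: if_True if_False simp_thms length_list_update sum.neutral_const of_bool_eq)
  qed
  also have "\<dots> = (\<Sum>j\<in>set [0, 1, 2, 3, 4]. of_bool (2 ^ k \<le> t ! j \<and> trace_coeff (factor_powers fs) (e + j * 2 ^ (i + k)) (t[j := t ! j - 2 ^ k])))"
    by (rule sum.cong) auto
  also have "\<dots> = of_bool (trace_coeff (factor_powers (f # fs)) e t)"
  proof -
    have "[0, 1, 2, 3, 4] = [0..<length t]" using Cons.prems by (simp add: upt_rec)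
    then show ?thesis
      by (subst sum_of_bool_xor_list) (simp_all only: f factor_powers_def list.map prod.case trace_coeff_Cons, simp)
  qed
  finally show ?case .
qed

lemma binary_expansion: "m < 32 \<Longrightarrow> m = (\<Sum>k\<in>{4, 3, 2, 1, 0}. of_bool (odd (m div 2 ^ k)) * 2 ^ k)" for m :: nat
proof -
  assume "m < 32"
  have "\<forall>m\<in>set [0..<32]. m = (\<Sum>k\<leftarrow>[4, 3, 2, 1, 0]. of_bool (odd (m div 2 ^ k)) * 2 ^ k)" by code_simp
  then have "m = (\<Sum>k\<leftarrow>[4, 3, 2, 1, 0]. of_bool (odd (m div 2 ^ k)) * 2 ^ k)"
    by (rule bspec) (use \<open>m < 32\<close> in simp)
  also have "\<dots> = (\<Sum>k\<in>set [4, 3, 2, 1, 0]. of_bool (odd (m div 2 ^ k)) * 2 ^ k)"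
    by (rule sum_list_distinct_conv_sum_set) simp
  finally show ?thesis by (simp only: list.set)
qed

lemma factor_prod_binary_factors:
  assumes "length ms = 5" "list_all (\<lambda>m. m < 32) ms"
  shows "factor_prod r (binary_factors ms) = Ymon r ms"
proof -
  let ?F = "\<lambda>i k. if odd (ms ! i div 2 ^ k) then Y (r + i) ^ 2 ^ k else 1"
  have p: "(\<Prod>x\<leftarrow>concat xss. g x) = (\<Prod>xs\<leftarrow>xss. \<Prod>x\<leftarrow>xs. g x)" for g :: "nat \<times> nat \<Rightarrow> (5, 'k) kP" and xss
    by (induction xss) simp_all
  have f: "(\<Prod>x\<leftarrow>filter P xs. g x) = (\<Prod>x\<leftarrow>xs. if P x then g x else 1)" for g :: "nat \<Rightarrow> (5, 'k) kP" and P xs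
    by (induction xs) simp_all
  have "factor_prod r (binary_factors ms) = (\<Prod>k\<leftarrow>[4, 3, 2, 1, 0]. \<Prod>i\<leftarrow>[0, 1, 2, 3, 4]. ?F i k)"
    unfolding factor_prod_def binary_factors_def p map_map comp_def prod.case f ..
  also have "\<dots> = (\<Prod>k\<in>{4, 3, 2, 1, 0}. \<Prod>i\<in>{0, 1, 2, 3, 4}. ?F i k)" by (simp add: mult.assoc)
  also have "\<dots> = (\<Prod>i\<in>{0, 1, 2, 3, 4}. \<Prod>k\<in>{4, 3, 2, 1, 0}. ?F i k)" by (rule prod.swap)
  also have "\<dots> = (\<Prod>i\<in>{0, 1, 2, 3, 4}. Y (r + i) ^ (ms ! i))"
  proof (rule prod.cong, rule refl)
    fix i :: nat assume "i \<in> {0, 1, 2, 3, 4}"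
    then have "ms ! i < 32" using assms by (auto simp: list_all_length)
    have "Y (r + i) ^ (\<Sum>k\<in>{4, 3, 2, 1, 0}. of_bool (odd (ms ! i div 2 ^ k)) * 2 ^ k) = (\<Prod>k\<in>{4, 3, 2, 1, 0}. ?F i k)"
      unfolding power_sum by (rule prod.cong) auto
    then show "(\<Prod>k\<in>{4, 3, 2, 1, 0}. ?F i k) = Y (r + i) ^ (ms ! i)"
      using binary_expansion[OF \<open>ms ! i < 32\<close>] by metis
  qed
  also have "\<dots> = Ymon r ms"
  proof -
    from assms(1) obtain a b c d e where "ms = [a, b, c, d, e]" by (rule length_5_E)
    then show ?thesis by (simp add: numeral_eq_Suc)
  qed
  finally show ?thesis .
qed

lemma lookup_Yorbit:
  assumes "length ms = 5" "list_all (\<lambda>m. m < 32) ms" "length t = 5"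
  shows "Poly_Mapping.lookup (Yorbit ms) (spike_of t) = of_bool (orbit_coeff t ms)"
proof -
  have "Poly_Mapping.lookup (Yorbit ms) (spike_of t) =
      (\<Sum>r<5. z ^ (0 * 2 ^ r) * Poly_Mapping.lookup (factor_prod r (binary_factors ms)) (spike_of t))"
    by (simp only: Yorbit_def lookup_sum factor_prod_binary_factors[OF assms(1,2)] mult_zero_left power_0 mult_1_left)
  then show ?thesis unfolding lookup_factor_prod[OF assms(3)] orbit_coeff_def .
qed

text \<open>The average of \<open>f\<close> is a combination of basis orbits modulo hit elements.
  Its spike coefficients vanish, and independence of the columns of \<open>M\<close> forces the
  combination to be zero.\<close>

lemma hit_if_certificate:
  fixes f :: "5 P"
  assumes cert: "certificate d basis rss" and "d < 31"
    and basis: "admissible_basis basis" and T: "list_all admissible_spike T"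
    and sep: "map (coeff_row basis) T = M" "left_inverse (length basis) M R"
    and f: "homogeneous d f" "invariant_mod_hit f"
  shows "f \<in> hit"
proof -
  define n where "n = length basis"
  define V where "V c = (\<Sum>p<n. cK (c p) * Yorbit (basis ! p))" for c
  \<comment> \<open>The sum of \<open>hit_K\<close> and the span of the basis orbits, with
    \<open>+\<close> in place of subtraction.\<close>
  define U where "U = {g. \<exists>c. g + V c \<in> hit_K}"
  have V_add: "V (\<lambda>p. c p + c' p) = V c + V c'" for c c'
    by (simp add: V_def distrib_right sum.distrib)
  have V_scale: "V (\<lambda>p. a * c p) = cK a * V c" for a c
    unfolding V_def sum_distrib_left cK_simps mult.assoc ..
  have V0: "V (\<lambda>p. 0) = 0" by (simp add: V_def)
  have "kP.subspace U"
    unfolding kP.subspace_def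
  proof (intro conjI ballI allI)
    show "0 \<in> U" using V0 hit_K_0 by (auto simp: U_def intro!: exI[of _ "\<lambda>p. 0"])
    fix x y assume "x \<in> U" "y \<in> U"
    then obtain c c' where "x + V c \<in> hit_K" "y + V c' \<in> hit_K" by (auto simp: U_def)
    from hit_K_add[OF this] have "x + y + V (\<lambda>p. c p + c' p) \<in> hit_K" by (simp add: V_add add_ac)
    then show "x + y \<in> U" by (auto simp: U_def)
  next
    fix a x assume "x \<in> U"
    then obtain c where "x + V c \<in> hit_K" by (auto simp: U_def)
    from hit_K_scale[OF this, of a] have "cK a * x + V (\<lambda>p. a * c p) \<in> hit_K" by (simp add: V_scale distrib_left)
    then show "cK a * x \<in> U" by (auto simp: U_def)
  qed
  moreover have "hit_K \<subseteq> U"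
    using V0 by (auto simp: U_def intro!: exI[of _ "\<lambda>p. 0"])
  moreover have "Yorbit b \<in> U" if "b \<in> set basis" for b
  proof -
    from that obtain q where q: "q < n" "basis ! q = b" by (metis n_def in_set_conv_nth)
    have "V (\<lambda>p. of_bool (p = q)) = (\<Sum>p<n. if p = q then Yorbit b else 0)"
      unfolding V_def using q by (intro sum.cong) auto
    then have "Yorbit b + V (\<lambda>p. of_bool (p = q)) = 0" using q by (simp add: kP_add_self)
    then show ?thesis using hit_K_0 by (metis (mono_tags, lifting) U_def mem_Collect_eq)
  qed
  ultimately have "incl (average f) \<in> U"
    using certificate_sound[OF cert \<open>d < 31\<close> f(1)] by blast
  then obtain c where c: "incl (average f) + V c \<in> hit_K" by (auto simp: U_def)
  have inv: "invariant_mod_hit (average f)"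
    by (rule invariant_mod_hit_cong[OF f(2) average_congruent[OF f(2)]])
  have basis: "length (basis ! p) = 5" "list_all (\<lambda>m. m < 32) (basis ! p)" if "p < n" for p
    using basis that by (auto simp: admissible_basis_def n_def list_all_length)
  have T: "admissible_spike t" if "t \<in> set T" for t
    using T that by (auto simp: list_all_iff)
  \<comment> \<open>At a spike both the element of \<open>hit_K\<close> and the invariant
    \<open>average f\<close> have coefficient 0, hence so has \<open>V c\<close>.\<close>
  have eq: "(\<Sum>p<n. c p * of_bool (orbit_coeff t (basis ! p))) = 0" if t: "t \<in> set T" for t
  proof -
    have len: "length t = 5" using T[OF t] by (simp add: admissible_spike_def)
    have "Poly_Mapping.lookup (incl (average f) + V c) (spike_of t) = 0"
      by (rule lookup_hit_K_spike[OF c spike_admissible[OF T[OF t]]])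
    moreover have "Poly_Mapping.lookup (incl (average f)) (spike_of t) = 0"
      using lookup_invariant_admissible[OF inv T[OF t]] by (simp add: lookup_incl)
    ultimately have "Poly_Mapping.lookup (V c) (spike_of t) = 0" by (simp add: lookup_add)
    then show ?thesis
      using basis len by (simp add: V_def lookup_sum lookup_cK_mult lookup_Yorbit)
  qed
  \<comment> \<open>Adding the equations listed in \<open>R ! q\<close> leaves the q-th unit vector
    as row of coefficients.\<close>
  have "c q = 0" if q: "q < n" for q
  proof -
    have R: "r < length T" if "r \<in> set (R ! q)" for r
      using sep q that by (auto simp: left_inverse_def unit_row_def n_def list_all_iff)
    have sum_xor: "(\<Sum>r\<leftarrow>xs. of_bool (P r)) = (of_bool (xor_list P xs) :: 'k)" for P and xs :: "nat list"
      by (induction xs) auto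
    have "(\<Sum>r\<leftarrow>R ! q. \<Sum>p<n. c p * of_bool (orbit_coeff (T ! r) (basis ! p))) = (\<Sum>r\<leftarrow>R ! q. 0)"
      using R eq by (intro arg_cong[where f = sum_list] map_cong refl) auto
    moreover have "(\<Sum>r\<leftarrow>xs. \<Sum>p<n. c p * of_bool (orbit_coeff (T ! r) (basis ! p))) =
        (\<Sum>p<n. c p * (\<Sum>r\<leftarrow>xs. of_bool (orbit_coeff (T ! r) (basis ! p))))" for xs
      by (induction xs) (simp_all add: sum.distrib distrib_left)
    ultimately have "(\<Sum>p<n. c p * of_bool (xor_list (\<lambda>r. orbit_coeff (T ! r) (basis ! p)) (R ! q))) = 0"
      by (simp add: sum_xor)
    moreover have "xor_list (\<lambda>r. orbit_coeff (T ! r) (basis ! p)) (R ! q) \<longleftrightarrow> p = q" if p: "p < n" for p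
    proof -
      have "xor_list (entry M p) (R ! q) \<longleftrightarrow> p = q"
        using sep(2) p q by (auto simp: left_inverse_def unit_row_def unit_entry_def n_def list_all_iff)
      moreover have "xor_list (entry M p) rs = xor_list (\<lambda>r. orbit_coeff (T ! r) (basis ! p)) rs"
        if "\<And>r. r \<in> set rs \<Longrightarrow> r < length T" for rs
        using that by (induction rs) (use p in \<open>auto simp: entry_def coeff_row_def n_def simp flip: sep(1)\<close>)
      ultimately show ?thesis using R by blast
    qed
    ultimately have "(\<Sum>p<n. c p * of_bool (p = q)) = 0" by simp
    moreover have "(\<Sum>p<n. c p * of_bool (p = q)) = (\<Sum>p<n. if p = q then c p else 0)"
      by (rule sum.cong) auto
    ultimately show ?thesis using q by simp
  qed
  then have "V c = 0" by (simp add: V_def)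
  then have "average f \<in> hit" using c hit_if_incl_hit_K by simp
  then show ?thesis
    using hit_add_cancel[of f "average f"] average_congruent[OF f(2)] by (simp add: add.commute)
qed

end

subsection \<open>Degrees 10 and 25\<close>

text \<open>
  The lists were found by Gaussian elimination. In each entry of \<open>relations_d\<close>, a list of pairs
  \<open>(k, ms)\<close> standing for the sum of the twisted squares \<open>Sq\<^sup>k\<close> of the monomials \<open>ms\<close>, exactly one
  orbit is not yet known to be a combination of the orbits in \<open>basis_d\<close> modulo hit elements.
\<close>

definition basis_10 :: "nat list list" where
  "basis_10 = [[0, 0, 3, 0, 7], [0, 1, 5, 3, 1]]"

definition matrix_10 :: "bool list list" where
  "matrix_10 = [[True, False], [False, True]]"

definition relations_10 :: "(nat \<times> nat list) list list" where
  "relations_10 = [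
    [(1, [0, 0, 1, 1, 7]), (1, [0, 3, 0, 5, 1]), (1, [0, 3, 2, 2, 2]), (2, [0, 1, 3, 2, 2])],
    [(1, [0, 3, 2, 2, 2])], [(1, [0, 3, 0, 5, 1])], [(2, [0, 3, 0, 3, 2])], [(1, [0, 1, 3, 4, 1])],
    [(1, [0, 0, 1, 1, 7])]]"

definition spikes_10 :: "nat list list" where
  "spikes_10 = [[0, 0, 0, 3, 7], [0, 0, 0, 7, 3]]"

definition dual_10 :: "nat list list" where
  "dual_10 = [[0], [1]]"

definition basis_25 :: "nat list list" where
  "basis_25 = [[3, 4, 10, 3, 5], [1, 2, 7, 7, 8], [1, 3, 2, 5, 14], [1, 6, 5, 3, 10], [1, 13, 2, 3, 6], [0, 12, 7, 3, 3],
    [1, 11, 3, 5, 5], [1, 3, 11, 7, 3]]"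

definition matrix_25 :: "bool list list" where
  "matrix_25 = [[True, True, True, False, False, True, False, True],
    [False, False, True, False, False, False, False, True],
    [True, False, False, False, True, False, False, False],
    [False, True, True, True, True, True, False, True],
    [True, True, True, False, False, False, False, True],
    [True, True, False, True, True, True, False, False],
    [False, True, True, False, True, False, True, False],
    [False, False, False, True, True, True, True, False]]"

definition relations_25 :: "(nat \<times> nat list) list list" where
  "relations_25 = [
    [(1, [0, 2, 16, 5, 1]), (1, [0, 3, 7, 9, 5]), (1, [0, 9, 0, 9, 6]), (1, [1, 4, 2, 9, 8]),
    (1, [1, 4, 4, 6, 9]), (1, [1, 4, 6, 3, 10]), (1, [1, 5, 8, 6, 4]), (1, [1, 6, 1, 7, 9]),
    (1, [1, 6, 5, 1, 11]), (1, [1, 7, 5, 7, 4]), (1, [1, 7, 7, 4, 5]), (1, [1, 9, 6, 2, 6]),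
    (1, [2, 2, 5, 10, 5]), (1, [2, 2, 7, 7, 6]), (1, [2, 3, 2, 5, 12]), (1, [2, 3, 4, 2, 13]),
    (1, [2, 6, 5, 3, 8]), (1, [3, 6, 5, 5, 5]), (2, [0, 2, 3, 7, 11]), (2, [0, 2, 18, 0, 3]),
    (2, [0, 5, 2, 11, 5]), (2, [1, 1, 12, 5, 4]), (2, [1, 2, 5, 6, 9]), (2, [1, 6, 3, 2, 11]),
    (2, [1, 9, 2, 6, 5]), (2, [2, 2, 7, 5, 7]), (2, [2, 4, 2, 9, 6]), (2, [2, 4, 4, 6, 7]), (2, [2, 6, 3, 4, 8]),
    (2, [2, 7, 7, 4, 3]), (2, [3, 4, 6, 5, 5]), (4, [0, 5, 4, 4, 8]), (4, [0, 6, 8, 4, 3]),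
    (4, [1, 2, 5, 2, 11]), (4, [1, 4, 2, 3, 11]), (4, [2, 3, 9, 4, 3]), (4, [2, 4, 4, 2, 9]),
    (8, [0, 0, 2, 0, 15]), (8, [0, 2, 8, 3, 4]), (8, [1, 8, 3, 2, 3])], [(1, [0, 2, 16, 5, 1]),
    (1, [0, 3, 5, 12, 4]), (1, [0, 3, 11, 3, 7]), (1, [0, 6, 1, 5, 12]), (1, [0, 6, 3, 2, 13]),
    (1, [0, 7, 1, 11, 5]), (1, [0, 9, 0, 9, 6]), (1, [1, 2, 5, 8, 8]), (1, [1, 4, 2, 9, 8]),
    (1, [1, 4, 4, 6, 9]), (1, [1, 7, 3, 10, 3]), (1, [1, 7, 5, 7, 4]), (1, [2, 2, 5, 10, 5]),
    (1, [2, 6, 5, 3, 8]), (1, [3, 4, 6, 7, 4]), (1, [3, 6, 5, 5, 5]), (2, [0, 2, 18, 0, 3]),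
    (2, [0, 3, 5, 10, 5]), (2, [0, 3, 11, 1, 8]), (2, [0, 5, 2, 11, 5]), (2, [0, 6, 1, 3, 13]),
    (2, [0, 6, 8, 8, 1]), (2, [1, 1, 12, 5, 4]), (2, [1, 2, 5, 6, 9]), (2, [1, 2, 7, 3, 10]),
    (2, [1, 3, 5, 12, 2]), (2, [1, 3, 11, 3, 5]), (2, [1, 4, 6, 1, 11]), (2, [1, 5, 2, 13, 2]),
    (2, [1, 7, 1, 11, 3]), (2, [1, 7, 5, 5, 5]), (2, [1, 9, 2, 6, 5]), (2, [2, 4, 2, 9, 6]),
    (2, [2, 6, 3, 4, 8]), (2, [2, 7, 7, 4, 3]), (2, [3, 4, 6, 5, 5]), (4, [0, 3, 1, 12, 5]),
    (4, [0, 3, 7, 3, 8]), (4, [0, 6, 8, 4, 3]), (4, [1, 2, 5, 2, 11]), (4, [1, 3, 5, 8, 4]),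
    (4, [1, 5, 2, 9, 4]), (4, [1, 7, 1, 7, 5]), (4, [2, 5, 6, 5, 3]), (8, [0, 0, 2, 0, 15]),
    (8, [0, 2, 8, 3, 4]), (8, [0, 3, 1, 4, 9])], [(2, [0, 1, 6, 12, 4])], [(1, [0, 3, 5, 12, 4])],
    [(2, [0, 0, 2, 12, 9])], [(8, [0, 0, 2, 0, 15])], [(1, [2, 2, 5, 10, 5])], [(1, [2, 3, 2, 5, 12])],
    [(1, [0, 12, 7, 1, 4])], [(8, [0, 2, 8, 3, 4])], [(8, [1, 2, 10, 2, 2])], [(1, [2, 3, 4, 2, 13])],
    [(2, [0, 6, 8, 8, 1])], [(1, [1, 4, 2, 9, 8])], [(8, [0, 2, 10, 0, 5])], [(1, [1, 2, 5, 8, 8])],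
    [(2, [0, 0, 8, 3, 12])], [(1, [0, 12, 1, 10, 1])], [(2, [0, 16, 1, 1, 5])], [(2, [0, 0, 10, 0, 13])],
    [(4, [0, 5, 4, 4, 8])], [(2, [0, 0, 0, 15, 8])], [(1, [0, 2, 16, 5, 1])], [(1, [1, 2, 1, 14, 6])],
    [(4, [0, 8, 7, 2, 4])], [(1, [1, 4, 4, 6, 9])], [(8, [0, 4, 1, 10, 2])], [(1, [0, 6, 1, 5, 12])],
    [(1, [0, 11, 1, 4, 8])], [(2, [0, 2, 18, 0, 3])], [(1, [1, 4, 6, 3, 10])], [(2, [2, 6, 3, 4, 8])],
    [(2, [2, 4, 2, 9, 6])], [(1, [0, 0, 19, 4, 1])], [(4, [2, 4, 4, 2, 9])], [(8, [0, 2, 4, 9, 2])],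
    [(1, [0, 4, 13, 6, 1])], [(2, [0, 2, 1, 10, 10])], [(8, [1, 1, 2, 8, 5])], [(1, [1, 9, 6, 2, 6])],
    [(1, [1, 5, 8, 6, 4])], [(1, [0, 8, 7, 8, 1])], [(1, [0, 5, 10, 1, 8])], [(4, [0, 1, 2, 14, 4])],
    [(1, [0, 4, 15, 3, 2])], [(1, [0, 0, 8, 5, 11])], [(1, [0, 6, 3, 2, 13])], [(2, [0, 1, 10, 6, 6])],
    [(2, [0, 6, 3, 0, 14])], [(8, [0, 0, 9, 5, 3])], [(4, [0, 6, 8, 4, 3])], [(8, [0, 8, 1, 3, 5])],
    [(2, [2, 4, 4, 6, 7])], [(2, [1, 3, 5, 12, 2])], [(4, [1, 1, 10, 4, 5])], [(2, [0, 0, 19, 2, 2])],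
    [(2, [1, 1, 12, 5, 4])], [(2, [0, 1, 1, 4, 17])], [(4, [0, 6, 10, 1, 4])], [(8, [0, 0, 5, 11, 1])],
    [(8, [0, 1, 0, 9, 7])], [(4, [0, 8, 5, 5, 3])], [(4, [0, 0, 13, 7, 1])], [(4, [0, 10, 2, 6, 3])],
    [(2, [0, 4, 11, 7, 1])], [(4, [1, 3, 5, 8, 4])], [(2, [1, 3, 2, 1, 16])], [(2, [1, 1, 1, 6, 14])],
    [(1, [0, 14, 2, 5, 3])], [(1, [2, 6, 5, 3, 8])], [(1, [0, 1, 10, 8, 5])], [(1, [0, 9, 0, 9, 6])],
    [(1, [3, 4, 6, 7, 4])], [(1, [2, 2, 7, 7, 6])], [(2, [0, 8, 7, 6, 2])], [(8, [1, 8, 3, 2, 3])],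
    [(8, [1, 5, 2, 1, 8])], [(8, [0, 3, 1, 4, 9])], [(1, [1, 1, 16, 1, 5])], [(8, [0, 3, 3, 1, 10])],
    [(4, [1, 5, 2, 9, 4])], [(2, [0, 3, 11, 1, 8])], [(2, [1, 4, 6, 1, 11])], [(2, [1, 2, 5, 6, 9])],
    [(4, [1, 1, 8, 7, 4])], [(2, [2, 9, 4, 5, 3])], [(2, [3, 4, 6, 5, 5])], [(4, [0, 3, 1, 12, 5])],
    [(8, [0, 1, 4, 3, 9])], [(4, [0, 7, 1, 5, 8])], [(2, [1, 2, 1, 12, 7])], [(2, [0, 3, 5, 10, 5])],
    [(2, [0, 12, 3, 5, 3])], [(2, [0, 5, 2, 11, 5])], [(2, [1, 5, 2, 13, 2])], [(4, [1, 1, 4, 13, 2])],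
    [(4, [0, 1, 8, 5, 7])], [(4, [1, 1, 12, 1, 6])], [(4, [1, 5, 4, 6, 5])], [(4, [0, 3, 7, 3, 8])],
    [(4, [1, 12, 3, 3, 2])], [(4, [1, 2, 5, 2, 11])], [(4, [1, 4, 2, 3, 11])], [(4, [2, 3, 9, 4, 3])],
    [(4, [1, 1, 6, 10, 3])], [(4, [1, 3, 1, 14, 2])], [(2, [1, 9, 2, 6, 5])], [(2, [0, 6, 1, 3, 13])],
    [(2, [0, 2, 7, 1, 13])], [(1, [1, 5, 10, 3, 5])], [(1, [1, 2, 7, 5, 9])], [(4, [0, 5, 2, 7, 7])],
    [(4, [2, 7, 5, 3, 4])], [(1, [1, 1, 3, 5, 14])], [(1, [0, 3, 3, 15, 3])], [(2, [2, 5, 10, 3, 3])],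
    [(1, [1, 6, 5, 1, 11])], [(2, [1, 2, 7, 3, 10])], [(4, [2, 5, 6, 5, 3])], [(4, [0, 3, 5, 6, 7])],
    [(1, [0, 7, 1, 11, 5])], [(1, [1, 7, 1, 13, 2])], [(1, [1, 7, 3, 10, 3])], [(2, [2, 3, 2, 3, 13])],
    [(1, [1, 2, 3, 11, 7])], [(2, [2, 11, 3, 3, 4])], [(4, [1, 7, 3, 4, 6])], [(1, [1, 6, 1, 7, 9])],
    [(1, [1, 5, 6, 9, 3])], [(2, [0, 2, 3, 7, 11])], [(2, [1, 6, 3, 2, 11])], [(1, [1, 3, 7, 11, 2])],
    [(1, [2, 11, 3, 5, 3])], [(1, [0, 3, 7, 9, 5])], [(1, [0, 3, 11, 3, 7])], [(2, [2, 7, 7, 4, 3])],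
    [(2, [3, 6, 3, 6, 5])], [(1, [3, 6, 5, 5, 5])], [(1, [1, 7, 7, 4, 5])], [(1, [1, 7, 5, 7, 4])],
    [(2, [1, 7, 5, 5, 5])], [(1, [1, 1, 12, 7, 3])], [(4, [1, 3, 7, 5, 5])], [(2, [1, 3, 11, 3, 5])],
    [(2, [1, 3, 7, 9, 3])], [(2, [1, 7, 1, 11, 3])]]"

definition spikes_25 :: "nat list list" where
  "spikes_25 = [[0, 0, 3, 7, 15], [0, 0, 3, 15, 7], [0, 0, 7, 3, 15], [0, 0, 7, 15, 3], [0, 0, 15, 3, 7], [0, 0, 15, 7, 3],
    [0, 3, 0, 7, 15], [0, 3, 7, 0, 15]]"

definition dual_25 :: "nat list list" where
  "dual_25 = [[1, 3, 5], [3, 4, 5], [2, 5, 6, 7], [0, 2, 3], [1, 2, 3, 5], [0, 4], [1, 4, 5, 7], [1, 2, 5, 6, 7]]"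

lemma certificate_10: "certificate 10 basis_10 relations_10"
  by code_simp

lemma certificate_25: "certificate 25 basis_25 relations_25"
  by code_simp

lemma admissible:
  "admissible_basis basis_10" "list_all admissible_spike spikes_10"
  "admissible_basis basis_25" "list_all admissible_spike spikes_25"
  by code_simp+

lemma matrix_10: "map (coeff_row basis_10) spikes_10 = matrix_10"
  by code_simp

lemma coeff_rows_25:
  "coeff_row basis_25 [0, 0, 3, 7, 15] = [True, True, True, False, False, True, False, True]"
  "coeff_row basis_25 [0, 0, 3, 15, 7] = [False, False, True, False, False, False, False, True]"
  "coeff_row basis_25 [0, 0, 7, 3, 15] = [True, False, False, False, True, False, False, False]"
  "coeff_row basis_25 [0, 0, 7, 15, 3] = [False, True, True, True, True, True, False, True]"
  "coeff_row basis_25 [0, 0, 15, 3, 7] = [True, True, True, False, False, False, False, True]"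
  "coeff_row basis_25 [0, 0, 15, 7, 3] = [True, True, False, True, True, True, False, False]"
  "coeff_row basis_25 [0, 3, 0, 7, 15] = [False, True, True, False, True, False, True, False]"
  "coeff_row basis_25 [0, 3, 7, 0, 15] = [False, False, False, True, True, True, True, False]"
  by code_simp+

lemma matrix_25: "map (coeff_row basis_25) spikes_25 = matrix_25"
  by (simp only: spikes_25_def matrix_25_def list.map coeff_rows_25)

lemma left_inverses:
  "left_inverse (length basis_10) matrix_10 dual_10"
  "left_inverse (length basis_25) matrix_25 dual_25"
  by code_simp+

section \<open>Existence of the functional and of a root of x^5 + x^2 + 1\<close>

lemma exists_additive_functional:
  assumes "(1 :: 'k::field) + 1 = 0"
  obtains lam :: "'k::field \<Rightarrow> bit" where "\<And>x y. lam (x + y) = lam x + lam y" "lam 1 = 1"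
proof -
  have hadd: "bit_K (b + c) = bit_K b + (bit_K c :: 'k)" and hmult: "bit_K (b * c) = bit_K b * (bit_K c :: 'k)" for b c
    using assms by (cases b; cases c; simp add: bit_K_def)+
  have "(2 :: 'k) = 0" using assms by simp
  then interpret vector_space_pair "\<lambda>b (x :: 'k). bit_K b * x" "(*) :: bit \<Rightarrow> bit \<Rightarrow> bit"
    by unfold_locales (simp_all add: hadd hmult algebra_simps, auto simp: bit_K_def)
  have "vs1.independent {1 :: 'k}"
    by (simp add: vs1.dependent_single)
  then obtain g where g: "Vector_Spaces.linear (\<lambda>b (x :: 'k). bit_K b * x) (*) g" "\<forall>x\<in>{1}. g x = (1 :: bit)"
    using linear_independent_extend[of "{1}" "\<lambda>_. 1"] by blast
  from g(1) interpret g: Vector_Spaces.linear "\<lambda>b (x :: 'k). bit_K b * x" "(*) :: bit \<Rightarrow> bit \<Rightarrow> bit" g .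
  show thesis by (rule that[of g]) (use g(2) g.add in auto)
qed

lemma exists_field_32: "\<exists>(lam :: bit alg_closure \<Rightarrow> bit) z. field_32 lam z"
proof -
  have two: "(1 :: bit alg_closure) + 1 = 0"
    using to_ac_add[of "1 :: bit" 1] by simp
  then obtain lam :: "bit alg_closure \<Rightarrow> bit" where lam: "\<And>x y. lam (x + y) = lam x + lam y" "lam 1 = 1"
    by (rule exists_additive_functional) blast
  have "degree [:1, 0, 1, 0, 0, 1 :: bit alg_closure:] > 0" by simp
  then obtain z :: "bit alg_closure" where "poly [:1, 0, 1, 0, 0, 1:] z = 0"
    using alg_closed_imp_poly_has_root by blast
  then have z: "z ^ 5 + (z ^ 2 + 1) = 0" by (simp add: algebra_simps numeral_eq_Suc)
  have "x + x = 0" for x :: "bit alg_closure" using two by (metis distrib_left mult_1_right mult_zero_right)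
  then have "z ^ 5 = z ^ 2 + 1" using z by (metis add.right_cancel)
  then have "field_32 lam z" by unfold_locales (use two lam in auto)
  then show ?thesis by blast
qed

lemma invariant_hit_10_25:
  fixes f :: "5 P"
  assumes "d = 10 \<or> d = 25" "homogeneous d f" "invariant_mod_hit f"
  shows "f \<in> hit"
proof -
  obtain lam :: "bit alg_closure \<Rightarrow> bit" and z where "field_32 lam z" using exists_field_32 by blast
  then interpret field_32 lam z .
  show ?thesis
    using assms hit_if_certificate[OF certificate_10 _ admissible(1,2) matrix_10 left_inverses(1)]
      hit_if_certificate[OF certificate_25 _ admissible(3,4) matrix_25 left_inverses(2)] by auto
qed

subsection \<open>Kameko's map\<close>

lemma P_square_add: "(f + g) ^ 2 = f ^ 2 + (g :: 'n P) ^ 2"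
proof -
  have "(f + g) ^ 2 = f ^ 2 + g ^ 2 + (f * g + f * g)"
    by (simp add: power2_eq_square algebra_simps del: P_add_self)
  then show ?thesis by simp
qed

text \<open>Mixed terms occur twice and cancel, so squaring a polynomial squares its coefficients
  and doubles the degrees.\<close>

lemma coeff_square:
  "coeff (p ^ 2) k = (if even k then coeff (p :: 'n P poly) (k div 2) ^ 2 else 0)"
proof (induction p arbitrary: k)
  case (pCons a p)
  have "pCons a p ^ 2 = pCons (a ^ 2) (pCons 0 (p ^ 2)) + (smult a (pCons 0 p) + smult a (pCons 0 p))"
    by (simp add: power2_eq_square mult.commute)
  moreover have "smult a (pCons 0 p) + smult a (pCons 0 p) = 0"
    by (rule poly_eqI) (simp only: coeff_add P_add_self coeff_0)
  ultimately have sq: "pCons a p ^ 2 = pCons (a ^ 2) (pCons 0 (p ^ 2))" by simp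
  show ?case
  proof (cases k)
    case (Suc k')
    show ?thesis
    proof (cases k')
      case (Suc k'')
      then show ?thesis using \<open>k = Suc k'\<close> pCons.IH[of k''] by (simp add: sq)
    qed (simp add: sq \<open>k = Suc k'\<close>)
  qed (simp add: sq)
qed simp

lemma Sq_square: "Sq k (f ^ 2) = (if even k then Sq (k div 2) f ^ 2 else 0)"
  by (simp add: Sq_eq_coeff total_square_power coeff_square)

definition odd_exp :: "('n::finite \<Rightarrow>\<^sub>0 nat) \<Rightarrow> 'n \<Rightarrow>\<^sub>0 nat" where
  "odd_exp a = expo (\<lambda>i. 2 * Poly_Mapping.lookup a i + 1)"

definition kameko :: "'n::finite P \<Rightarrow> 'n P" where
  "kameko f = Poly_Mapping.map_key odd_exp f"

lemma lookup_odd_exp [simp]: "Poly_Mapping.lookup (odd_exp a) i = 2 * Poly_Mapping.lookup a i + 1"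
  by (simp add: odd_exp_def)

lemma inj_odd_exp: "inj (odd_exp :: ('n::finite \<Rightarrow>\<^sub>0 nat) \<Rightarrow> _)"
proof (rule injI)
  fix a b :: "'n \<Rightarrow>\<^sub>0 nat" assume e: "odd_exp a = odd_exp b"
  show "a = b"
  proof (rule poly_mapping_eqI)
    fix i show "Poly_Mapping.lookup a i = Poly_Mapping.lookup b i"
      using lookup_odd_exp[of a i] lookup_odd_exp[of b i] e by simp
  qed
qed

lemma lookup_kameko [simp]: "Poly_Mapping.lookup (kameko f) a = Poly_Mapping.lookup f (odd_exp a)"
  by (simp add: kameko_def Poly_Mapping.map_key.rep_eq inj_odd_exp)

lemma kameko_add: "kameko (f + g) = kameko f + kameko g"
  by (intro poly_mapping_eqI) (simp add: lookup_add)

lemma kameko_0 [simp]: "kameko 0 = 0"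
  by (intro poly_mapping_eqI) simp

lemma kameko_sum: "kameko (sum f K) = (\<Sum>i\<in>K. kameko (f i))"
  by (induction K rule: infinite_finite_induct) (simp_all add: kameko_add)

lemma kameko_mon_even:
  assumes "even (Poly_Mapping.lookup m i)"
  shows "kameko (mon m) = 0"
proof -
  have "m \<noteq> odd_exp a" for a using assms by auto
  then show ?thesis by (intro poly_mapping_eqI) (simp add: lookup_single when_def)
qed

lemma kameko_mon_odd_exp: "kameko (mon (odd_exp a)) = mon a"
  using injD[OF inj_odd_exp] by (intro poly_mapping_eqI) (auto simp: lookup_single when_def)

lemma odd_exp_half:
  assumes "\<forall>i. odd (Poly_Mapping.lookup m i)"
  shows "m = odd_exp (expo (\<lambda>i. Poly_Mapping.lookup m i div 2))"
  using assms by (intro poly_mapping_eqI) simp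

lemma mon_power2: "mon a ^ 2 = mon (a + a)"
  by (simp add: power2_eq_square mult_single)

text \<open>A square changes no parity of an exponent, and adding 2a to an odd exponent adds a after
  halving.\<close>

lemma kameko_square_mult: "kameko (g ^ 2 * f) = g * kameko f"
proof -
  have mm: "kameko (mon (a + a) * mon m) = mon a * kameko (mon m)" for a m :: "'a \<Rightarrow>\<^sub>0 nat"
  proof (cases "\<forall>i. odd (Poly_Mapping.lookup m i)")
    case True
    then obtain b where m: "m = odd_exp b" using odd_exp_half by blast
    have "a + a + m = odd_exp (a + b)" unfolding m by (intro poly_mapping_eqI) (simp add: lookup_add)
    then show ?thesis using kameko_mon_odd_exp[of "a + b"] by (simp add: m mult_single kameko_mon_odd_exp)
  next
    case False
    then obtain i where "even (Poly_Mapping.lookup m i)" by blast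
    then have "kameko (mon m) = 0" "kameko (mon (a + a + m)) = 0"
      by (intro kameko_mon_even[of _ i]; simp add: lookup_add)+
    then show ?thesis by (simp add: mult_single)
  qed
  have m: "kameko (mon (a + a) * f) = mon a * kameko f" for a
    by (induction f rule: P_mon_induct) (simp_all add: distrib_left kameko_add mm)
  show ?thesis
    by (induction g rule: P_mon_induct) (simp_all add: P_square_add distrib_right kameko_add m mon_power2)
qed

definition parity_exp :: "('n::finite \<Rightarrow>\<^sub>0 nat) \<Rightarrow> 'n \<Rightarrow>\<^sub>0 nat" where
  "parity_exp m = expo (\<lambda>i. Poly_Mapping.lookup m i mod 2)"

definition half_exp :: "('n::finite \<Rightarrow>\<^sub>0 nat) \<Rightarrow> 'n \<Rightarrow>\<^sub>0 nat" where
  "half_exp m = expo (\<lambda>i. Poly_Mapping.lookup m i div 2)"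

lemma mon_decompose: "mon m = mon (half_exp m) ^ 2 * mon (parity_exp m)"
proof -
  have "m = half_exp m + half_exp m + parity_exp m"
    by (intro poly_mapping_eqI) (simp add: half_exp_def parity_exp_def lookup_add flip: mult_2)
  then show ?thesis by (simp add: mon_power2 mult_single)
qed

text \<open>Each term of the square contains some x_i^2, so it has an even exponent and is
  killed.\<close>

lemma kameko_Sq_squarefree:
  assumes "\<forall>i. Poly_Mapping.lookup m i \<le> 1" "k > 0"
  shows "kameko (Sq k (mon m)) = 0"
proof -
  have zero: "kameko (of_nat c * mon (m + expo b)) = 0"
    if b: "\<forall>i. b i \<le> Poly_Mapping.lookup m i" "sum b UNIV = k" for b and c :: nat
  proof -
    from b(2) assms(2) obtain i where i: "b i > 0" by (metis gr0I sum.neutral)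
    then have "Poly_Mapping.lookup m i = 1" "b i = 1"
      using b(1)[rule_format, of i] assms(1)[rule_format, of i] by auto
    then have "kameko (mon (m + expo b)) = 0" by (intro kameko_mon_even[of _ i]) (simp add: lookup_add)
    moreover have "of_nat c = (0 :: 'a P) \<or> of_nat c = (1 :: 'a P)"
      by (induction c) auto
    ultimately show ?thesis by auto
  qed
  show ?thesis unfolding Sq_mon kameko_sum
    by (intro sum.neutral ballI) (rule zero, auto)
qed

lemma parity_exp_le: "Poly_Mapping.lookup (parity_exp m) i \<le> 1"
  by (simp add: parity_exp_def)

lemma kameko_parity_exp: "kameko (mon (parity_exp m)) = 0 \<or> kameko (mon (parity_exp m)) = 1"
proof (cases "\<forall>i. odd (Poly_Mapping.lookup m i)")
  case True
  then have "parity_exp m = odd_exp 0"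
    by (intro poly_mapping_eqI) (simp add: parity_exp_def odd_iff_mod_2_eq_one)
  then show ?thesis by (simp add: kameko_mon_odd_exp)
next
  case False
  then obtain i where "even (Poly_Mapping.lookup m i)" by blast
  then have "kameko (mon (parity_exp m)) = 0"
    by (intro kameko_mon_even[of _ i]) (simp add: parity_exp_def)
  then show ?thesis by simp
qed

text \<open>A monomial is h^2 u with u squarefree. In the Cartan formula every term with a positive
  square on u dies by \<open>kameko_Sq_squarefree\<close>, which leaves Sq^k(h^2) u, where Sq^k(h^2)
  is the square of Sq^(k/2)(h) or zero.\<close>

lemma kameko_Sq: "kameko (Sq k f) = (if even k then Sq (k div 2) (kameko f) else 0)"
proof (induction f rule: P_mon_induct)
  case (add m f)
  let ?u = "mon (parity_exp m)" and ?h = "mon (half_exp m)"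
  have zero: "kameko (Sq (k - i) ?u) = 0" if "i < k" for i
    by (intro kameko_Sq_squarefree allI parity_exp_le) (use that in simp)
  have "kameko (Sq k (mon m)) = (\<Sum>i\<le>k. kameko (Sq i (?h ^ 2) * Sq (k - i) ?u))"
    by (subst mon_decompose) (simp only: Sq_simps kameko_sum)
  also have "\<dots> = (\<Sum>i\<le>k. if even i then Sq (i div 2) ?h * kameko (Sq (k - i) ?u) else 0)"
    by (rule sum.cong) (simp_all add: Sq_square kameko_square_mult)
  also have "\<dots> = (\<Sum>i\<in>{k}. if even i then Sq (i div 2) ?h * kameko (Sq (k - i) ?u) else 0)"
    by (intro sum.mono_neutral_right) (auto simp: zero)
  also have "\<dots> = (if even k then Sq (k div 2) ?h * kameko ?u else 0)" by (simp add: Sq_simps)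
  also have "Sq (k div 2) ?h * kameko ?u = Sq (k div 2) (kameko (mon m))"
    using kameko_parity_exp[of m] by (subst mon_decompose) (auto simp: kameko_square_mult)
  finally show ?case using add by (simp add: Sq_simps kameko_add)
qed simp

lemma kameko_hit:
  assumes "f \<in> hit"
  shows "kameko f \<in> hit"
  using assms
proof (induction rule: hit_induct)
  case (add k m f)
  have "kameko (Sq k (mon m)) \<in> hit"
  proof (cases "even k")
    case True
    then have "k div 2 > 0" using add(1) by (auto elim: evenE)
    then show ?thesis by (simp add: kameko_Sq True hit_Sq)
  qed (simp add: kameko_Sq)
  then show ?case using add by (simp add: kameko_add hit_add)
qed simp

lemma kameko_prod_X:
  fixes \<phi> :: "'n::finite \<Rightarrow> 'n"
  shows "kameko (\<Prod>i\<in>S. X (\<phi> i)) = (if S = UNIV \<and> bij \<phi> then 1 else 0)"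
proof -
  let ?m = "\<Sum>i\<in>S. Poly_Mapping.single (\<phi> i) (1 :: nat)"
  have p: "(\<Prod>i\<in>S. X (\<phi> i)) = mon ?m" by (simp add: mon_sum X_def)
  show ?thesis
  proof (cases "S = UNIV \<and> bij \<phi>")
    case True
    then have "(\<Prod>i\<in>S. X (\<phi> i)) = (\<Prod>i\<in>UNIV. X i)" by (simp add: prod.reindex_bij_betw)
    also have "\<dots> = mon (odd_exp 0)" using prod_X_expo[of "\<lambda>_. 1"] by (simp add: odd_exp_def)
    finally show ?thesis using True by (simp add: kameko_mon_odd_exp)
  next
    case False
    have "\<phi> ` S \<noteq> UNIV"
    proof
      assume surj: "\<phi> ` S = UNIV"
      then have "card S = CARD('n)"
        by (metis card_image_le card_mono finite order_antisym subset_UNIV)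
      then have "S = UNIV" by (metis card_subset_eq finite subset_UNIV)
      with surj have "surj \<phi>" by simp
      then have "bij \<phi>" by (simp add: bij_def finite_UNIV_surj_inj)
      with \<open>S = UNIV\<close> False show False by blast
    qed
    then obtain j where "j \<notin> \<phi> ` S" by blast
    then have "Poly_Mapping.lookup ?m j = 0"
      by (auto simp: lookup_sum lookup_single when_def intro!: sum.neutral)
    then have "kameko (mon ?m) = 0" by (intro kameko_mon_even[of _ j]) simp
    then show ?thesis using False p by auto
  qed
qed

lemma kameko_const_mult: "kameko (const c * f) = const c * kameko f"
  by (cases c) simp_all

lemma const_prod: "finite K \<Longrightarrow> const (prod c K) = (\<Prod>i\<in>K. const (c i))"
  by (induction K rule: finite_induct) (simp_all only: prod.empty prod.insert const_simps not_False_eq_True)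

lemma const_sum: "const (sum c K) = (\<Sum>i\<in>K. const (c i))"
  by (induction K rule: infinite_finite_induct) (simp_all only: sum.infinite sum.empty sum.insert const_simps not_False_eq_True)

text \<open>The coefficient of the product of all variables is the permanent of \<open>A\<close>.
  Signs are 1 modulo 2, so it equals the determinant, which is 1. Fewer linear forms cannot involve
  every variable to an odd power.\<close>

lemma kameko_prod_linform:
  fixes A :: "bit ^ 'n ^ 'n"
  assumes "invertible A"
  shows "kameko (\<Prod>i\<in>S. linform A i) = (if S = (UNIV :: 'n::finite set) then 1 else 0)"
proof -
  let ?F = "PiE S (\<lambda>_. UNIV :: 'n set)"
  have "(\<Prod>i\<in>S. linform A i) = (\<Sum>\<phi>\<in>?F. \<Prod>i\<in>S. const (A $ \<phi> i $ i) * X (\<phi> i))"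
    unfolding linform_def scaleP_def by (rule prod_sum_PiE) simp_all
  also have "\<dots> = (\<Sum>\<phi>\<in>?F. const (\<Prod>i\<in>S. A $ \<phi> i $ i) * (\<Prod>i\<in>S. X (\<phi> i)))"
    by (simp only: prod.distrib const_prod finite)
  finally have k: "kameko (\<Prod>i\<in>S. linform A i) =
      (\<Sum>\<phi>\<in>?F. const (\<Prod>i\<in>S. A $ \<phi> i $ i) * (if S = UNIV \<and> bij \<phi> then 1 else 0))"
    by (simp only: kameko_sum kameko_const_mult kameko_prod_X)
  show ?thesis
  proof (cases "S = UNIV")
    case True
    have "kameko (\<Prod>i\<in>S. linform A i) = (\<Sum>\<phi>\<in>UNIV. if bij \<phi> then const (\<Prod>i\<in>UNIV. A $ \<phi> i $ i) else 0)"
      unfolding k using True by (intro sum.cong) (auto simp: PiE_UNIV_domain)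
    also have "\<dots> = (\<Sum>\<phi>\<in>{\<phi>. \<phi> permutes UNIV}. const (\<Prod>i\<in>UNIV. A $ \<phi> i $ i))"
      by (rule sum.mono_neutral_cong_right) (auto dest: permutes_bij intro: bij_imp_permutes)
    also have "\<dots> = const (det (transpose A))"
    proof -
      have "of_int (sign p) = (1 :: bit)" for p :: "'n \<Rightarrow> 'n" by (simp add: sign_def)
      then show ?thesis by (simp only: det_def transpose_def vec_lambda_beta const_sum mult_1_left)
    qed
    also have "det (transpose A) = 1"
    proof -
      have "det A \<noteq> 0" using assms by (simp add: invertible_det_nz)
      then show ?thesis by (cases "det A") (simp_all add: det_transpose)
    qed
    finally show ?thesis using True by simp
  next
    case False
    then show ?thesis unfolding k by simp
  qed
qed

text \<open>The square part of a monomial passes through both maps. What remains is a product of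
  distinct variables, for which \<open>kameko_prod_linform\<close> gives the same value on both
  sides.\<close>

lemma kameko_linear_subst:
  assumes "invertible A"
  shows "kameko (linear_subst A f) = linear_subst A (kameko f)"
proof (induction f rule: P_mon_induct)
  case (add m f)
  let ?u = "mon (parity_exp m)" and ?h = "mon (half_exp m)"
  let ?S = "{i. odd (Poly_Mapping.lookup m i)}"
  have par: "F i ^ Poly_Mapping.lookup (parity_exp m) i = (if i \<in> ?S then F i else 1)" for F :: "'a \<Rightarrow> 'a P" and i
    by (cases "odd (Poly_Mapping.lookup m i)") (simp_all add: parity_exp_def odd_iff_mod_2_eq_one)
  have u: "?u = (\<Prod>i\<in>?S. X i)" "linear_subst A ?u = (\<Prod>i\<in>?S. linform A i)"
    unfolding linear_subst_mon unfolding mon_eq_prod par by (simp_all add: prod.If_cases)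
  have "kameko ?u = (if ?S = UNIV then 1 else 0)"
    unfolding u(1) using kameko_prod_X[of "\<lambda>i. i" ?S] by (simp add: bij_id[unfolded id_def])
  moreover have "kameko (linear_subst A ?u) = (if ?S = UNIV then 1 else 0)"
    unfolding u(2) by (rule kameko_prod_linform[OF assms])
  ultimately have "linear_subst A (kameko ?u) = kameko (linear_subst A ?u)"
    by (simp add: linear_subst_simps)
  then have "kameko (linear_subst A (mon m)) = linear_subst A (kameko (mon m))"
    by (subst (1 2) mon_decompose) (simp add: linear_subst_simps linear_subst_power kameko_square_mult)
  then show ?case using add by (simp add: linear_subst_simps kameko_add)
qed (simp add: linear_subst_simps)

lemma invariant_mod_hit_kameko:
  assumes "invariant_mod_hit f"
  shows "invariant_mod_hit (kameko f)"
  unfolding invariant_mod_hit_def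
proof (intro allI impI)
  fix A :: "bit ^ 'a ^ 'a" assume A: "invertible A"
  then have "linear_subst A f + f \<in> hit" using assms by (simp add: invariant_mod_hit_def)
  from kameko_hit[OF this] show "linear_subst A (kameko f) + kameko f \<in> hit"
    using A by (simp add: kameko_add kameko_linear_subst)
qed

subsection \<open>Conjugate squares\<close>

definition degree_part :: "nat \<Rightarrow> 'n::finite P \<Rightarrow> 'n P" where
  "degree_part d f = (\<Sum>m\<in>Poly_Mapping.keys f. if total_degree m = d then mon m else 0)"

lemma lookup_degree_part [simp]:
  "Poly_Mapping.lookup (degree_part d f) m = (if total_degree m = d then Poly_Mapping.lookup f m else 0)"
proof -
  have "Poly_Mapping.lookup (degree_part d f) m =
      (\<Sum>m'\<in>Poly_Mapping.keys f. if m' = m then if total_degree m = d then 1 else 0 else 0)"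
    unfolding degree_part_def lookup_sum by (rule sum.cong) (auto simp: lookup_single when_def)
  also have "\<dots> = (if m \<in> Poly_Mapping.keys f then if total_degree m = d then 1 else 0 else 0)"
    by simp
  also have "\<dots> = (if total_degree m = d then Poly_Mapping.lookup f m else 0)"
    by (cases "Poly_Mapping.lookup f m") (simp_all add: in_keys_iff)
  finally show ?thesis .
qed

lemma degree_part_add: "degree_part d (f + g) = degree_part d f + degree_part d g"
  by (intro poly_mapping_eqI) (simp add: lookup_add)

lemma degree_part_homogeneous: "homogeneous d f \<Longrightarrow> degree_part d f = f"
  by (intro poly_mapping_eqI) (auto simp: homogeneous_iff)

lemma homogeneous_degree_part: "homogeneous d (degree_part d f)"
  by (simp add: homogeneous_iff)

lemma total_degree_add: "total_degree (a + b) = total_degree a + total_degree b"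
  by (simp add: total_degree_def lookup_add sum.distrib)

lemma homogeneous_Sq_mon: "homogeneous (total_degree m + k) (Sq k (mon m))"
proof -
  have "total_degree m' = total_degree m + k"
    if "Poly_Mapping.lookup (Sq k (mon m)) m' \<noteq> 0" for m'
  proof -
    from that[unfolded Sq_mon lookup_sum] obtain b where
      "b \<in> {b. (\<forall>i. b i \<le> Poly_Mapping.lookup m i) \<and> sum b UNIV = k}"
      "Poly_Mapping.lookup (of_nat (\<Prod>i\<in>UNIV. Poly_Mapping.lookup m i choose b i) * mon (m + expo b)) m' \<noteq> 0"
      by (rule sum.not_neutral_contains_not_neutral)
    then have b: "sum b UNIV = k"
      "Poly_Mapping.lookup (of_nat (\<Prod>i\<in>UNIV. Poly_Mapping.lookup m i choose b i) * mon (m + expo b)) m' \<noteq> 0"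
      by (simp_all only: mem_Collect_eq simp_thms)
    have "m' = m + expo b"
    proof (rule ccontr)
      assume "m' \<noteq> m + expo b"
      with b(2) show False by (simp only: lookup_of_nat_mult_mon if_False simp_thms eq_commute[of m'])
    qed
    then show ?thesis using b(1) by (simp add: total_degree_add) (simp add: total_degree_def)
  qed
  then show ?thesis by (simp add: homogeneous_iff)
qed

lemma degree_part_other: "homogeneous e f \<Longrightarrow> e \<noteq> d \<Longrightarrow> degree_part d f = 0"
  by (intro poly_mapping_eqI) (auto simp: homogeneous_iff)

lemma degree_part_hit:
  fixes f :: "'n::finite P"
  assumes "f \<in> hit"
  shows "degree_part d f \<in> hit"
  using assms
proof (induction rule: hit_induct)
  case zero
  have "degree_part d (0 :: 'n P) = 0" by (intro poly_mapping_eqI) simp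
  then show ?case by simp
next
  case (add k m f)
  have "degree_part d (Sq k (mon m)) \<in> hit"
    using homogeneous_Sq_mon[of m k] add(1)
    by (cases "total_degree m + k = d") (auto simp: degree_part_homogeneous degree_part_other hit_Sq)
  then show ?case using add by (simp add: degree_part_add hit_add)
qed

lemma total_degree_odd_exp:
  "total_degree (odd_exp a :: 'n::finite \<Rightarrow>\<^sub>0 nat) = 2 * total_degree a + CARD('n)"
  unfolding total_degree_def lookup_odd_exp sum.distrib sum_distrib_left[symmetric] by simp

lemma kameko_degree_part:
  "kameko (degree_part (2 * d + CARD('n)) f) = degree_part d (kameko (f :: 'n::finite P))"
  by (intro poly_mapping_eqI) (simp add: total_degree_odd_exp)

lemma homogeneous_kameko:
  "homogeneous (2 * d + CARD('n)) f \<Longrightarrow> homogeneous d (kameko (f :: 'n::finite P))"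
  by (metis degree_part_homogeneous homogeneous_degree_part kameko_degree_part)

text \<open>A right inverse of \<open>kameko\<close>. It does not commute with the squares, but
  \<open>kameko_up_hit\<close> controls the error in large degrees.\<close>

definition kameko_up :: "'n::finite P \<Rightarrow> 'n P" where
  "kameko_up g = g ^ 2 * mon (odd_exp 0)"

lemma kameko_kameko_up: "kameko (kameko_up g) = g"
  by (simp add: kameko_up_def kameko_square_mult kameko_mon_odd_exp)

lemma kameko_up_add: "kameko_up (f + g) = kameko_up f + kameko_up g"
  by (simp add: kameko_up_def P_square_add distrib_right)

lemma homogeneous_add: "homogeneous d f \<Longrightarrow> homogeneous d g \<Longrightarrow> homogeneous d (f + g)"
  unfolding homogeneous_iff lookup_add by (metis add.right_neutral)

lemma homogeneous_kameko_up:
  assumes "homogeneous d (g :: 'n::finite P)"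
  shows "homogeneous (2 * d + CARD('n)) (kameko_up g)"
proof -
  have "kameko_up g = (\<Sum>m\<in>Poly_Mapping.keys g. mon (odd_exp m))"
  proof -
    have "kameko_up (sum F K) = (\<Sum>m\<in>K. kameko_up (F m))" for F :: "('n \<Rightarrow>\<^sub>0 nat) \<Rightarrow> 'n P" and K
      by (induction K rule: infinite_finite_induct) (simp_all add: kameko_up_add, simp_all add: kameko_up_def)
    moreover have "kameko_up (mon m) = mon (odd_exp m)" for m :: "'n \<Rightarrow>\<^sub>0 nat"
    proof -
      have "m + m + odd_exp 0 = odd_exp m" by (intro poly_mapping_eqI) (simp add: lookup_add)
      then show ?thesis by (simp add: kameko_up_def mon_power2 mult_single)
    qed
    ultimately show ?thesis by (subst P_eq_sum_mon) simp
  qed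
  moreover have "homogeneous (2 * d + CARD('n)) (\<Sum>m\<in>K. mon (odd_exp m))"
    if "K \<subseteq> Poly_Mapping.keys g" for K
    using that
  proof (induction K rule: infinite_finite_induct)
    case (insert x F)
    have "total_degree x = d" using assms insert.prems by (simp add: homogeneous_def total_degree_def)
    then have "homogeneous (2 * d + CARD('n)) (mon (odd_exp x))"
      by (simp add: homogeneous_iff lookup_single when_def total_degree_odd_exp split: if_splits)
    then show ?case using insert by (simp add: homogeneous_add)
  qed (simp_all add: homogeneous_def)
  ultimately show ?thesis by simp
qed

text \<open>
  The conjugate squares enter through \<open>total_square_conv\<close>: a power series \<open>R\<close> with
  \<open>total_square_conv R = fps_const u\<close> has the conjugate squares of \<open>u\<close> as coefficients.
\<close>

definition total_square_conv :: "'n::finite P fps \<Rightarrow> 'n P fps" where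
  "total_square_conv F = Abs_fps (\<lambda>n. \<Sum>a\<le>n. Sq (n - a) (fps_nth F a))"

lemma total_square_conv_mult:
  "total_square_conv (F * G) = total_square_conv F * total_square_conv G"
proof (rule fps_ext)
  fix n
  let ?f = "fps_nth F" and ?g = "fps_nth G"
  have "fps_nth (total_square_conv (F * G)) n =
      (\<Sum>a\<le>n. \<Sum>i\<le>a. \<Sum>l\<le>n - a. Sq l (?f i) * Sq (n - a - l) (?g (a - i)))"
    by (simp add: total_square_conv_def fps_mult_nth Sq_sum Sq_simps atLeast0AtMost)
  also have "\<dots> = (\<Sum>(a, i, l)\<in>(SIGMA a:{..n}. {..a} \<times> {..n - a}). Sq l (?f i) * Sq (n - a - l) (?g (a - i)))"
    by (simp add: sum.Sigma sum.cartesian_product)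
  \<comment> \<open>Substitution p = i + l, j = a - i: p is the part of the degree that belongs to
    the first factor.\<close>
  also have "\<dots> = (\<Sum>(p, i, j)\<in>(SIGMA p:{..n}. {..p} \<times> {..n - p}). Sq (p - i) (?f i) * Sq (n - p - j) (?g j))"
    by (rule sum.reindex_bij_witness[where i = "\<lambda>(p, i, j). (i + j, i, p - i)" and j = "\<lambda>(a, i, l). (i + l, i, a - i)"])
      (auto simp: diff_diff_add add.commute)
  also have "\<dots> = (\<Sum>p\<le>n. \<Sum>i\<le>p. \<Sum>j\<le>n - p. Sq (p - i) (?f i) * Sq (n - p - j) (?g j))"
    by (simp add: sum.Sigma sum.cartesian_product)
  also have "\<dots> = fps_nth (total_square_conv F * total_square_conv G) n"
    by (simp add: total_square_conv_def fps_mult_nth sum_product atLeast0AtMost)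
  finally show "fps_nth (total_square_conv (F * G)) n = fps_nth (total_square_conv F * total_square_conv G) n" .
qed

text \<open>The series x + x^2 t + x^4 t^3 + x^8 t^7 + ..., the total conjugate square of a
  variable.\<close>

definition conj_var :: "'n \<Rightarrow> 'n::finite P fps" where
  "conj_var i = Abs_fps (\<lambda>n. if \<exists>j. Suc n = 2 ^ j then X i ^ Suc n else 0)"

lemma Sq_X_power: "Sq b (X i ^ (2 ^ j)) = (if b = 0 then X i ^ (2 ^ j) else if b = 2 ^ j then X i ^ (2 ^ Suc j) else 0)"
proof (induction j arbitrary: b)
  case 0
  show ?case by (simp add: Sq_eq_coeff total_square_simps coeff_pCons split: nat.split)
next
  case (Suc j)
  have p: "X i ^ (2 ^ Suc k) = (X i ^ (2 ^ k)) ^ 2" for k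
    by (simp add: mult.commute flip: power_mult)
  have "Sq b (X i ^ (2 ^ Suc j)) = (if even b then Sq (b div 2) (X i ^ (2 ^ j)) ^ 2 else 0)"
    unfolding p Sq_square ..
  also have "\<dots> = (if b = 0 then X i ^ (2 ^ Suc j) else if b = 2 ^ Suc j then X i ^ (2 ^ Suc (Suc j)) else 0)"
  proof (cases "even b")
    case True
    then obtain c where c: "b = 2 * c" by (elim evenE)
    then have "b div 2 = c" "b = 0 \<longleftrightarrow> c = 0" "b = 2 ^ Suc j \<longleftrightarrow> c = 2 ^ j" by auto
    then show ?thesis unfolding Suc p[of "Suc j"] p[of j] using True
      by (cases "c = 0"; cases "c = 2 ^ j") (simp_all only: if_True if_False power_zero_numeral simp_thms)
  next
    case False
    then have "b \<noteq> 0" "b \<noteq> 2 ^ Suc j" by (metis dvd_0_right, metis dvd_triv_left power_Suc)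
    then show ?thesis using False by (simp only: if_False)
  qed
  finally show ?case .
qed

text \<open>Telescoping: the total square of x^(2^j) is x^(2^j) + x^(2^(j+1)) t^(2^j), and its
  second term cancels the next term of the series.\<close>

lemma total_square_conv_var: "total_square_conv (conj_var i) = fps_const (X i)"
proof (rule fps_ext)
  fix n
  let ?r = "fps_nth (conj_var i)"
  have Sq_r: "Sq b (?r a) = (if b = 0 then ?r a else if b = Suc a then ?r (2 * a + 1) else 0)" for a b
  proof (cases "\<exists>j. Suc a = 2 ^ j")
    case True
    then obtain j where j: "Suc a = 2 ^ j" by blast
    then have j': "Suc (2 * a + 1) = 2 ^ Suc j" by simp
    have r: "?r a = X i ^ (2 ^ j)" "?r (2 * a + 1) = X i ^ (2 ^ Suc j)"
    proof -
      have "\<exists>k. (2 :: nat) ^ l = 2 ^ k" for l by blast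
      then show "?r a = X i ^ (2 ^ j)" "?r (2 * a + 1) = X i ^ (2 ^ Suc j)"
        unfolding conj_var_def fps_nth_Abs_fps j j' by (simp_all only: if_True)
    qed
    show ?thesis unfolding r Sq_X_power j ..
  next
    case False
    have "\<nexists>j. Suc (2 * a + 1) = 2 ^ j"
    proof
      assume "\<exists>j. Suc (2 * a + 1) = 2 ^ j"
      then obtain j where j: "Suc (2 * a + 1) = 2 ^ j" by blast
      then obtain j' where "j = Suc j'" by (cases j) auto
      with j have "Suc a = 2 ^ j'" by simp
      with False show False by blast
    qed
    then show ?thesis using False by (simp add: conj_var_def)
  qed
  show "fps_nth (total_square_conv (conj_var i)) n = fps_nth (fps_const (X i)) n"
  proof (cases "n = 0")
    case True
    have "\<exists>j. Suc 0 = 2 ^ j" by (rule exI[of _ 0]) simp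
    then show ?thesis using True by (simp add: total_square_conv_def Sq_simps) (simp add: conj_var_def)
  next
    case False
    \<comment> \<open>The n-th coefficient arises from a = n and, if n = 2a + 1, a second time from
      the top square of the a-th term.\<close>
    have "fps_nth (total_square_conv (conj_var i)) n =
        (\<Sum>a\<le>n. (if a = n then ?r n else 0) + (if a = n div 2 \<and> odd n then ?r n else 0))"
      unfolding total_square_conv_def fps_nth_Abs_fps Sq_r
    proof (rule sum.cong, rule refl)
      fix a assume "a \<in> {..n}"
      then have "n - a = 0 \<longleftrightarrow> a = n" "n - a = Suc a \<longleftrightarrow> n = 2 * a + 1" by auto
      moreover have "a = n div 2 \<and> odd n \<longleftrightarrow> n = 2 * a + 1" by presburger
      ultimately show "(if n - a = 0 then ?r a else if n - a = Suc a then ?r (2 * a + 1) else 0) =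
          (if a = n then ?r n else 0) + (if a = n div 2 \<and> odd n then ?r n else 0)"
        by auto
    qed
    also have "\<dots> = ?r n + (if odd n then ?r n else 0)"
      by (cases "odd n") (simp_all add: sum.distrib)
    also have "\<dots> = 0"
    proof (cases "odd n")
      case False
      have "\<nexists>j. Suc n = 2 ^ j"
      proof
        assume "\<exists>j. Suc n = 2 ^ j"
        then obtain j where j: "Suc n = 2 ^ j" by blast
        then obtain j' where "j = Suc j'" using \<open>n \<noteq> 0\<close> by (cases j) auto
        with j have "even (Suc n)" by simp
        with False show False by simp
      qed
      then show ?thesis using False by (simp add: conj_var_def)
    qed simp
    finally show ?thesis using False by simp
  qed
qed

lemma total_square_conv_const: "fps_nth (total_square_conv (fps_const v)) n = Sq n v"
proof -
  have "(\<Sum>a\<le>n. Sq (n - a) (fps_nth (fps_const v) a)) = (\<Sum>a\<le>n. if a = 0 then Sq n v else 0)"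
    by (rule sum.cong) auto
  then show ?thesis by (simp add: total_square_conv_def)
qed

lemma total_square_conv_prod:
  "finite S \<Longrightarrow> total_square_conv (\<Prod>i\<in>S. conj_var i) = fps_const (\<Prod>i\<in>S. X i)"
proof (induction S rule: finite_induct)
  case empty
  have "fps_nth (total_square_conv (fps_const 1)) n = fps_nth (fps_const (1 :: 'a P)) n" for n
    unfolding total_square_conv_const by (simp add: Sq_eq_coeff total_square_simps one_pCons coeff_pCons split: nat.split)
  then show ?case by (simp add: fps_eq_iff)
qed (simp add: total_square_conv_mult total_square_conv_var fps_const_mult[symmetric] del: fps_const_mult)

text \<open>With R the conjugate series of the product u, multiplicativity writes u Sq^e(v) as the
  sum of Sq^(e-a)(R_a v) over a up to e. All terms except a = e are hit.\<close>

lemma prod_X_mult_Sq_cong: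
  "(\<Prod>i\<in>S. X i) * Sq e v + fps_nth (\<Prod>i\<in>S. conj_var i) e * v \<in> hit"
proof -
  let ?R = "\<Prod>i\<in>S. conj_var i"
  have "(\<Prod>i\<in>S. X i) * Sq e v = fps_nth (total_square_conv (?R * fps_const v)) e"
    by (simp add: total_square_conv_mult total_square_conv_prod total_square_conv_const)
  also have "\<dots> = (\<Sum>a\<le>e. Sq (e - a) (fps_nth ?R a * v))"
    by (simp add: total_square_conv_def)
  also have "\<dots> = (\<Sum>a<e. Sq (e - a) (fps_nth ?R a * v)) + fps_nth ?R e * v"
    by (simp add: Sq_simps flip: lessThan_Suc_atMost)
  finally have "(\<Prod>i\<in>S. X i) * Sq e v + fps_nth ?R e * v = (\<Sum>a<e. Sq (e - a) (fps_nth ?R a * v))"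
    by (simp add: add.assoc)
  also have "\<dots> \<in> hit" by (intro hit_sum hit_Sq) simp
  finally show ?thesis .
qed

text \<open>A nonzero coefficient selects an exponent of the form 2^j - 1 from each factor, and
  these add up to \<open>e\<close>.\<close>

lemma conj_prod_nonzero:
  assumes "finite S" "fps_nth (\<Prod>i\<in>S. conj_var i) e \<noteq> 0"
  shows "\<exists>j. e + card S = (\<Sum>i\<in>S. 2 ^ j i)"
  using assms
proof (induction S arbitrary: e rule: finite_induct)
  case empty
  then show ?case by (cases e) auto
next
  case (insert x S)
  have "(\<Sum>a=0..e. fps_nth (conj_var x) a * fps_nth (\<Prod>i\<in>S. conj_var i) (e - a)) \<noteq> 0"
    using insert by (simp add: fps_mult_nth)
  then obtain a where a: "a \<le> e" "fps_nth (conj_var x) a \<noteq> 0" "fps_nth (\<Prod>i\<in>S. conj_var i) (e - a) \<noteq> 0"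
    by (metis (no_types, lifting) atLeastAtMost_iff mult_zero_left mult_zero_right sum.neutral)
  then obtain k where k: "Suc a = 2 ^ k" by (auto simp: conj_var_def split: if_splits)
  from insert.IH[OF a(3)] obtain j where j: "e - a + card S = (\<Sum>i\<in>S. 2 ^ j i)" by blast
  have "(\<Sum>i\<in>insert x S. (2 :: nat) ^ (j(x := k)) i) = 2 ^ k + (\<Sum>i\<in>S. 2 ^ j i)"
  proof -
    have "(\<Sum>i\<in>S. 2 ^ (j(x := k)) i) = (\<Sum>i\<in>S. (2 :: nat) ^ j i)"
      by (rule sum.cong) (use insert(2) in auto)
    then show ?thesis using insert(1,2) by simp
  qed
  also have "\<dots> = e + card (insert x S)"
    using j k a(1) insert(1,2) by (simp add: j[symmetric])
  finally show ?case by metis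
qed

lemma Sq_top_mon: "Sq (total_degree m) (mon m) = mon m ^ 2"
proof -
  have "{b. (\<forall>i. b i \<le> Poly_Mapping.lookup m i) \<and> sum b UNIV = total_degree m} = {Poly_Mapping.lookup m}"
  proof (intro equalityI subsetI)
    fix b assume "b \<in> {b. (\<forall>i. b i \<le> Poly_Mapping.lookup m i) \<and> sum b UNIV = total_degree m}"
    then have le: "b i \<le> Poly_Mapping.lookup m i" and s: "sum b UNIV = (\<Sum>i\<in>UNIV. Poly_Mapping.lookup m i)" for i
      by (auto simp: total_degree_def)
    have "b i = Poly_Mapping.lookup m i" for i
      using sum_mono_inv[OF s, of i] le by simp
    then show "b \<in> {Poly_Mapping.lookup m}" by auto
  qed (auto simp: total_degree_def)
  moreover have "expo (Poly_Mapping.lookup m) = m" by (intro poly_mapping_eqI) simp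
  ultimately show ?thesis unfolding Sq_mon by (simp add: mon_power2)
qed

text \<open>The top square of v = \<open>mon (half_exp m)\<close> is v^2, so
  \<open>prod_X_mult_Sq_cong\<close> applies to u v^2; its conjugate term vanishes by
  \<open>conj_prod_nonzero\<close>.\<close>

lemma mon_hit_if_not_sum_of_powers:
  fixes m :: "'n::finite \<Rightarrow>\<^sub>0 nat"
  defines "S \<equiv> {i. odd (Poly_Mapping.lookup m i)}"
  assumes "\<nexists>j. total_degree (half_exp m) + card S = (\<Sum>i\<in>S. 2 ^ j i)"
  shows "mon m \<in> hit"
proof -
  let ?e = "total_degree (half_exp m)"
  have "fps_nth (\<Prod>i\<in>S. conj_var i) ?e = 0"
    using assms(2) conj_prod_nonzero[of S ?e] by auto
  then have "(\<Prod>i\<in>S. X i) * Sq ?e (mon (half_exp m)) \<in> hit"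
    using prod_X_mult_Sq_cong[of S ?e "mon (half_exp m)"] by simp
  moreover have "mon (parity_exp m) = (\<Prod>i\<in>S. X i)"
  proof -
    have "X i ^ Poly_Mapping.lookup (parity_exp m) i = (if i \<in> S then X i else 1)" for i
      by (cases "odd (Poly_Mapping.lookup m i)") (simp_all add: S_def parity_exp_def odd_iff_mod_2_eq_one)
    then show ?thesis unfolding mon_eq_prod by (simp add: prod.If_cases)
  qed
  ultimately show ?thesis by (subst mon_decompose) (simp add: Sq_top_mon mult.commute)
qed

lemma total_degree_parity:
  "total_degree m = card {i. odd (Poly_Mapping.lookup m i)} + 2 * total_degree (half_exp m)"
proof -
  have "total_degree m = (\<Sum>i\<in>UNIV. (if odd (Poly_Mapping.lookup m i) then 1 else 0) + 2 * (Poly_Mapping.lookup m i div 2))"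
    unfolding total_degree_def by (rule sum.cong) (auto simp: odd_two_times_div_two_succ)
  also have "\<dots> = card {i. odd (Poly_Mapping.lookup m i)} + 2 * total_degree (half_exp m)"
    by (simp add: sum.distrib total_degree_def half_exp_def sum.If_cases flip: sum_distrib_left)
  finally show ?thesis .
qed

subsection \<open>All degrees\<close>

lemma power_2_parity: "odd ((2 :: nat) ^ a) \<longleftrightarrow> a = 0"
  by (cases a) auto

lemma not_two_powers_14: "(2 :: nat) ^ a + 2 ^ b \<noteq> 14"
proof
  assume s: "(2 :: nat) ^ a + 2 ^ b = 14"
  have "a < 4" "b < 4"
  proof -
    have "(2 :: nat) ^ a < 2 ^ 4" "(2 :: nat) ^ b < 2 ^ 4" using s by simp_all
    then show "a < 4" "b < 4" by (simp_all only: power_strict_increasing_iff one_less_numeral_iff semiring_norm)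
  qed
  then have "a \<in> {0, 1, 2, 3}" "b \<in> {0, 1, 2, 3}" by auto
  then show False using s by auto
qed

lemma power_plus_2_neq:
  assumes "r \<ge> 1"
  shows "(2 :: nat) ^ a + 2 \<noteq> 15 * 2 ^ r"
proof
  assume s: "2 ^ a + 2 = 15 * (2 :: nat) ^ r"
  obtain r' where r: "r = Suc r'" using assms by (cases r) auto
  have "even ((2 :: nat) ^ a + 2)" unfolding s r by simp
  then obtain a' where a: "a = Suc a'" using power_2_parity[of a] by (cases a) auto
  have s': "2 ^ a' + 1 = 15 * (2 :: nat) ^ r'" using s by (simp add: a r)
  show False
  proof (cases r')
    case 0
    then have "2 ^ a' = (14 :: nat)" using s' by simp
    then show False using not_two_powers_14[of "a' - 1" "a' - 1"] by (cases a') auto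
  next
    case (Suc r'')
    have "even ((2 :: nat) ^ a' + 1)" unfolding s' Suc by simp
    then have "a' = 0" using power_2_parity[of a'] by simp
    then have "(15 :: nat) * 2 ^ r' = 2" using s' by simp
    moreover have "(2 :: nat) ^ r' \<ge> 1" by simp
    ultimately show False by linarith
  qed
qed

text \<open>If both exponents are positive, halving gives 2^a' + 2^b' + 1 = 15 2^(r-1). For r = 1
  the two powers would add up to 14; for larger r parity makes one of them 1 and
  \<open>power_plus_2_neq\<close> applies.\<close>

lemma two_powers_plus_2_neq:
  assumes "r \<ge> 1"
  shows "(2 :: nat) ^ a + 2 ^ b + 2 \<noteq> 15 * 2 ^ r \<or> a = 0 \<or> b = 0"
proof (rule ccontr)
  assume "\<not> ?thesis"
  then obtain a' b' where ab: "a = Suc a'" "b = Suc b'" and s: "2 ^ a + 2 ^ b + 2 = 15 * (2 :: nat) ^ r"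
    by (metis not0_implies_Suc)
  obtain r' where r: "r = Suc r'" using assms by (cases r) auto
  have s': "2 ^ a' + 2 ^ b' + 1 = 15 * (2 :: nat) ^ r'" using s by (simp add: ab r)
  show False
  proof (cases r')
    case 0
    then show False using s' not_two_powers_14[of a' b'] by simp
  next
    case (Suc r'')
    have "even ((2 :: nat) ^ a' + 2 ^ b' + 1)" unfolding s' Suc by simp
    then have "(a' = 0) \<noteq> (b' = 0)" using power_2_parity[of a'] power_2_parity[of b'] by simp
    then have "2 ^ a' + 2 = 15 * (2 :: nat) ^ r' \<or> 2 ^ b' + 2 = 15 * (2 :: nat) ^ r'" using s' by auto
    then show False using power_plus_2_neq[of r'] Suc by auto
  qed
qed

text \<open>By parity one or all three of the powers are 1. For r = 0 there is the solution 8 + 4 +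
  2 + 1 = 15, which is why degree 25 is exceptional.\<close>

lemma three_powers_plus_1_neq:
  assumes "r \<ge> 1"
  shows "(2 :: nat) ^ a + 2 ^ b + 2 ^ c + 1 \<noteq> 15 * 2 ^ r"
proof
  assume s: "2 ^ a + 2 ^ b + 2 ^ c + 1 = 15 * (2 :: nat) ^ r"
  obtain r' where r: "r = Suc r'" using assms by (cases r) auto
  have "even ((2 :: nat) ^ a + 2 ^ b + 2 ^ c + 1)" unfolding s r by simp
  then consider "a = 0" "b = 0" "c = 0" | "a = 0" "b \<noteq> 0" "c \<noteq> 0" | "a \<noteq> 0" "b = 0" "c \<noteq> 0" | "a \<noteq> 0" "b \<noteq> 0" "c = 0"
    using power_2_parity[of a] power_2_parity[of b] power_2_parity[of c] by auto
  then show False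
  proof cases
    case 1
    then have "(15 :: nat) * 2 ^ r = 4" using s by simp
    moreover have "(2 :: nat) ^ r \<ge> 1" by simp
    ultimately show False by linarith
  next
    case 2
    then show False using s two_powers_plus_2_neq[OF assms, of b c] by simp
  next
    case 3
    then show False using s two_powers_plus_2_neq[OF assms, of a c] by simp
  next
    case 4
    then show False using s two_powers_plus_2_neq[OF assms, of a b] by simp
  qed
qed

text \<open>Monomials of \<open>f\<close> have an even exponent, and the degree is odd, so one or
  three exponents are odd. Escaping \<open>mon_hit_if_not_sum_of_powers\<close> would then require
  15 2^(s-1) to be 2^a + 2 or 2^a + 2^b + 2^c + 1.\<close>

lemma kameko_kernel_hit:
  fixes f :: "5 P"
  assumes "s \<ge> 2" "homogeneous (15 * 2 ^ s - 5) f" "kameko f = 0"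
  shows "f \<in> hit"
proof -
  obtain r where r: "s = Suc r" "r \<ge> 1" using assms(1) by (cases s) auto
  have big: "15 * 2 ^ s - 5 + 5 = (15 :: nat) * 2 ^ s" using one_le_power[of "2 :: nat" s] by simp
  have "mon m \<in> hit" if m: "m \<in> Poly_Mapping.keys f" for m
  proof (rule mon_hit_if_not_sum_of_powers, rule notI)
    let ?S = "{i. odd (Poly_Mapping.lookup m i)}"
    let ?e = "total_degree (half_exp m)"
    assume "\<exists>j. ?e + card ?S = (\<Sum>i\<in>?S. 2 ^ j i)"
    then obtain j where j: "?e + card ?S = (\<Sum>i\<in>?S. 2 ^ j i)" by blast
    have "total_degree m = 15 * 2 ^ s - 5" using assms(2) m by (simp add: homogeneous_def total_degree_def)
    then have deg: "card ?S + 2 * ?e + 5 = 15 * 2 ^ s" using total_degree_parity[of m] big by simp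
    have "?S \<noteq> UNIV"
    proof
      assume "?S = UNIV"
      then have "m = odd_exp (half_exp m)" using odd_exp_half[of m] by (auto simp: half_exp_def)
      then have "Poly_Mapping.lookup (kameko f) (half_exp m) = Poly_Mapping.lookup f m" by simp
      then show False using assms(3) m by (simp add: in_keys_iff)
    qed
    then have "card ?S < 5" using psubset_card_mono[of "UNIV :: 5 set" ?S] by auto
    moreover have "odd (card ?S)"
    proof -
      have "even (card ?S + 2 * ?e + 5)" unfolding deg r by simp
      then show ?thesis by simp
    qed
    ultimately have "card ?S = 1 \<or> card ?S = 3" by presburger
    then consider "card ?S = 1" | "card ?S = 3" by blast
    then show False
    proof cases
      case 1
      then obtain x where "?S = {x}" by (auto simp: card_1_singleton_iff)
      then have "?e + 1 = 2 ^ j x" using j by simp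
      moreover have "2 * ?e + 6 = 15 * 2 ^ s" using deg 1 by simp
      ultimately have "2 ^ j x + 2 = (15 :: nat) * 2 ^ r" by (simp add: r)
      then show False using power_plus_2_neq[OF r(2)] by blast
    next
      case 2
      then obtain x y w where S: "?S = {x, y, w}" "x \<noteq> y" "y \<noteq> w" "x \<noteq> w" by (auto simp: card_3_iff)
      then have "?e + 3 = 2 ^ j x + 2 ^ j y + 2 ^ j w" using j 2 by (simp add: S(1))
      moreover have "2 * ?e + 8 = 15 * 2 ^ s" using deg 2 by simp
      ultimately have "2 ^ j x + 2 ^ j y + 2 ^ j w + 1 = (15 :: nat) * 2 ^ r" by (simp add: r)
      then show False using three_powers_plus_1_neq[OF r(2)] by blast
    qed
  qed
  then have "(\<Sum>m\<in>Poly_Mapping.keys f. mon m) \<in> hit" by (rule hit_sum)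
  then show ?thesis by (simp flip: P_eq_sum_mon)
qed

text \<open>Generators may have any degree, hence the projection by \<open>degree_part\<close>,
  which lets \<open>kameko_kernel_hit\<close> absorb the error terms.\<close>

lemma kameko_up_hit:
  fixes g :: "5 P"
  assumes "s \<ge> 2" "g \<in> hit"
  shows "degree_part (15 * 2 ^ s - 5) (kameko_up g) \<in> hit"
  using assms(2)
proof (induction rule: hit_induct)
  case zero
  have "kameko_up 0 = (0 :: 5 P)" by (simp add: kameko_up_def)
  then show ?case using degree_part_hit[OF hit_0] by simp
next
  case (add k m f)
  obtain r where r: "s = Suc r" using assms(1) by (cases s) auto
  define d where "d = (15 :: nat) * 2 ^ r - 5"
  have d: "15 * 2 ^ s - 5 = 2 * d + CARD(5)"
  proof -
    have "(2 :: nat) ^ r \<ge> 1" by simp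
    then have "2 * (15 * 2 ^ r) - 5 = 2 * (15 * 2 ^ r - 5) + (5 :: nat)" by linarith
    then show ?thesis by (simp add: r d_def)
  qed
  let ?u = "mon (odd_exp 0) :: 5 P" and ?g = "mon m"
  let ?w = "\<Sum>i<2 * k. Sq i (?g ^ 2) * Sq (2 * k - i) ?u"
  \<comment> \<open>The last Cartan term is \<open>kameko_up (Sq k ?g)\<close>; the others put a
    positive square on the product of all variables and lie in the kernel of
    \<open>kameko\<close>.\<close>
  have "Sq (2 * k) (?g ^ 2 * ?u) = ?w + Sq (2 * k) (?g ^ 2) * ?u"
    by (simp add: Sq_simps flip: lessThan_Suc_atMost)
  then have up: "kameko_up (Sq k ?g) = Sq (2 * k) (?g ^ 2 * ?u) + ?w"
    by (simp add: kameko_up_def Sq_square add_ac)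
  have "kameko ?w = 0"
    unfolding kameko_sum
  proof (rule sum.neutral, rule ballI)
    fix i assume "i \<in> {..<2 * k}"
    then have "kameko (Sq (2 * k - i) ?u) = 0"
      by (intro kameko_Sq_squarefree) auto
    then show "kameko (Sq i (?g ^ 2) * Sq (2 * k - i) ?u) = 0"
      by (simp add: Sq_square kameko_square_mult)
  qed
  then have "kameko (degree_part (15 * 2 ^ s - 5) ?w) = 0"
    unfolding d kameko_degree_part by (intro poly_mapping_eqI) simp
  then have "degree_part (15 * 2 ^ s - 5) ?w \<in> hit"
    by (intro kameko_kernel_hit[OF assms(1) homogeneous_degree_part])
  moreover have "degree_part (15 * 2 ^ s - 5) (Sq (2 * k) (?g ^ 2 * ?u)) \<in> hit"
    using add(1) by (intro degree_part_hit hit_Sq) simp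
  ultimately show ?case using add by (simp add: kameko_up_add up degree_part_add hit_add)
qed

lemma invariant_hit:
  fixes f :: "5 P"
  assumes "homogeneous (15 * 2 ^ s - 5) f" "invariant_mod_hit f"
  shows "f \<in> hit"
  using assms
proof (induction s arbitrary: f)
  case 0
  then show ?case using invariant_hit_10_25[of 10 f] by simp
next
  case (Suc r)
  show ?case
  proof (cases r)
    case 0
    then show ?thesis using invariant_hit_10_25[of 25 f] Suc.prems by simp
  next
    case (Suc r')
    let ?d = "15 * 2 ^ Suc r - 5 :: nat"
    have s: "Suc r \<ge> 2" using Suc by simp
    have d: "?d = 2 * (15 * 2 ^ r - 5) + CARD(5)"
    proof -
      have "(2 :: nat) ^ r \<ge> 1" by simp
      then have "2 * (15 * 2 ^ r) - 5 = 2 * (15 * 2 ^ r - 5) + (5 :: nat)" by linarith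
      then show ?thesis by simp
    qed
    have hom: "homogeneous (15 * 2 ^ r - 5) (kameko f)"
      using Suc.prems(1) unfolding d by (rule homogeneous_kameko)
    then have "kameko f \<in> hit" using Suc.IH invariant_mod_hit_kameko[OF Suc.prems(2)] by blast
    from kameko_up_hit[OF s this] have up: "kameko_up (kameko f) \<in> hit"
      using degree_part_homogeneous[OF homogeneous_kameko_up[OF hom]] by (simp only: d)
    \<comment> \<open>This element lies in the kernel of \<open>kameko\<close>, so \<open>f\<close>
      is congruent to the lift of \<open>kameko f\<close>, which is hit by induction and
      \<open>kameko_up_hit\<close>.\<close>
    have "f + kameko_up (kameko f) \<in> hit"
    proof (rule kameko_kernel_hit[OF s])
      show "homogeneous ?d (f + kameko_up (kameko f))"
        using Suc.prems(1) homogeneous_kameko_up[OF hom] unfolding d by (intro homogeneous_add)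
      show "kameko (f + kameko_up (kameko f)) = 0" by (simp add: kameko_add kameko_kameko_up)
    qed
    then show ?thesis using up by (rule hit_add_cancel)
  qed
qed

lemma QP_class_eq_iff: "QP_class f = QP_class g \<longleftrightarrow> f - g \<in> hit"
  by transfer rule

theorem theorem5p1:
  fixes s :: nat
  shows "(QP_invariants (15 * 2 ^ s - 5) :: 5 QP set) = {0}"
proof (intro equalityI subsetI)
  fix q :: "5 QP" assume "q \<in> QP_invariants (15 * 2 ^ s - 5)"
  then obtain f :: "5 P" where f: "homogeneous (15 * 2 ^ s - 5) f" "q = QP_class f"
    and inv: "\<And>A :: bit ^ 5 ^ 5. invertible A \<Longrightarrow> QP_act A q = q"
    by (auto simp: QP_invariants_def QP_deg_def)
  have "QP_act A (QP_class f) = QP_class (linear_subst A f)" for A by transfer (simp add: hit_def P.span_zero)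
  then have "invariant_mod_hit f"
    using inv unfolding invariant_mod_hit_def f(2) by (simp add: QP_class_eq_iff diff_P)
  then have "f \<in> hit" using f(1) by (intro invariant_hit)
  then have "QP_class f = QP_class 0" by (simp add: QP_class_eq_iff)
  moreover have "QP_class 0 = (0 :: 5 QP)" by (simp add: QP_class_def zero_QP_def)
  ultimately show "q \<in> {0}" by (simp add: f(2))
next
  fix q :: "5 QP" assume "q \<in> {0}"
  have z: "QP_class 0 = (0 :: 5 QP)" by (simp add: QP_class_def zero_QP_def)
  have "QP_act A (QP_class 0) = (QP_class 0 :: 5 QP)" for A
    by transfer (simp add: linear_subst_simps hit_def P.span_zero)
  moreover have "homogeneous (15 * 2 ^ s - 5) (0 :: 5 P)" by (simp add: homogeneous_def)
  ultimately show "q \<in> QP_invariants (15 * 2 ^ s - 5)"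
    using \<open>q \<in> {0}\<close> z by (auto simp: QP_invariants_def QP_deg_def intro!: image_eqI[of _ _ 0])
qed

end
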